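(* Let $n\ge 2$, let $\Omega\subset\mathbb{R}^n$ be a smooth, bounded and strictly convex domain, and let $u$ be the solution (strictly convex and smooth on $\overline{\Omega}$) of the Dirichlet problem $$\det D^2u=1\ \text{ in }\Omega,\qquad u=0\ \text{ on }\partial\Omega .$$ Let $K$ and $H$ be the Gauss curvature and the mean curvature of the level sets of $u$, and let $\kappa_m$, $\kappa_M$ be the minimal and maximal principal curvatures of the level set of $u$ at a point. Then the functions $K|Du|^{n+1}$ and $H|Du|^{3}$ (on $\overline{\Omega}$) attain their maximum only at the boundary $\partial\Omega$. Consequently, for every constant $c\in(\min_{\Omega}u,0)$, setting $\Omega'=\{x\in\Omega : u(x)<c\}$, for all $x\in\Omega\setminus\Omega'$ the following estimates hold: $$K(x)<\frac{\max_{\partial\Omega}K\ \max_{\partial\Omega'}\kappa_M^{\,n+1}}{\min_{\partial\Omega}\kappa_m^{\,n+1}}$$ and $$H(x)<\frac{\max_{\partial\Omega}H\ \max_{\partial\Omega'}\kappa_M^{\,n+1}}{\min_{\partial\Omega}\kappa_m^{\,n+1}} .$$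
   Context: Subscripts denote partial derivatives: $u_k=\partial u/\partial x_k$, $u_{kl}=\partial^2u/\partial x_k\partial x_l$; $Du$ is the gradient and $D^2u=(u_{kl})$ the Hessian matrix. "Strictly convex" for $u$ means that $D^2u$ is positive definite. For a symmetric $n\times n$ matrix $W$ with eigenvalues $\lambda_1,\dots,\lambda_n$, $\sigma_k(W)=\sum_{1\le i_1<\cdots<i_k\le n}\lambda_{i_1}\cdots\lambda_{i_k}$; derivatives $\partial\sigma_k(D^2u)/\partial u_{kl}$ are taken treating the $n^2$ matrix entries as independent variables. The level set of $u$ through a point $x$ with $Du(x)\ne0$ is $\{u=u(x)\}$ (for $x\in\partial\Omega$ it is $\partial\Omega$, and $\partial\Omega'=\{u=c\}$). Its principal curvatures are taken with respect to the normal direction $-Du$, so that they are nonnegative for these convex hypersurfaces (a sphere of radius $r$ has all principal curvatures $1/r$). The mean curvature (sum of the principal curvatures) and Gauss curvature (product of the principal curvatures) of the level sets are given by $$H=\sum_{k,l=1}^n\frac{\partial\sigma_2(D^2u)}{\partial u_{kl}}u_ku_l\,|Du|^{-3},\qquad K=\sum_{k,l=1}^n\frac{\partial\sigma_n(D^2u)}{\partial u_{kl}}u_ku_l\,|Du|^{-n-1}.$$ At the unique critical point of $u$, the functions $K|Du|^{n+1}$ and $H|Du|^3$ are understood as $\sum_{k,l}\frac{\partial\sigma_n(D^2u)}{\partial u_{kl}}u_ku_l$ and $\sum_{k,l}\frac{\partial\sigma_2(D^2u)}{\partial u_{kl}}u_ku_l$, i.e. they equal $0$ there. *)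

theory Defs
  imports "HOL-Analysis.Analysis"
begin

text \<open>
  Partial derivatives are taken within a set \<open>S\<close>, which is either open or the closure of a
  convex domain. Such a set determines the derivative at each of its points uniquely: at interior
  points it is the ordinary derivative, and at boundary points the one-sided one, that is, the
  continuous extension from the interior.
\<close>

definition pderiv_within :: "(real^'n) set \<Rightarrow> 'n \<Rightarrow> (real^'n \<Rightarrow> real) \<Rightarrow> real^'n \<Rightarrow> real" where
  "pderiv_within S k f x = frechet_derivative f (at x within S) (axis k 1)"

fun iter_pderiv_within :: "(real^'n) set \<Rightarrow> 'n list \<Rightarrow> (real^'n \<Rightarrow> real) \<Rightarrow> real^'n \<Rightarrow> real" where
  "iter_pderiv_within S [] f = f"
| "iter_pderiv_within S (k # ks) f = pderiv_within S k (iter_pderiv_within S ks f)"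

text \<open>
  For the closure \<open>S\<close> of a bounded convex domain, being differentiable within \<open>S\<close> to all orders is
  the same as being smooth inside with all derivatives extending continuously to \<open>S\<close>.
\<close>

definition smooth_within :: "(real^'n) set \<Rightarrow> (real^'n \<Rightarrow> real) \<Rightarrow> bool" where
  "smooth_within S f \<longleftrightarrow>
     (\<forall>ks. \<forall>x\<in>S. iter_pderiv_within S ks f differentiable (at x within S))"

definition gradient :: "(real^'n) set \<Rightarrow> (real^'n \<Rightarrow> real) \<Rightarrow> real^'n \<Rightarrow> real^'n" where
  "gradient S u x = (\<chi> k. pderiv_within S k u x)"

definition hessian :: "(real^'n) set \<Rightarrow> (real^'n \<Rightarrow> real) \<Rightarrow> real^'n \<Rightarrow> real^'n^'n" where
  "hessian S u x = (\<chi> k l. pderiv_within S k (pderiv_within S l u) x)"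

definition positive_definite :: "real^'n^'n \<Rightarrow> bool" where
  "positive_definite A \<longleftrightarrow> transpose A = A \<and> (\<forall>v. v \<noteq> 0 \<longrightarrow> v \<bullet> (A *v v) > 0)"

definition strictly_convex_function :: "(real^'n) set \<Rightarrow> (real^'n \<Rightarrow> real) \<Rightarrow> bool" where
  "strictly_convex_function S u \<longleftrightarrow> (\<forall>x\<in>S. positive_definite (hessian S u x))"

definition smooth_boundary :: "(real^'n) set \<Rightarrow> bool" where
  "smooth_boundary D \<longleftrightarrow>
     (\<forall>p\<in>frontier D. \<exists>U \<rho>. open U \<and> p \<in> U \<and> smooth_within U \<rho> \<and>
        (\<forall>x\<in>U. gradient U \<rho> x \<noteq> 0) \<and>
        D \<inter> U = {x\<in>U. \<rho> x < 0} \<and> frontier D \<inter> U = {x\<in>U. \<rho> x = 0})"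

definition strictly_convex_domain :: "(real^'n) set \<Rightarrow> bool" where
  "strictly_convex_domain D \<longleftrightarrow> open D \<and> connected D \<and> D \<noteq> {} \<and>
     (\<forall>x\<in>closure D. \<forall>y\<in>closure D. x \<noteq> y \<longrightarrow> open_segment x y \<subseteq> D)"

text \<open>
  The eigenvalues with algebraic multiplicity, enumerated by the index type in some order. They are
  complex because differentiating \<open>\<sigma>\<^sub>k\<close> with respect to a single matrix entry leaves the
  symmetric matrices; the elementary symmetric functions of the eigenvalues of a real matrix are
  real, so taking the real part below loses nothing.
\<close>

definition eigenvalues :: "real^'n^'n \<Rightarrow> 'n \<Rightarrow> complex" where
  "eigenvalues W =
     (SOME ev. \<forall>t. det (mat t - (\<chi> i j. complex_of_real (W $ i $ j))) = (\<Prod>i\<in>UNIV. t - ev i))"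

definition elem_sym :: "nat \<Rightarrow> real^'n^'n \<Rightarrow> real" where
  "elem_sym k W = Re (\<Sum>I | I \<subseteq> UNIV \<and> card I = k. \<Prod>i\<in>I. eigenvalues W i)"

definition elem_sym_pderiv :: "nat \<Rightarrow> real^'n^'n \<Rightarrow> 'n \<Rightarrow> 'n \<Rightarrow> real" where
  "elem_sym_pderiv m W k l =
     deriv (\<lambda>t. elem_sym m (\<chi> i j. if i = k \<and> j = l then t else W $ i $ j)) (W $ k $ l)"

text \<open>
  Curvatures of the level set of \<open>u\<close> through \<open>x\<close>. Where the gradient vanishes, division by zero
  gives them the value \<open>0\<close>, so \<open>K|Du|\<^sup>n\<^sup>+\<^sup>1\<close> and \<open>H|Du|\<^sup>3\<close> are \<open>0\<close> there, and elsewhere these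
  products are the sums in the numerators.
\<close>

definition mean_curvature :: "(real^'n) set \<Rightarrow> (real^'n \<Rightarrow> real) \<Rightarrow> real^'n \<Rightarrow> real" where
  "mean_curvature S u x =
     (\<Sum>k\<in>UNIV. \<Sum>l\<in>UNIV. elem_sym_pderiv 2 (hessian S u x) k l *
        gradient S u x $ k * gradient S u x $ l) / norm (gradient S u x) ^ 3"

definition gauss_curvature :: "(real^'n) set \<Rightarrow> (real^'n \<Rightarrow> real) \<Rightarrow> real^'n \<Rightarrow> real" where
  "gauss_curvature S u x =
     (\<Sum>k\<in>UNIV. \<Sum>l\<in>UNIV. elem_sym_pderiv CARD('n) (hessian S u x) k l *
        gradient S u x $ k * gradient S u x $ l) / norm (gradient S u x) ^ (CARD('n) + 1)"

text \<open>
  The principal curvatures with respect to the unit normal \<open>N = -Du/|Du|\<close> are the eigenvalues, on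
  the tangent space of the level set, of the Weingarten map \<open>-dN = d(Du/|Du|)\<close>. For a sphere of
  radius \<open>r\<close> and \<open>u\<close> increasing outwards they are all \<open>1/r\<close>.
\<close>

definition weingarten :: "(real^'n) set \<Rightarrow> (real^'n \<Rightarrow> real) \<Rightarrow> real^'n \<Rightarrow> real^'n \<Rightarrow> real^'n" where
  "weingarten S u x = frechet_derivative (\<lambda>y. sgn (gradient S u y)) (at x within S)"

definition principal_curvatures :: "(real^'n) set \<Rightarrow> (real^'n \<Rightarrow> real) \<Rightarrow> real^'n \<Rightarrow> real set" where
  "principal_curvatures S u x =
     {\<kappa>. \<exists>v. v \<noteq> 0 \<and> v \<bullet> gradient S u x = 0 \<and> weingarten S u x v = \<kappa> *\<^sub>R v}"

definition min_curvature :: "(real^'n) set \<Rightarrow> (real^'n \<Rightarrow> real) \<Rightarrow> real^'n \<Rightarrow> real" where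
  "min_curvature S u x = Min (principal_curvatures S u x)"

definition max_curvature :: "(real^'n) set \<Rightarrow> (real^'n \<Rightarrow> real) \<Rightarrow> real^'n \<Rightarrow> real" where
  "max_curvature S u x = Max (principal_curvatures S u x)"

definition attains_max_only_on :: "('a \<Rightarrow> real) \<Rightarrow> 'a set \<Rightarrow> 'a set \<Rightarrow> bool" where
  "attains_max_only_on f A B \<longleftrightarrow>
     (\<exists>x\<in>A. \<forall>y\<in>A. f y \<le> f x) \<and> (\<forall>x\<in>A. (\<forall>y\<in>A. f y \<le> f x) \<longrightarrow> x \<in> B)"

end

theory Submission
  imports Defs "HOL-Computational_Algebra.Fundamental_Theorem_Algebra"
begin

text \<open>
  Write \<open>A = D\<^sup>2u\<close>, \<open>p = Du\<close>, \<open>w = A\<inverse>p\<close>, and let \<open>L\<close> be the linearized operator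
  \<open>\<Sum> u\<^sup>i\<^sup>j \<partial>\<^sub>i\<partial>\<^sub>j\<close>, where \<open>(u\<^sup>i\<^sup>j) = A\<inverse>\<close>. Because \<open>det A = 1\<close>, the two functions of the theorem
  are \<open>\<phi> = p \<bullet> w\<close> for \<open>K|Du|\<^sup>n\<^sup>+\<^sup>1\<close> and \<open>\<psi> = tr A |p|\<^sup>2 - p \<bullet> Ap\<close> for \<open>H|Du|\<^sup>3\<close>.

  Both are strictly subharmonic for \<open>L\<close>. Let \<open>Q(v)\<close> be the squared norm of the matrix
  \<open>\<partial>\<^sub>vA\<close> measured with \<open>A\<inverse>\<close>. Differentiating \<open>det A = 1\<close> once and twice gives
  \<open>tr (A\<inverse> \<partial>\<^sub>vA) = 0\<close> and \<open>tr (A\<inverse> \<partial>\<^sub>v\<partial>\<^sub>vA) = Q(v)\<close> (\<open>first_variation_of_det\<close>,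
  \<open>second_variation_of_det\<close>). With the symmetry of the third and fourth derivatives of \<open>u\<close>
  these identities yield \<open>L\<phi> = 2n + Q(w)\<close> and
  \<open>L\<psi> = |p|\<^sup>2 (\<Sum>\<^sub>k Q(e\<^sub>k)) - Q(p) + 2 ((tr A)\<^sup>2 - tr A\<^sup>2)\<close> with the standard basis \<open>e\<^sub>k\<close>, where the
  first difference is nonnegative by the Cauchy-Schwarz inequality and the last bracket is positive. At an interior maximum
  \<open>L\<close> would be nonpositive (\<open>\<phi>_no_interior_max\<close>, \<open>\<psi>_no_interior_max\<close>).

  To pass from \<open>\<phi>\<close> and \<open>\<psi>\<close> to \<open>K\<close> and \<open>H\<close> one needs bounds for \<open>|Du|\<close>. By Blaschke's rolling
  theorem a ball of radius \<open>R = 1 / min \<kappa>\<^sub>m\<close> tangent to \<open>\<partial>\<Omega>\<close> contains \<open>\<Omega>\<close>, and a ball of radius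
  \<open>r = 1 / max \<kappa>\<^sub>M\<close> tangent to the level set \<open>{u = c}\<close> from inside is contained in \<open>{u \<le> c}\<close>. The
  paraboloids \<open>|x - a|\<^sup>2 / 2\<close> have Hessian determinant \<open>1\<close>, so comparing \<open>u\<close> with them on these
  balls gives \<open>|Du| \<le> R\<close> on \<open>\<partial>\<Omega>\<close> (\<open>boundary_gradient_upper_bound\<close>) and \<open>|Du| \<ge> r\<close> on \<open>{u = c}\<close>
  (\<open>gradient_lower_bound\<close>). By convexity the lower bound persists where \<open>u \<ge> c\<close>
  (\<open>gradient_larger_above_level\<close>). The maximum of \<open>K|Du|\<^sup>n\<^sup>+\<^sup>1\<close> is therefore at most
  \<open>max K R\<^sup>n\<^sup>+\<^sup>1\<close>, and dividing by \<open>|Du(x)|\<^sup>n\<^sup>+\<^sup>1 \<ge> r\<^sup>n\<^sup>+\<^sup>1\<close> proves the estimate for \<open>K\<close>. The same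
  argument bounds \<open>H\<close> by \<open>max H (R/r)\<^sup>3\<close>, and \<open>r \<le> R\<close>, again by the two gradient bounds, so
  that the exponent \<open>3\<close> can be raised to \<open>n + 1\<close>.

  The rolling theorem is proved by a monotonicity argument. For a vector \<open>\<theta> \<noteq> 0\<close> let \<open>X(\<theta>)\<close> be the
  point of \<open>{u \<le> c}\<close> farthest in direction \<open>\<theta>\<close>. A second-order expansion shows that \<open>X - \<rho> sgn\<close> is
  locally monotone if all principal curvatures are below \<open>1/\<rho>\<close>, and locally antitone if they are
  above (\<open>local_rolling\<close>). Local monotonicity along a segment adds up to global monotonicity
  (\<open>rolling_along_segment\<close>), which is an inequality between support functions and hence an
  inclusion of a ball.
\<close>

section \<open>Symmetric and positive definite matrices\<close>

text \<open>
  A maximizer \<open>v\<close> of the Rayleigh quotient on the unit sphere of \<open>V\<close> is an eigenvector: moving from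
  \<open>v\<close> in the direction of the defect \<open>f v - c v\<close>, which is orthogonal to \<open>v\<close>, would otherwise
  increase the quotient to first order.
\<close>

lemma selfadjoint_eigenvector_exists:
  fixes f :: "'a::euclidean_space \<Rightarrow> 'a"
  assumes V: "subspace V" "V \<noteq> {0}" and lin: "linear f" and inv: "\<And>v. v \<in> V \<Longrightarrow> f v \<in> V"
    and sa: "\<And>v w. v \<in> V \<Longrightarrow> w \<in> V \<Longrightarrow> f v \<bullet> w = v \<bullet> f w"
  obtains v c where "v \<in> V" "norm v = 1" "f v = c *\<^sub>R v"
proof -
  let ?K = "V \<inter> sphere 0 1"
  obtain z where z: "z \<in> V" "z \<noteq> 0"
    using V subspace_0 by blast
  then have "sgn z \<in> ?K"
    using V(1) by (auto simp: sgn_div_norm subspace_scale)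
  moreover have "compact ?K"
    using closed_subspace[OF V(1)] by (simp add: closed_Int_compact)
  moreover have "continuous_on ?K (\<lambda>v. v \<bullet> f v)"
    using lin by (intro continuous_intros linear_continuous_on linear_conv_bounded_linear[THEN iffD1])
  ultimately obtain v where v: "v \<in> ?K" and vmax: "\<And>w. w \<in> ?K \<Longrightarrow> w \<bullet> f w \<le> v \<bullet> f v"
    using continuous_attains_sup[of ?K "\<lambda>v. v \<bullet> f v"] by blast
  define c where "c = v \<bullet> f v"
  have vv: "v \<in> V" "v \<bullet> v = 1"
    using v by (auto simp: dot_square_norm)
  have bound: "w \<bullet> f w \<le> c * (w \<bullet> w)" if "w \<in> V" for w
  proof (cases "w = 0")
    case False
    have "sgn w \<in> ?K"
      using V(1) that False by (auto simp: sgn_div_norm subspace_scale)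
    from vmax[OF this] have "(w \<bullet> f w) / (norm w)\<^sup>2 \<le> c"
      by (simp add: c_def sgn_div_norm linear_scale[OF lin] power2_eq_square divide_simps)
    then show ?thesis
      using False by (simp add: dot_square_norm divide_simps)
  qed (simp add: linear_0[OF lin])
  define w where "w = f v - c *\<^sub>R v"
  have w: "w \<in> V"
    using V(1) vv inv by (simp add: w_def subspace_diff subspace_scale)
  have wv: "w \<bullet> v = 0"
    using vv by (simp add: w_def inner_diff_left c_def inner_commute[of "f v" v])
  have wfv: "w \<bullet> f v = w \<bullet> w"
    using wv by (simp add: w_def inner_diff_right inner_diff_left inner_commute)
  have "2 * t * (w \<bullet> w) \<le> t\<^sup>2 * (c * (w \<bullet> w) - w \<bullet> f w)" for t
  proof -
    have "v + t *\<^sub>R w \<in> V"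
      using V(1) vv w by (simp add: subspace_add subspace_scale)
    from bound[OF this] show ?thesis
      using wv wfv sa[OF vv(1) w]
      by (simp add: linear_add[OF lin] linear_scale[OF lin] inner_simps power2_eq_square c_def[symmetric] vv
            inner_commute algebra_simps)
  qed
  note * = this
  have "w \<bullet> w \<le> 0"
  proof (rule ccontr)
    assume neg: "\<not> ?thesis"
    define k where "k = c * (w \<bullet> w) - w \<bullet> f w"
    \<comment> \<open>With this step length the quadratic term is at most half of the linear one.\<close>
    define s where "s = (w \<bullet> w) / (\<bar>k\<bar> + 1)"
    have s: "s > 0" unfolding s_def using neg by (intro divide_pos_pos) auto
    have "2 * (w \<bullet> w) \<le> s * k"
      using *[of s] s by (simp add: k_def power2_eq_square)
    also have "\<dots> \<le> s * (\<bar>k\<bar> + 1)"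
      using s by (intro mult_left_mono) auto
    also have "\<dots> = w \<bullet> w" by (simp add: s_def)
    finally show False using neg by simp
  qed
  then have "w = 0" by (metis inner_eq_zero_iff inner_ge_zero order_antisym)
  then have "f v = c *\<^sub>R v" by (simp add: w_def)
  with v show thesis by (intro that[of v c]) auto
qed

text \<open>
  The spectral theorem on an invariant subspace, by splitting off one eigenvector and continuing in
  its orthogonal complement. Subspaces other than the whole space are needed for the tangent spaces
  of level sets.
\<close>

theorem selfadjoint_eigenbasis:
  fixes f :: "'a::euclidean_space \<Rightarrow> 'a"
  assumes lin: "linear f"
  assumes "subspace V" "\<And>v. v \<in> V \<Longrightarrow> f v \<in> V"
    "\<And>v w. v \<in> V \<Longrightarrow> w \<in> V \<Longrightarrow> f v \<bullet> w = v \<bullet> f w"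
  obtains B where "B \<subseteq> V" "pairwise orthogonal B" "span B = V"
    "\<And>b. b \<in> B \<Longrightarrow> norm b = 1 \<and> (\<exists>c. f b = c *\<^sub>R b)"
proof -
  have "\<exists>B. B \<subseteq> V \<and> pairwise orthogonal B \<and> span B = V \<and>
      (\<forall>b\<in>B. norm b = 1 \<and> (\<exists>c. f b = c *\<^sub>R b))"
    using assms(2-)
  proof (induction "dim V" arbitrary: V rule: less_induct)
    case less
    show ?case
    proof (cases "V = {0}")
      case True
      then show ?thesis by (intro exI[of _ "{}"]) auto
    next
      case False
      obtain v c where v: "v \<in> V" "norm v = 1" "f v = c *\<^sub>R v"
        using selfadjoint_eigenvector_exists[OF less.prems(1) False lin less.prems(2,3)] by blast
      have vv: "v \<bullet> v = 1" using v by (simp add: dot_square_norm)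
      define W where "W = {w \<in> V. v \<bullet> w = 0}"
      have W: "subspace W"
        using less.prems(1) unfolding W_def subspace_def by (auto simp: inner_simps)
      have "v \<notin> W" using vv by (simp add: W_def)
      moreover have "W \<subseteq> V" by (auto simp: W_def)
      ultimately have sub: "W \<subset> V" using v(1) by blast
      have "dim W < dim V"
        using sub W less.prems(1) by (metis dim_psubset span_eq_iff)
      moreover have "f w \<in> W" if "w \<in> W" for w
        using that less.prems(2)[of w] less.prems(3)[of v w] v by (auto simp: W_def)
      moreover have "f u \<bullet> w = u \<bullet> f w" if "u \<in> W" "w \<in> W" for u w
        using that less.prems(3) by (auto simp: W_def)
      ultimately obtain B where B: "B \<subseteq> W" "pairwise orthogonal B" "span B = W"
          "\<forall>b\<in>B. norm b = 1 \<and> (\<exists>c. f b = c *\<^sub>R b)"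
        using less.hyps[OF _ W] by blast
      have "span (insert v B) = V"
      proof
        show "span (insert v B) \<subseteq> V"
          using v(1) B(1) sub less.prems(1) by (intro span_minimal) auto
        show "V \<subseteq> span (insert v B)"
        proof
          fix x assume x: "x \<in> V"
          have "x - (v \<bullet> x) *\<^sub>R v \<in> W"
            using x v vv less.prems(1) by (auto simp: W_def subspace_diff subspace_scale inner_simps)
          then show "x \<in> span (insert v B)"
            using B(3) span_breakdown_eq by blast
        qed
      qed
      moreover have "pairwise orthogonal (insert v B)"
        using B(1,2) by (auto simp: pairwise_insert orthogonal_def W_def inner_commute)
      ultimately show ?thesis
        using v B sub by (intro exI[of _ "insert v B"]) auto
    qed
  qed
  then show thesis using that by blast
qed

definition diag :: "('n \<Rightarrow> 'a::zero) \<Rightarrow> 'a^'n^'n" where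
  "diag d = (\<chi> i j. if i = j then d i else 0)"

lemma diag_mult: "diag c ** diag d = diag (\<lambda>i. c i * d i :: 'a::semiring_1)"
  by (simp add: diag_def matrix_matrix_mult_def vec_eq_iff if_distrib[of "\<lambda>x. x * _"] if_distrib[of "\<lambda>x. _ * x"] sum.delta cong: if_cong)

lemma diag_1: "diag (\<lambda>_. 1) = mat 1"
  by (simp add: diag_def mat_def)

lemma trace_diag: "trace (diag d) = sum d UNIV"
  by (simp add: diag_def trace_def)

lemma det_diag: "det (diag d) = prod d UNIV"
  by (subst det_diagonal) (auto simp: diag_def)

lemma dot_transpose_mult: "v \<bullet> (transpose B *v y) = (B *v v) \<bullet> (y :: real^'n)"
  by (metis dot_lmul_matrix inner_commute transpose_matrix_vector)

lemma column_matrix_mult: "column j (A ** Q) = A *v column j Q"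
  by (simp add: column_def matrix_matrix_mult_def matrix_vector_mult_def vec_eq_iff)

lemma symmetric_matrix_diagonalization:
  fixes A :: "real^'n^'n"
  assumes "transpose A = A"
  obtains Q d where "orthogonal_matrix Q" "transpose Q ** A ** Q = diag d"
    "\<And>a. d a = column a Q \<bullet> (A *v column a Q)" "\<And>a. norm (column a Q) = 1"
proof -
  have sa: "(A *v v) \<bullet> w = v \<bullet> (A *v w)" for v w
    using dot_transpose_mult[of v A w] assms by simp
  obtain B where B: "pairwise orthogonal B" "span B = UNIV"
      "\<And>b. b \<in> B \<Longrightarrow> norm b = 1 \<and> (\<exists>c. A *v b = c *\<^sub>R b)"
    by (rule selfadjoint_eigenbasis[OF matrix_vector_mul_linear[of A] subspace_UNIV])
      (auto simp: sa)
  have ind: "independent B"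
    using B(1,3) by (intro pairwise_orthogonal_independent) force+
  have "card B = CARD('n)" "finite B"
    using dim_span_eq_card_independent[OF ind] B(2) ind by (auto simp: independent_imp_finite)
  then obtain q where q: "bij_betw q (UNIV::'n set) B"
    using finite_same_card_bij[of "UNIV::'n set" B] by auto
  have qB: "q i \<in> B" for i using q by (auto simp: bij_betw_def)
  have orth: "q i \<bullet> q j = (if i = j then 1 else 0)" for i j
  proof (cases "i = j")
    case True then show ?thesis using B(3)[OF qB[of j]] by (simp add: dot_square_norm)
  next
    case False
    then have "q i \<noteq> q j" using q by (auto simp: bij_betw_def inj_on_def)
    then show ?thesis using B(1) qB False by (auto simp: pairwise_def orthogonal_def)
  qed
  define Q :: "real^'n^'n" where "Q = (\<chi> i j. q j $ i)"
  have col: "column j Q = q j" for j by (simp add: Q_def column_def vec_eq_iff)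
  have Q: "orthogonal_matrix Q"
    unfolding orthogonal_matrix matrix_mult_transpose_dot_column
    by (simp add: col orth mat_def)
  define d where "d a = q a \<bullet> (A *v q a)" for a
  have Aq: "A *v q a = d a *\<^sub>R q a" for a
    using B(3)[OF qB[of a]] orth[of a a] by (auto simp: d_def)
  have "transpose Q ** A ** Q = transpose Q ** (A ** Q)"
    by (simp add: matrix_mul_assoc)
  also have "\<dots> = diag d"
  proof -
    have c: "column j (A ** Q) = d j *\<^sub>R q j" for j
      by (simp add: column_matrix_mult col Aq)
    have "(transpose Q ** (A ** Q)) $ i $ j = column i Q \<bullet> column j (A ** Q)" for i j
      by (simp add: matrix_matrix_mult_def transpose_def column_def inner_vec_def)
    then show ?thesis by (simp add: vec_eq_iff c col orth diag_def)
  qed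
  finally show thesis
    using Q by (intro that[of Q d]) (use orth in \<open>auto simp: d_def col norm_eq_sqrt_inner\<close>)
qed

lemma positive_definite_congruence:
  fixes A B :: "real^'n^'n"
  assumes "positive_definite A" "det B \<noteq> 0"
  shows "positive_definite (transpose B ** A ** B)"
  unfolding positive_definite_def
proof (intro conjI allI impI)
  show "transpose (transpose B ** A ** B) = transpose B ** A ** B"
    using assms(1) by (simp add: positive_definite_def matrix_transpose_mul matrix_mul_assoc)
  fix v :: "real^'n" assume "v \<noteq> 0"
  then have "B *v v \<noteq> 0"
    using assms(2) det_nz_iff_inj[of "(*v) B"] linear_injective_0[of "(*v) B"] by auto
  moreover have "v \<bullet> (transpose B ** A ** B *v v) = (B *v v) \<bullet> (A *v (B *v v))"
    by (simp add: matrix_vector_mul_assoc[symmetric] dot_transpose_mult del: transpose_matrix_vector)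
  ultimately show "v \<bullet> (transpose B ** A ** B *v v) > 0"
    using assms(1) by (simp add: positive_definite_def)
qed

lemma positive_definite_eigenvalues:
  fixes A :: "real^'n^'n"
  assumes "positive_definite A"
  shows "\<exists>d :: 'n \<Rightarrow> real. (\<forall>a. d a > 0 \<and> (\<exists>v. norm v = 1 \<and> d a = v \<bullet> (A *v v))) \<and>
    det A = prod d UNIV \<and> trace A = sum d UNIV \<and> trace (A ** A) = (\<Sum>a\<in>UNIV. d a * d a)"
proof -
  from assms have "transpose A = A" by (simp add: positive_definite_def)
  then obtain Q d where Q: "orthogonal_matrix Q" "transpose Q ** A ** Q = diag d"
    "\<And>a. d a = column a Q \<bullet> (A *v column a Q)" "\<And>a. norm (column a Q) = 1"
    using symmetric_matrix_diagonalization[of A] by blast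
  have pos: "d a > 0" for a
  proof -
    have "column a Q \<noteq> 0" using Q(4)[of a] by force
    then show ?thesis using assms Q(3)[of a] by (simp add: positive_definite_def)
  qed
  have QQ: "transpose Q ** Q = mat 1" "Q ** transpose Q = mat 1"
    using Q(1) by (auto simp: orthogonal_matrix_def)
  have "det (transpose Q) * det Q = 1"
    using arg_cong[OF QQ(1), of det] by (simp add: det_mul)
  then have "det (diag d) = det A"
    unfolding Q(2)[symmetric] by (simp add: det_mul algebra_simps)
  then have 1: "det A = prod d UNIV" by (simp add: det_diag)
  have conj: "trace (transpose Q ** M ** Q) = trace M" for M
    by (subst trace_mul_sym) (simp add: matrix_mul_assoc QQ)
  have "trace (diag d) = trace A"
    unfolding Q(2)[symmetric] by (rule conj)
  then have 2: "trace A = sum d UNIV" by (simp add: trace_diag)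
  have "(transpose Q ** A ** Q) ** (transpose Q ** A ** Q) = transpose Q ** A ** (Q ** transpose Q) ** A ** Q"
    by (simp only: matrix_mul_assoc)
  then have "diag d ** diag d = transpose Q ** A ** mat 1 ** A ** Q"
    by (simp only: QQ Q(2))
  then have "diag d ** diag d = transpose Q ** (A ** A) ** Q"
    by (simp add: matrix_mul_assoc)
  then have "trace (diag d ** diag d) = trace (A ** A)"
    by (simp add: conj)
  then have 3: "trace (A ** A) = (\<Sum>a\<in>UNIV. d a * d a)" by (simp add: diag_mult trace_diag)
  have "\<exists>v. norm v = 1 \<and> d a = v \<bullet> (A *v v)" for a
    using Q(3)[of a] Q(4)[of a] by blast
  with pos 1 2 3 show ?thesis by (intro exI[of _ d]) simp
qed

lemma det_less_one:
  fixes A :: "real^'n^'n"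
  assumes "positive_definite A" "\<And>v. v \<bullet> (A *v v) \<le> s * (v \<bullet> v)" "s < 1"
  shows "det A < 1"
proof -
  obtain d :: "'n \<Rightarrow> real" where d: "\<And>a. d a > 0" "\<And>a. \<exists>v. norm v = 1 \<and> d a = v \<bullet> (A *v v)"
      "det A = prod d UNIV" "trace A = sum d UNIV" "trace (A ** A) = (\<Sum>a\<in>UNIV. d a * d a)"
    using positive_definite_eigenvalues[OF assms(1)] by blast
  have le: "d a \<le> s" for a
    using assms(2) d(2)[of a] by (metis dot_square_norm mult.right_neutral one_power2)
  have s: "0 \<le> s" using le[of undefined] d(1)[of undefined] by linarith
  have "prod d UNIV \<le> (\<Prod>a\<in>(UNIV::'n set). s)"
    using le d(1) by (intro prod_mono) (auto intro: less_imp_le)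
  also have "\<dots> < 1" using s assms(3) by (simp add: power_less_one_iff)
  finally show ?thesis by (simp add: d(3))
qed

lemma det_greater_one:
  fixes A :: "real^'n^'n"
  assumes "positive_definite A" "\<And>v. v \<bullet> (A *v v) \<ge> s * (v \<bullet> v)" "s > 1"
  shows "det A > 1"
proof -
  obtain d :: "'n \<Rightarrow> real" where d: "\<And>a. d a > 0" "\<And>a. \<exists>v. norm v = 1 \<and> d a = v \<bullet> (A *v v)"
      "det A = prod d UNIV" "trace A = sum d UNIV" "trace (A ** A) = (\<Sum>a\<in>UNIV. d a * d a)"
    using positive_definite_eigenvalues[OF assms(1)] by blast
  have le: "d a \<ge> s" for a
    using assms(2) d(2)[of a] by (metis dot_square_norm mult.right_neutral one_power2)
  have "1 < (\<Prod>a\<in>(UNIV::'n set). s)" using assms(3) by (simp add: one_less_power)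
  also have "\<dots> \<le> prod d UNIV"
    using le assms(3) by (intro prod_mono) auto
  finally show ?thesis by (simp add: d(3))
qed

text \<open>
  The columns of \<open>B\<close> are orthonormal for the inner product of \<open>A\<close>, and \<open>B B\<^sup>T\<close> is the inverse of
  \<open>A\<close>. Sums over these columns will represent traces against \<open>A\<inverse>\<close>, and so the operator \<open>L\<close>.
\<close>

lemma positive_definite_normal_form:
  fixes A :: "real^'n^'n"
  assumes "positive_definite A"
  obtains B :: "real^'n^'n" where "transpose B ** A ** B = mat 1" "B ** transpose B ** A = mat 1"
proof -
  obtain Q d where Q0: "orthogonal_matrix Q" "transpose Q ** A ** Q = diag d"
    "\<And>a. d a = column a Q \<bullet> (A *v column a Q)" "\<And>a. norm (column a Q) = 1"
    using symmetric_matrix_diagonalization[of A] assms unfolding positive_definite_def by blast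
  have "column a Q \<noteq> 0" for a using Q0(4)[of a] by force
  then have "d a > 0" for a
    using assms Q0(3)[of a] by (simp add: positive_definite_def)
  note Q = Q0(2) this
  define D where "D = diag (\<lambda>a. 1 / sqrt (d a))"
  have nz: "d a \<noteq> 0" for a using Q(2)[of a] by simp
  have tD: "transpose D = D" by (auto simp: D_def diag_def transpose_def vec_eq_iff)
  have "transpose (Q ** D) ** A ** (Q ** D) = D ** (transpose Q ** A ** Q) ** D"
    by (simp add: matrix_transpose_mul tD matrix_mul_assoc)
  also have "\<dots> = mat 1"
    unfolding Q(1) D_def diag_mult
    using Q(2) by (simp add: nz less_imp_le diag_1[symmetric])
  finally have 1: "transpose (Q ** D) ** A ** (Q ** D) = mat 1" .
  then have "(Q ** D) ** (transpose (Q ** D) ** A) = mat 1"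
    using matrix_left_right_inverse by blast
  with 1 show thesis by (intro that[of "Q ** D"]) (simp_all only: matrix_mul_assoc)
qed

text \<open>
  The inequality of arithmetic and geometric means for the eigenvalues, in the form
  \<open>ln d \<le> d - 1\<close>.
\<close>

lemma positive_definite_trace_ge:
  fixes A :: "real^'n^'n"
  assumes "positive_definite A" "det A = 1"
  shows "trace A \<ge> CARD('n)"
proof -
  obtain d :: "'n \<Rightarrow> real" where d: "\<And>a. d a > 0" "\<And>a. \<exists>v. norm v = 1 \<and> d a = v \<bullet> (A *v v)"
      "det A = prod d UNIV" "trace A = sum d UNIV" "trace (A ** A) = (\<Sum>a\<in>UNIV. d a * d a)"
    using positive_definite_eigenvalues[OF assms(1)] by blast
  have "0 = ln (prod d UNIV)" using d(3) assms(2) by simp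
  also have "\<dots> = (\<Sum>a\<in>UNIV. ln (d a))" by (intro ln_prod) (simp, metis d(1) less_irrefl)
  also have "\<dots> \<le> (\<Sum>a\<in>UNIV. d a - 1)" using d(1) by (intro sum_mono ln_le_minus_one)
  also have "\<dots> = trace A - CARD('n)" by (simp add: d(4) sum_subtractf)
  finally show ?thesis by simp
qed

text \<open>
  Each of the at least two positive eigenvalues is smaller than their sum.
\<close>

lemma positive_definite_trace_square:
  fixes A :: "real^'n^'n"
  assumes "positive_definite A" "CARD('n) \<ge> 2"
  shows "trace (A ** A) < (trace A)\<^sup>2"
proof -
  obtain d :: "'n \<Rightarrow> real" where d: "\<And>a. d a > 0" "\<And>a. \<exists>v. norm v = 1 \<and> d a = v \<bullet> (A *v v)"
      "det A = prod d UNIV" "trace A = sum d UNIV" "trace (A ** A) = (\<Sum>a\<in>UNIV. d a * d a)"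
    using positive_definite_eigenvalues[OF assms(1)] by blast
  have "d a < sum d UNIV" for a
  proof -
    have "card (UNIV - {a}) > 0" using assms(2) by (subst card_Diff_singleton) auto
    then have "UNIV - {a} \<noteq> {}" by (metis card.empty less_irrefl)
    then have "sum d (UNIV - {a}) > 0" using d(1) by (intro sum_pos) auto
    then show ?thesis by (subst sum.remove[of UNIV a]) auto
  qed
  then have "(\<Sum>a\<in>UNIV. d a * d a) < (\<Sum>a\<in>UNIV. d a * sum d UNIV)"
    using d(1) by (intro sum_strict_mono mult_strict_left_mono) auto
  then show ?thesis by (simp add: d(4,5) power2_eq_square sum_distrib_right)
qed

lemma left_inverse_unique:
  fixes M :: "real^'n^'n"
  assumes "C ** M = mat 1" "C' ** M = mat 1"
  shows "C = C'"
  using assms by (metis matrix_left_right_inverse matrix_mul_assoc matrix_mul_lid matrix_mul_rid)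

lemma symmetric_matrix_inner: "transpose M = M \<Longrightarrow> (M *v v) \<bullet> w = v \<bullet> (M *v (w :: real^'n))"
  using dot_transpose_mult[of v M w] by simp

lemma trace_eq_sum_inner_columns:
  fixes M B :: "real^'n^'n"
  shows "trace (transpose B ** M ** B) = (\<Sum>a\<in>UNIV. column a B \<bullet> (M *v column a B))"
proof -
  have "(transpose B ** M ** B) $ a $ b = column a B \<bullet> (M *v column b B)" for a b
  proof -
    have "(transpose B ** (M ** B)) $ a $ b = column a B \<bullet> column b (M ** B)"
      by (simp add: matrix_matrix_mult_def transpose_def column_def inner_vec_def)
    then show ?thesis by (simp add: matrix_mul_assoc column_matrix_mult)
  qed
  then show ?thesis by (simp add: trace_def)
qed

lemma trace_frame:
  fixes M B :: "real^'n^'n"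
  shows "trace (B ** transpose B ** M) = (\<Sum>a\<in>UNIV. column a B \<bullet> (M *v column a B))"
proof -
  have "trace (B ** (transpose B ** M)) = trace ((transpose B ** M) ** B)" by (rule trace_mul_sym)
  then show ?thesis by (simp only: matrix_mul_assoc trace_eq_sum_inner_columns)
qed

lemma sum_square_inner_columns:
  fixes B :: "real^'n^'n"
  shows "(\<Sum>a\<in>UNIV. (column a B \<bullet> y)\<^sup>2) = y \<bullet> ((B ** transpose B) *v y)"
proof -
  have c: "(transpose B *v y) $ a = column a B \<bullet> y" for a
    by (simp add: matrix_vector_mult_def transpose_def column_def inner_vec_def)
  have "y \<bullet> ((B ** transpose B) *v y) = (transpose B *v y) \<bullet> (transpose B *v y)"
    using dot_transpose_mult[of y "transpose B" "transpose B *v y"] by (simp only: transpose_transpose matrix_vector_mul_assoc)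
  also have "\<dots> = (\<Sum>a\<in>UNIV. (column a B \<bullet> y)\<^sup>2)"
    by (simp only: inner_vec_def[of "transpose B *v y"] c power2_eq_square inner_real_def)
  finally show ?thesis by simp
qed

lemma sum_columns_expand:
  fixes B M :: "real^'n^'n"
  assumes "B ** transpose B ** M = mat 1"
  shows "(\<Sum>a\<in>UNIV. (column a B \<bullet> (M *v y)) *\<^sub>R column a B) = y"
proof -
  have c: "(transpose B *v z) $ a = column a B \<bullet> z" for a z
    by (simp add: matrix_vector_mult_def transpose_def column_def inner_vec_def)
  have "y = B *v (transpose B *v (M *v y))"
    using assms by (simp add: matrix_vector_mul_assoc matrix_mul_assoc)
  also have "\<dots> = (\<Sum>a\<in>UNIV. (column a B \<bullet> (M *v y)) *s column a B)"
    by (simp only: matrix_mult_sum[of B] c)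
  finally show ?thesis by (simp add: scalar_mult_eq_scaleR)
qed

text \<open>
  Testing with the component of \<open>b\<close> orthogonal to \<open>a\<close>, pushed slightly into the half-space, shows
  that this component vanishes.
\<close>

lemma halfspace_subset_imp_parallel:
  fixes a b :: "'a::real_inner"
  assumes a: "a \<noteq> 0" and sub: "\<And>v. a \<bullet> v < 0 \<Longrightarrow> b \<bullet> v \<le> 0"
  shows "\<exists>c\<ge>0. b = c *\<^sub>R a"
proof -
  define c where "c = (a \<bullet> b) / (a \<bullet> a)"
  define z where "z = b - c *\<^sub>R a"
  have aa: "a \<bullet> a > 0" using a by simp
  have az: "a \<bullet> z = 0" using aa by (simp add: z_def inner_diff_right c_def)
  have bz: "b \<bullet> z = z \<bullet> z" using az by (simp add: z_def inner_diff_left inner_commute)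
  have "z \<bullet> z \<le> e * (a \<bullet> b)" if "e > 0" for e
    using sub[of "z - e *\<^sub>R a"] that aa az bz by (simp add: inner_diff_right inner_commute)
  note small = this
  have "z \<bullet> z \<le> 0"
  proof (rule ccontr)
    assume n: "\<not> z \<bullet> z \<le> 0"
    then have pos: "a \<bullet> b > 0" using small[of 1] by simp
    have "z \<bullet> z \<le> (z \<bullet> z / (2 * (a \<bullet> b))) * (a \<bullet> b)"
      using n pos by (intro small divide_pos_pos) auto
    then show False using n pos by (simp add: field_simps)
  qed
  then have "z = 0" by (metis inner_eq_zero_iff inner_ge_zero order_antisym)
  moreover have "c \<ge> 0"
    using sub[of "- a"] aa by (simp add: c_def inner_commute)
  ultimately show ?thesis by (intro exI[of _ c]) (simp add: z_def)
qed

lemma orthonormal_expand_inner: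
  assumes B: "pairwise orthogonal B" "\<And>b. b \<in> B \<Longrightarrow> norm b = 1" and fin: "finite B" and v: "v \<in> span B"
  shows "v \<bullet> y = (\<Sum>b\<in>B. (v \<bullet> b) * (b \<bullet> (y :: 'a::euclidean_space)))"
proof -
  have "v \<bullet> y = (\<Sum>b\<in>B. (v \<bullet> b) *\<^sub>R b) \<bullet> y"
    using orthonormal_basis_expand[OF B v fin] by simp
  then show ?thesis by (simp add: inner_sum_left)
qed

text \<open>
  In an eigenbasis \<open>v \<bullet> f v = \<Sum> l\<^sub>b v\<^sub>b\<^sup>2\<close> and \<open>|f v|\<^sup>2 = \<Sum> l\<^sub>b\<^sup>2 v\<^sub>b\<^sup>2\<close>, so bounds for the eigenvalues
  \<open>l\<^sub>b\<close> compare the two quadratic forms. This is how pinched principal curvatures enter the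
  rolling argument.
\<close>

lemma selfadjoint_spectral_bounds:
  fixes f :: "'a::euclidean_space \<Rightarrow> 'a"
  assumes lin: "linear f" and V: "subspace V" and inv: "\<And>v. v \<in> V \<Longrightarrow> f v \<in> V"
    and sa: "\<And>v w. v \<in> V \<Longrightarrow> w \<in> V \<Longrightarrow> f v \<bullet> w = v \<bullet> f w"
  defines "E \<equiv> {c. \<exists>v. v \<noteq> 0 \<and> v \<in> V \<and> f v = c *\<^sub>R v}"
  shows selfadjoint_finite_spectrum: "finite E"
    and selfadjoint_spectrum_nonempty: "V \<noteq> {0} \<Longrightarrow> E \<noteq> {}"
    and selfadjoint_norm_le: "\<And>v M. v \<in> V \<Longrightarrow> (\<And>c. c \<in> E \<Longrightarrow> 0 \<le> c \<and> c \<le> M) \<Longrightarrow> f v \<bullet> f v \<le> M * (v \<bullet> f v)"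
    and selfadjoint_norm_ge: "\<And>v m. v \<in> V \<Longrightarrow> (\<And>c. c \<in> E \<Longrightarrow> 0 \<le> c \<and> m \<le> c) \<Longrightarrow> m * (v \<bullet> f v) \<le> f v \<bullet> f v"
proof -
  obtain B where B: "B \<subseteq> V" "pairwise orthogonal B" "span B = V"
      "\<And>b. b \<in> B \<Longrightarrow> norm b = 1 \<and> (\<exists>c. f b = c *\<^sub>R b)"
    using selfadjoint_eigenbasis[OF lin V inv sa] by blast
  define l where "l b = (SOME c. f b = c *\<^sub>R b)" for b
  have l: "f b = l b *\<^sub>R b" if "b \<in> B" for b
    unfolding l_def using B(4)[OF that] by (metis (mono_tags, lifting) someI_ex)
  have fin: "finite B" using pairwise_orthogonal_imp_finite[OF B(2)] .
  have n1: "norm b = 1" if "b \<in> B" for b using B(4)[OF that] by simp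
  have expand: "v \<bullet> y = (\<Sum>b\<in>B. (v \<bullet> b) * (b \<bullet> y))" if "v \<in> V" for v y
    using orthonormal_expand_inner[OF B(2) n1 fin] that B(3) by blast
  have lE: "l b \<in> E" if "b \<in> B" for b
  proof -
    have "b \<noteq> 0" using n1[OF that] by auto
    then show ?thesis unfolding E_def using l[OF that] that B(1) by blast
  qed
  have "E \<subseteq> l ` B"
  proof
    fix c assume "c \<in> E"
    then obtain v where v: "v \<noteq> 0" "v \<in> V" "f v = c *\<^sub>R v" by (auto simp: E_def)
    have "\<exists>b\<in>B. v \<bullet> b \<noteq> 0"
    proof (rule ccontr)
      assume "\<not> ?thesis"
      then have "v \<bullet> v = 0" using expand[OF v(2), of v] by simp
      then show False using v by simp
    qed
    then obtain b where b: "b \<in> B" "v \<bullet> b \<noteq> 0" by blast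
    have "c * (v \<bullet> b) = l b * (v \<bullet> b)"
      using sa[OF v(2), of b] b B(1) l[OF b(1)] v(3) by auto
    then have "c = l b" using b by simp
    then show "c \<in> l ` B" using b by simp
  qed
  then show "finite E" using fin finite_surj by blast
  show "E \<noteq> {}" if "V \<noteq> {0}"
  proof -
    have "B \<noteq> {}" using that B(3) by auto
    then show ?thesis using lE by blast
  qed
  have bf: "b \<bullet> f v = l b * (v \<bullet> b)" if "b \<in> B" "v \<in> V" for b v
    using sa[OF that(2), of b] that B(1) l[OF that(1)] by (auto simp: inner_commute)
  have vf: "v \<bullet> f v = (\<Sum>b\<in>B. l b * (v \<bullet> b)\<^sup>2)" if "v \<in> V" for v
  proof -
    have "v \<bullet> f v = (\<Sum>b\<in>B. (v \<bullet> b) * (b \<bullet> f v))" by (rule expand[OF that])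
    also have "\<dots> = (\<Sum>b\<in>B. l b * (v \<bullet> b)\<^sup>2)"
      using bf that by (intro sum.cong refl) (simp add: power2_eq_square)
    finally show ?thesis .
  qed
  have ff: "f v \<bullet> f v = (\<Sum>b\<in>B. l b * l b * (v \<bullet> b)\<^sup>2)" if "v \<in> V" for v
  proof -
    have "f v \<bullet> f v = (\<Sum>b\<in>B. (f v \<bullet> b) * (b \<bullet> f v))" by (rule expand[OF inv[OF that]])
    also have "\<dots> = (\<Sum>b\<in>B. l b * l b * (v \<bullet> b)\<^sup>2)"
    proof (rule sum.cong)
      fix b assume "b \<in> B"
      from bf[OF this that] show "(f v \<bullet> b) * (b \<bullet> f v) = l b * l b * (v \<bullet> b)\<^sup>2"
        by (simp add: inner_commute power2_eq_square)
    qed simp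
    finally show ?thesis .
  qed
  show "f v \<bullet> f v \<le> M * (v \<bullet> f v)" if "v \<in> V" "\<And>c. c \<in> E \<Longrightarrow> 0 \<le> c \<and> c \<le> M" for v M
    unfolding vf[OF that(1)] ff[OF that(1)] sum_distrib_left mult.assoc[symmetric]
    using that(2)[OF lE] by (intro sum_mono mult_right_mono) auto
  show "m * (v \<bullet> f v) \<le> f v \<bullet> f v" if "v \<in> V" "\<And>c. c \<in> E \<Longrightarrow> 0 \<le> c \<and> m \<le> c" for v m
    unfolding vf[OF that(1)] ff[OF that(1)] sum_distrib_left mult.assoc[symmetric]
    using that(2)[OF lE] by (intro sum_mono mult_right_mono) auto
qed

lemma half_norm_square_diff_unit:
  fixes a b :: "real^'n"
  assumes "norm a = 1" "norm b = 1"
  shows "1 - a \<bullet> b = (norm (a - b))\<^sup>2 / 2"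
  using assms by (simp add: dot_square_norm[symmetric] inner_diff_left inner_diff_right inner_commute norm_eq_1)

section \<open>Elementary symmetric functions of the eigenvalues\<close>

text \<open>
  The Leibniz expansion over polynomials is monic of degree \<open>n\<close>, since only the identity permutation
  contributes to the top degree. By the fundamental theorem of algebra it splits, and its \<open>n\<close> roots
  can be indexed by \<open>'n\<close>. This shows that the choice in the definition of \<open>eigenvalues\<close> is a choice
  from a nonempty set.
\<close>

lemma characteristic_polynomial_splits:
  fixes M :: "complex^'n^'n"
  shows "\<exists>ev :: 'n \<Rightarrow> complex. \<forall>t. det (mat t - M) = (\<Prod>i\<in>UNIV. t - ev i)"
proof -
  define E :: "'n \<Rightarrow> 'n \<Rightarrow> complex poly" where "E i j = [: - M $ i $ j, if i = j then 1 else 0 :]" for i j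
  define f :: "('n \<Rightarrow> 'n) \<Rightarrow> complex poly" where "f p = of_int (sign p) * (\<Prod>i\<in>UNIV. E i (p i))" for p
  let ?U = "UNIV :: 'n set"
  let ?P = "{p. p permutes ?U}"
  define P where "P = sum f ?P"
  have poly_P: "poly P t = det (mat t - M)" for t
    unfolding P_def f_def det_def poly_sum poly_mult poly_prod poly_of_int
    by (intro sum.cong refl arg_cong2[of _ _ _ _ times] prod.cong) (auto simp: E_def mat_def)
  have "lead_coeff (\<Prod>i\<in>?U. [:- M $ i $ i, 1:]) = 1"
    by (simp only: lead_coeff_prod) simp
  moreover have "degree (f id) = CARD('n)"
    by (simp add: f_def E_def degree_prod_eq_sum_degree)
  ultimately have deg_id: "degree (f id) = CARD('n)" "lead_coeff (f id) = 1"
    by (simp_all add: f_def E_def)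
  have deg_less: "degree (f p) < CARD('n)" if p: "p \<in> ?P - {id}" for p
  proof -
    obtain a where a: "p a \<noteq> a" using p by (metis DiffD2 eq_id_iff singletonI)
    have "degree (\<Prod>i\<in>UNIV. E i (p i)) \<le> (\<Sum>i\<in>UNIV. degree (E i (p i)))"
      using degree_prod_sum_le[of UNIV "\<lambda>i. E i (p i)"] by (simp add: o_def)
    also have "\<dots> < (\<Sum>i\<in>?U. 1)"
      using a by (intro sum_strict_mono_ex1) (auto simp: E_def, metis)
    finally have "degree (\<Prod>i\<in>UNIV. E i (p i)) < CARD('n)" by simp
    then show ?thesis
      unfolding f_def using degree_mult_le[of "of_int (sign p)" "\<Prod>i\<in>UNIV. E i (p i)"] by simp
  qed
  have P_eq: "P = f id + sum f (?P - {id})"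
    unfolding P_def by (subst sum.remove[of ?P id]) (auto simp: permutes_id finite_permutations)
  have "degree (sum f (?P - {id})) < CARD('n)"
    using deg_less by (intro degree_sum_less) auto
  then have P: "degree P = CARD('n)" "lead_coeff P = 1"
    using deg_id unfolding P_eq by (simp_all add: degree_add_eq_left lead_coeff_add_le coeff_eq_0)
  obtain root where "smult (lead_coeff P) (\<Prod>i<degree P. [:-root i, 1:]) = P"
    using complex_poly_decompose' by blast
  then have root: "P = (\<Prod>i<CARD('n). [:-root i, 1:])" using P by simp
  obtain g where g: "bij_betw g ?U {..<CARD('n)}"
    using finite_same_card_bij[of ?U "{..<CARD('n)}"] by auto
  have "det (mat t - M) = (\<Prod>i\<in>UNIV. t - root (g i))" for t
  proof -
    have "det (mat t - M) = (\<Prod>i<CARD('n). t - root i)"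
      unfolding poly_P[symmetric] root by (simp add: poly_prod)
    also have "\<dots> = (\<Prod>i\<in>UNIV. t - root (g i))"
      using prod.reindex_bij_betw[OF g, of "\<lambda>i. t - root i"] by simp
    finally show ?thesis .
  qed
  then show ?thesis by (intro exI[of _ "\<lambda>i. root (g i)"] allI)
qed

definition principal_minor :: "'a::comm_ring_1^'n^'n \<Rightarrow> 'n set \<Rightarrow> 'a" where
  "principal_minor M I = (\<Sum>p | p permutes I. of_int (sign p) * (\<Prod>i\<in>I. M $ i $ p i))"

text \<open>
  Expanding every factor \<open>\<delta> + s M\<close> in the Leibniz formula leaves, for the set \<open>I\<close> of rows from which
  \<open>s M\<close> is taken, only the permutations that fix all other rows.
\<close>

lemma det_mat_1_plus:
  fixes M :: "'a::comm_ring_1^'n^'n"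
  shows "det (\<chi> i j. (if i = j then 1 else 0) + s * M $ i $ j) = (\<Sum>I\<in>UNIV. s ^ card I * principal_minor M I)"
proof -
  let ?U = "UNIV :: 'n set"
  let ?P = "{p. p permutes ?U}"
  let ?d = "\<lambda>i j. if i = j then 1 else 0 :: 'a"
  have del: "(\<Prod>i\<in>J. ?d i (p i)) = (if \<forall>i\<in>J. p i = i then 1 else 0)" for p and J :: "'n set"
    by (induction J rule: infinite_finite_induct) auto
  have "det (\<chi> i j. ?d i j + s * M $ i $ j) =
      (\<Sum>p\<in>?P. of_int (sign p) * (\<Prod>i\<in>?U. s * M $ i $ p i + ?d i (p i)))"
    by (simp add: det_def add.commute)
  also have "\<dots> = (\<Sum>p\<in>?P. \<Sum>I\<in>Pow ?U. of_int (sign p) * ((\<Prod>i\<in>I. s * M $ i $ p i) * (\<Prod>i\<in>?U - I. ?d i (p i))))"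
    by (simp only: prod_add[OF finite] sum_distrib_left)
  also have "\<dots> = (\<Sum>I\<in>Pow ?U. \<Sum>p\<in>?P. of_int (sign p) * ((\<Prod>i\<in>I. s * M $ i $ p i) * (\<Prod>i\<in>?U - I. ?d i (p i))))"
    by (rule sum.swap)
  also have "\<dots> = (\<Sum>I\<in>Pow ?U. s ^ card I * principal_minor M I)"
  proof (rule sum.cong)
    fix I :: "'n set"
    have "(\<Sum>p\<in>?P. of_int (sign p) * ((\<Prod>i\<in>I. s * M $ i $ p i) * (\<Prod>i\<in>?U - I. ?d i (p i))))
      = (\<Sum>p\<in>?P. if \<forall>i\<in>?U - I. p i = i then s ^ card I * (of_int (sign p) * (\<Prod>i\<in>I. M $ i $ p i)) else 0)"
      by (intro sum.cong) (auto simp: del prod.distrib mult_ac)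
    also have "\<dots> = (\<Sum>p\<in>{p\<in>?P. \<forall>i\<in>?U - I. p i = i}. s ^ card I * (of_int (sign p) * (\<Prod>i\<in>I. M $ i $ p i)))"
      by (subst sum.inter_filter) (auto simp: finite_permutations)
    also have "{p\<in>?P. \<forall>i\<in>?U - I. p i = i} = {p. p permutes I}"
      using permutes_subset[of _ I ?U] permutes_superset[of _ ?U I] by (auto simp: permutes_def)
    finally show "(\<Sum>p\<in>?P. of_int (sign p) * ((\<Prod>i\<in>I. s * M $ i $ p i) * (\<Prod>i\<in>?U - I. ?d i (p i))))
      = s ^ card I * principal_minor M I"
      by (simp add: principal_minor_def sum_distrib_left)
  qed simp
  finally show ?thesis by simp
qed

lemma sum_subsets_by_card:
  fixes c :: "'n::finite set \<Rightarrow> 'a::comm_ring_1"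
  shows "(\<Sum>I\<in>UNIV. s ^ card I * c I) = (\<Sum>k\<le>CARD('n). (\<Sum>I | card I = k. c I) * s ^ k)"
proof -
  have "(\<Sum>I\<in>UNIV. s ^ card I * c I) = (\<Sum>k\<in>{..CARD('n)}. \<Sum>I | I \<in> UNIV \<and> card I = k. s ^ card I * c I)"
    by (rule sum.group[symmetric]) (auto simp: card_mono)
  also have "\<dots> = (\<Sum>k\<le>CARD('n). (\<Sum>I | card I = k. c I) * s ^ k)"
    unfolding sum_distrib_right by (intro sum.cong refl) (auto simp: mult.commute)
  finally show ?thesis .
qed

lemma principal_minor_of_real:
  "principal_minor (\<chi> i j. complex_of_real (W $ i $ j)) I = of_real (principal_minor W I)"
  by (simp add: principal_minor_def)

text \<open>
  Both \<open>\<Prod> (1 + s ev\<^sub>i)\<close> and \<open>det (1 + s W)\<close> are polynomials in \<open>s\<close>; the elementary symmetric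
  functions and the sums of principal minors are their coefficients. This makes \<open>\<sigma>\<^sub>2\<close> and \<open>\<sigma>\<^sub>n\<close>
  explicit polynomials in the entries, for nonsymmetric matrices as well.
\<close>

theorem elem_sym_eq_principal_minors:
  fixes W :: "real^'n^'n"
  assumes "k \<le> CARD('n)"
  shows "elem_sym k W = (\<Sum>I | card I = k. principal_minor W I)"
proof -
  define M :: "complex^'n^'n" where "M = (\<chi> i j. complex_of_real (W $ i $ j))"
  define ev where "ev = eigenvalues W"
  have ev: "det (mat t - M) = (\<Prod>i\<in>UNIV. t - ev i)" for t
    unfolding ev_def eigenvalues_def M_def[symmetric]
    using someI_ex[OF characteristic_polynomial_splits[of M]] by blast
  have "\<forall>s. (\<Sum>I\<in>UNIV. s ^ card I * (\<Prod>i\<in>I. ev i)) = (\<Sum>I\<in>UNIV. s ^ card I * principal_minor M I)"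
  proof
    fix s
    have "(\<Sum>I\<in>UNIV. s ^ card I * (\<Prod>i\<in>I. ev i)) = (\<Prod>i\<in>UNIV. s * ev i + 1)"
      by (subst prod_add) (auto simp: prod.distrib)
    also have "\<dots> = det (\<chi> i j. (if i = j then 1 else 0) + s * M $ i $ j)"
    proof (cases "s = 0")
      case True
      then show ?thesis by (simp add: det_I[unfolded mat_def])
    next
      case False
      \<comment> \<open>This is the characteristic polynomial at \<open>- 1 / s\<close>, with every row scaled by \<open>- s\<close>.\<close>
      have "det (\<chi> i j. (if i = j then 1 else 0) + s * M $ i $ j) = det (\<chi> i. (- s) *s ((mat (- 1 / s) - M) $ i))"
        using False by (intro arg_cong[of _ _ det]) (auto simp: vec_eq_iff mat_def algebra_simps)
      also have "\<dots> = (\<Prod>i\<in>(UNIV::'n set). - s) * det (mat (- 1 / s) - M)"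
        by (subst det_rows_mul) simp
      also have "\<dots> = (\<Prod>i\<in>UNIV. s * ev i + 1)"
        unfolding ev prod.distrib[symmetric] using False by (intro prod.cong) (auto simp: field_simps)
      finally show ?thesis by simp
    qed
    finally show "(\<Sum>I\<in>UNIV. s ^ card I * (\<Prod>i\<in>I. ev i)) = (\<Sum>I\<in>UNIV. s ^ card I * principal_minor M I)"
      by (simp add: det_mat_1_plus)
  qed
  then have "(\<Sum>I | card I = k. \<Prod>i\<in>I. ev i) = (\<Sum>I | card I = k. principal_minor M I)"
    unfolding sum_subsets_by_card polyfun_eq_coeffs using assms by blast
  then show ?thesis
    by (simp add: elem_sym_def ev_def[symmetric] M_def principal_minor_of_real)
qed

corollary elem_sym_card: "elem_sym CARD('n) (W :: real^'n^'n) = det W"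
proof -
  have "{I :: 'n set. card I = CARD('n)} = {UNIV}"
    using card_eq_UNIV_imp_eq_UNIV[where 'a='n, OF finite] by auto
  then show ?thesis
    by (simp add: elem_sym_eq_principal_minors principal_minor_def det_def)
qed

lemma principal_minor_doubleton:
  assumes "a \<noteq> b"
  shows "principal_minor M {a, b} = M $ a $ a * M $ b $ b - M $ a $ b * M $ b $ a"
proof -
  have "{p. p permutes {a, b}} = {id, Transposition.transpose a b}"
  proof -
    have "p = id \<or> p = Transposition.transpose a b" if "p permutes {a, b}" for p
    proof (cases "p a = a")
      case True
      then have "p b = b" using that assms
        by (metis insert_iff permutes_in_image permutes_inj injD singletonD)
      then show ?thesis using that True by (auto simp: permutes_def fun_eq_iff)
    next
      case False
      then have "p a = b" using that by (metis insert_iff permutes_in_image singletonD)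
      moreover then have "p b = a" using that assms
        by (metis insert_iff permutes_in_image permutes_inj injD singletonD)
      ultimately show ?thesis using that
        by (auto simp: permutes_def fun_eq_iff Transposition.transpose_def)
    qed
    moreover have "Transposition.transpose a b permutes {a, b}" by (rule permutes_swap_id) auto
    ultimately show ?thesis by (auto simp: permutes_id)
  qed
  moreover have "id \<noteq> Transposition.transpose a b" using assms by (metis id_apply transpose_apply_first)
  ultimately show ?thesis using assms
    by (simp add: principal_minor_def sign_swap_id sign_id)
qed

lemma elem_sym_2:
  fixes W :: "real^'n^'n"
  assumes "CARD('n) \<ge> 2"
  shows "elem_sym 2 W = ((trace W)\<^sup>2 - trace (W ** W)) / 2"
proof -
  let ?g = "\<lambda>a b. W $ a $ a * W $ b $ b - W $ a $ b * W $ b $ a"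
  let ?O = "{x :: 'n \<times> 'n. fst x \<noteq> snd x}"
  have "(trace W)\<^sup>2 - trace (W ** W) = (\<Sum>a\<in>UNIV. \<Sum>b\<in>UNIV. ?g a b)"
    by (simp add: trace_def matrix_matrix_mult_def power2_eq_square sum_product sum_subtractf)
  also have "\<dots> = (\<Sum>x\<in>UNIV. ?g (fst x) (snd x))"
    by (simp add: sum.cartesian_product case_prod_beta)
  also have "\<dots> = (\<Sum>x\<in>?O. ?g (fst x) (snd x))"
    by (rule sum.mono_neutral_right) auto
  also have "\<dots> = (\<Sum>I\<in>{I. card I = 2}. \<Sum>x\<in>{x \<in> ?O. {fst x, snd x} = I}. ?g (fst x) (snd x))"
    by (rule sum.group[symmetric]) auto
  also have "\<dots> = (\<Sum>I | card I = 2. 2 * principal_minor W I)"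
  proof (rule sum.cong)
    fix I :: "'n set" assume "I \<in> {I. card I = 2}"
    then obtain a b where ab: "I = {a, b}" "a \<noteq> b" by (auto simp: card_2_iff)
    then have "{x \<in> ?O. {fst x, snd x} = I} = {(a, b), (b, a)}"
      by (auto simp: doubleton_eq_iff)
    then show "(\<Sum>x\<in>{x \<in> ?O. {fst x, snd x} = I}. ?g (fst x) (snd x)) = 2 * principal_minor W I"
      using ab by (simp add: principal_minor_doubleton)
  qed simp
  finally show ?thesis
    using assms by (simp add: elem_sym_eq_principal_minors sum_distrib_left[symmetric])
qed

lemma elem_sym_pderiv_2:
  fixes W :: "real^'n^'n"
  assumes "CARD('n) \<ge> 2"
  shows "elem_sym_pderiv 2 W k l = (if k = l then trace W else 0) - W $ l $ k"
proof -
  let ?V = "\<lambda>t. \<chi> i j. if i = k \<and> j = l then t else W $ i $ j"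
  have V: "((\<lambda>t. ?V t $ i $ j) has_field_derivative (if i = k \<and> j = l then 1 else 0)) (at x)" for i j x
    by (cases "i = k \<and> j = l") (simp_all only: vec_lambda_beta if_True if_False DERIV_ident DERIV_const simp_thms)
  have W: "?V (W $ k $ l) = W" by (simp add: vec_eq_iff)
  have tr: "((\<lambda>t. trace (?V t)) has_field_derivative (\<Sum>i\<in>UNIV. if i = k \<and> i = l then 1 else 0)) (at x)" for x
    unfolding trace_def by (intro DERIV_sum V)
  have trs: "(\<Sum>i\<in>UNIV. if i = k \<and> i = l then 1 else 0 :: real) = (if k = l then 1 else 0)"
    by (cases "k = l") (auto intro!: sum.neutral)
  have sq: "((\<lambda>t. \<Sum>a\<in>UNIV. \<Sum>b\<in>UNIV. ?V t $ a $ b * ?V t $ b $ a) has_field_derivative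
      (\<Sum>a\<in>UNIV. \<Sum>b\<in>UNIV. (if a = k \<and> b = l then 1 else 0) * ?V (W $ k $ l) $ b $ a +
         (if b = k \<and> a = l then 1 else 0) * ?V (W $ k $ l) $ a $ b)) (at (W $ k $ l))"
    by (intro DERIV_sum DERIV_mult V)
  have sqs: "(\<Sum>a\<in>UNIV. \<Sum>b\<in>UNIV. (if a = k \<and> b = l then 1 else 0) * W $ b $ a +
         (if b = k \<and> a = l then 1 else 0) * W $ a $ b) = 2 * W $ l $ k"
  proof -
    have "(\<Sum>a\<in>UNIV. \<Sum>b\<in>UNIV. (if a = k \<and> b = l then 1 else 0) * W $ b $ a)
        = (\<Sum>a\<in>UNIV. if a = k then W $ l $ k else 0)"
      by (intro sum.cong) (auto simp: if_distrib[of "\<lambda>x. x * _"] cong: if_cong)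
    moreover have "(\<Sum>a\<in>UNIV. \<Sum>b\<in>UNIV. (if b = k \<and> a = l then 1 else 0) * W $ a $ b)
        = (\<Sum>a\<in>UNIV. if a = l then W $ l $ k else 0)"
      by (intro sum.cong) (auto simp: if_distrib[of "\<lambda>x. x * _"] cong: if_cong)
    ultimately show ?thesis by (simp add: sum.distrib)
  qed
  have "((\<lambda>t. elem_sym 2 (?V t)) has_field_derivative (2 * trace W * (if k = l then 1 else 0) - 2 * W $ l $ k) / 2) (at (W $ k $ l))"
    unfolding elem_sym_2[OF assms] trace_def[of "_ ** _"]
    unfolding matrix_matrix_mult_def
    using DERIV_cdivide[OF DERIV_diff[OF DERIV_power[OF tr[of "W $ k $ l"], of 2] sq], of 2]
    by (simp only: trs W sqs vec_lambda_beta) (simp add: algebra_simps)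
  note D = DERIV_imp_deriv[OF this]
  show ?thesis
    unfolding elem_sym_pderiv_def D by (cases "k = l") simp_all
qed

text \<open>
  The determinant is affine in a single entry, with the cofactor as slope.
\<close>

lemma elem_sym_pderiv_card:
  fixes W :: "real^'n^'n"
  shows "elem_sym_pderiv CARD('n) W k l = det (\<chi> i. if i = k then axis l 1 else W $ i)"
proof -
  have "det (\<chi> i j. if i = k \<and> j = l then t else W $ i $ j) =
      det W + (t - W $ k $ l) * det (\<chi> i. if i = k then axis l 1 else W $ i)" for t
  proof -
    have "(\<chi> i j. if i = k \<and> j = l then t else W $ i $ j) =
        (\<chi> i. if i = k then W $ k + (t - W $ k $ l) *s axis l 1 else W $ i)"
      by (auto simp: vec_eq_iff axis_def)
    also have "det \<dots> = det (\<chi> i. if i = k then W $ k else W $ i) + 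
        (t - W $ k $ l) * det (\<chi> i. if i = k then axis l 1 else W $ i)"
      by (subst det_row_add) (simp add: det_row_mul)
    also have "(\<chi> i. if i = k then W $ k else W $ i) = W" by (simp add: vec_eq_iff)
    finally show ?thesis .
  qed
  then have "((\<lambda>t. elem_sym CARD('n) (\<chi> i j. if i = k \<and> j = l then t else W $ i $ j))
      has_field_derivative det (\<chi> i. if i = k then axis l 1 else W $ i)) (at (W $ k $ l))"
    unfolding elem_sym_card by (auto intro!: derivative_eq_intros)
  from DERIV_imp_deriv[OF this] show ?thesis by (simp add: elem_sym_pderiv_def)
qed

lemma elem_sym_pderiv_2_quadratic_form:
  fixes W :: "real^'n^'n"
  assumes "CARD('n) \<ge> 2"
  shows "(\<Sum>k\<in>UNIV. \<Sum>l\<in>UNIV. elem_sym_pderiv 2 W k l * p $ k * p $ l) = trace W * (p \<bullet> p) - p \<bullet> (W *v p)"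
proof -
  have "(\<Sum>k\<in>UNIV. \<Sum>l\<in>UNIV. elem_sym_pderiv 2 W k l * p $ k * p $ l) =
     (\<Sum>k\<in>UNIV. \<Sum>l\<in>UNIV. (if k = l then trace W * p $ k * p $ k else 0)) - (\<Sum>k\<in>UNIV. \<Sum>l\<in>UNIV. W $ l $ k * p $ k * p $ l)"
    unfolding elem_sym_pderiv_2[OF assms] sum_subtractf[symmetric]
    by (intro sum.cong) (auto simp: algebra_simps)
  also have "(\<Sum>k\<in>UNIV. \<Sum>l\<in>UNIV. W $ l $ k * p $ k * p $ l) = p \<bullet> (W *v p)"
    by (subst sum.swap) (simp add: inner_vec_def matrix_vector_mult_def sum_distrib_left mult_ac)
  also have "(\<Sum>k\<in>UNIV. \<Sum>l\<in>UNIV. (if k = l then trace W * p $ k * p $ k else 0)) = trace W * (p \<bullet> p)"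
    by (simp add: inner_vec_def sum_distrib_left mult_ac)
  finally show ?thesis .
qed

text \<open>
  For each \<open>k\<close> the sum over \<open>l\<close> is the determinant of \<open>W\<close> with row \<open>k\<close> replaced by \<open>p\<close>, to which
  Cramer's rule for \<open>W w = p\<close> applies.
\<close>

lemma elem_sym_pderiv_card_quadratic_form:
  fixes W :: "real^'n^'n"
  assumes W: "transpose W = W" and w: "W *v w = p"
  shows "(\<Sum>k\<in>UNIV. \<Sum>l\<in>UNIV. elem_sym_pderiv CARD('n) W k l * p $ k * p $ l) = det W * (p \<bullet> w)"
proof -
  let ?C = "\<lambda>k v. det (\<chi> i. if i = k then v else W $ i)"
  have "(\<Sum>l\<in>UNIV. elem_sym_pderiv CARD('n) W k l * p $ l) = w $ k * det W" for k
  proof -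
    have "(\<Sum>l\<in>UNIV. p $ l * ?C k (axis l 1)) = ?C k (\<Sum>l\<in>UNIV. p $ l *s axis l 1)"
      by (simp add: det_linear_row_sum det_row_mul)
    also have "(\<Sum>l\<in>UNIV. p $ l *s axis l 1) = p"
      by (rule basis_expansion)
    also have "?C k p = w $ k * det W"
    proof -
      have p: "p = (\<Sum>i\<in>UNIV. w $ i *s row i W)"
        unfolding w[symmetric] matrix_mult_sum using W by (metis row_transpose)
      show ?thesis
        unfolding p using cramer_lemma_transpose[of k w W] by (simp add: row_def cong: if_cong)
    qed
    finally show ?thesis by (simp add: elem_sym_pderiv_card mult.commute)
  qed
  moreover have "(\<Sum>l\<in>UNIV. elem_sym_pderiv CARD('n) W k l * p $ k * p $ l) =
      p $ k * (\<Sum>l\<in>UNIV. elem_sym_pderiv CARD('n) W k l * p $ l)" for k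
    unfolding sum_distrib_left by (intro sum.cong) auto
  ultimately show ?thesis by (simp add: inner_vec_def sum_distrib_left mult_ac)
qed

section \<open>Derivatives\<close>

text \<open>
  Half of the symmetry of second derivatives: the second difference quotient converges to the
  derivative, in direction \<open>w\<close>, of the derivative in direction \<open>v\<close>. The roles of \<open>v\<close> and \<open>w\<close> in the
  difference are symmetric. Differentiability of the one first derivative at the single point \<open>x\<close>
  suffices.
\<close>

lemma second_difference_expansion:
  fixes f :: "'a::real_normed_vector \<Rightarrow> real"
  assumes r: "r > 0" "\<And>y. dist y x < r \<Longrightarrow> (f has_derivative f' y) (at y)"
    and g: "((\<lambda>y. f' y v) has_derivative g) (at x)" and e: "e > 0"
  shows "\<exists>d>0. \<forall>h. 0 < h \<and> h < d \<longrightarrow>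
    \<bar>f (x + h *\<^sub>R v + h *\<^sub>R w) - f (x + h *\<^sub>R v) - f (x + h *\<^sub>R w) + f x - h\<^sup>2 * g w\<bar> \<le> e * h\<^sup>2"
proof -
  define F where "F y = f' y v" for y
  define N where "N = 2 * (norm v + norm w) + 1"
  have N: "N > 0" unfolding N_def by (simp add: add_nonneg_pos)
  have lin: "linear g" using g has_derivative_linear by blast
  obtain d where d: "d > 0" "\<And>y. norm (y - x) < d \<Longrightarrow> \<bar>F y - F x - g (y - x)\<bar> \<le> e / N * norm (y - x)"
    using g N e unfolding has_derivative_at_alt F_def real_norm_def by (metis divide_pos_pos)
  define \<delta> where "\<delta> = min r d / N"
  have "\<bar>f (x + h *\<^sub>R v + h *\<^sub>R w) - f (x + h *\<^sub>R v) - f (x + h *\<^sub>R w) + f x - h\<^sup>2 * g w\<bar> \<le> e * h\<^sup>2"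
    if h: "0 < h" "h < \<delta>" for h
  proof -
    have hN: "h * N < min r d" using h N by (simp add: \<delta>_def field_simps)
    have small: "norm (s *\<^sub>R v + t *\<^sub>R w) \<le> h * (norm v + norm w)" if "0 \<le> s" "s \<le> h" "0 \<le> t" "t \<le> h" for s t
    proof -
      have "norm (s *\<^sub>R v + t *\<^sub>R w) \<le> s * norm v + t * norm w"
        using norm_triangle_ineq[of "s *\<^sub>R v" "t *\<^sub>R w"] that by simp
      also have "\<dots> \<le> h * norm v + h * norm w"
        using that by (intro add_mono mult_right_mono) auto
      finally show ?thesis by (simp add: algebra_simps)
    qed
    have "h * (norm v + norm w) \<le> h * N" using h by (intro mult_left_mono) (auto simp: N_def)
    then have lt: "norm (s *\<^sub>R v + t *\<^sub>R w) < min r d" if "0 \<le> s" "s \<le> h" "0 \<le> t" "t \<le> h" for s t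
      using small[OF that] hN by linarith
    define G where "G s = f (x + s *\<^sub>R v + h *\<^sub>R w) - f (x + s *\<^sub>R v)" for s
    have fl: "((\<lambda>s. f (x + s *\<^sub>R v + z)) has_real_derivative F (x + s *\<^sub>R v + z)) (at s)"
      if "norm (s *\<^sub>R v + z) < r" for s z
    proof -
      have fd: "(f has_derivative f' (x + s *\<^sub>R v + z)) (at (x + s *\<^sub>R v + z))"
        using that r(2) by (simp add: dist_norm add.assoc)
      have "((\<lambda>s. f (x + s *\<^sub>R v + z)) has_derivative (\<lambda>t. f' (x + s *\<^sub>R v + z) (t *\<^sub>R v))) (at s)"
        by (rule has_derivative_compose[where f = "\<lambda>s. x + s *\<^sub>R v + z" and g = f, OF _ fd]) (auto intro!: derivative_eq_intros)
      moreover have "f' (x + s *\<^sub>R v + z) (t *\<^sub>R v) = F (x + s *\<^sub>R v + z) * t" for t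
        using linear_scale[OF has_derivative_linear[OF fd]] by (simp add: F_def)
      ultimately show ?thesis by (simp add: has_field_derivative_def)
    qed
    have G': "(G has_real_derivative F (x + s *\<^sub>R v + h *\<^sub>R w) - F (x + s *\<^sub>R v)) (at s)" if "0 \<le> s" "s \<le> h" for s
      unfolding G_def using lt[OF that, of h] lt[OF that, of 0] h
      by (intro DERIV_diff fl fl[of s 0, simplified]) auto
    \<comment> \<open>The second difference is an increment of \<open>G\<close>, so it is \<open>h\<close> times an increment of \<open>F\<close>.\<close>
    obtain \<xi> where \<xi>: "0 < \<xi>" "\<xi> < h" "G h - G 0 = (h - 0) * (F (x + \<xi> *\<^sub>R v + h *\<^sub>R w) - F (x + \<xi> *\<^sub>R v))"
      using MVT2[OF h(1) G'] by auto
    let ?a = "F (x + \<xi> *\<^sub>R v + h *\<^sub>R w) - F x - g (\<xi> *\<^sub>R v + h *\<^sub>R w)"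
    let ?b = "F (x + \<xi> *\<^sub>R v) - F x - g (\<xi> *\<^sub>R v)"
    have ab: "G h - G 0 - h\<^sup>2 * g w = h * (?a - ?b)"
      unfolding \<xi>(3) by (simp add: linear_add[OF lin] linear_scale[OF lin] algebra_simps power2_eq_square)
    have b1: "\<bar>?a\<bar> \<le> e / N * (h * (norm v + norm w))"
    proof -
      have "\<bar>?a\<bar> \<le> e / N * norm (\<xi> *\<^sub>R v + h *\<^sub>R w)"
        using d(2)[of "x + \<xi> *\<^sub>R v + h *\<^sub>R w"] lt[of \<xi> h] \<xi> h by (simp add: add.assoc)
      also have "\<dots> \<le> e / N * (h * (norm v + norm w))"
        using small[of \<xi> h] \<xi> h e N by (intro mult_left_mono) auto
      finally show ?thesis .
    qed
    have b2: "\<bar>?b\<bar> \<le> e / N * (h * (norm v + norm w))"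
    proof -
      have "\<bar>?b\<bar> \<le> e / N * norm (\<xi> *\<^sub>R v + 0 *\<^sub>R w)"
        using d(2)[of "x + \<xi> *\<^sub>R v"] lt[of \<xi> 0] \<xi> h by simp
      also have "\<dots> \<le> e / N * (h * (norm v + norm w))"
        using small[of \<xi> 0] \<xi> h e N by (intro mult_left_mono) auto
      finally show ?thesis .
    qed
    have "\<bar>?a - ?b\<bar> \<le> \<bar>?a\<bar> + \<bar>?b\<bar>" by (rule abs_triangle_ineq4)
    also have "\<dots> \<le> e / N * (h * (norm v + norm w)) + e / N * (h * (norm v + norm w))"
      using b1 b2 by (rule add_mono)
    also have "\<dots> = e / N * (h * (2 * (norm v + norm w)))" by simp
    also have "\<dots> \<le> e / N * (h * N)"
      using h e N by (intro mult_left_mono) (auto simp: N_def)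
    also have "\<dots> = e * h" using N by simp
    finally have "\<bar>h * (?a - ?b)\<bar> \<le> e * h\<^sup>2"
      using h by (simp add: abs_mult power2_eq_square)
    then show ?thesis unfolding ab[symmetric] by (simp add: G_def algebra_simps)
  qed
  moreover have "\<delta> > 0" using r d N by (simp add: \<delta>_def)
  ultimately show ?thesis by blast
qed

theorem symmetric_second_directional_derivatives:
  fixes f :: "'a::real_normed_vector \<Rightarrow> real"
  assumes r: "r > 0" "\<And>y. dist y x < r \<Longrightarrow> (f has_derivative f' y) (at y)"
    and g: "((\<lambda>y. f' y v) has_derivative g) (at x)" and k: "((\<lambda>y. f' y w) has_derivative k) (at x)"
  shows "g w = k v"
proof -
  have "\<bar>g w - k v\<bar> \<le> 2 * e" if e: "e > 0" for e
  proof -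
    obtain d where d: "d > 0" "\<forall>h. 0 < h \<and> h < d \<longrightarrow>
      \<bar>f (x + h *\<^sub>R v + h *\<^sub>R w) - f (x + h *\<^sub>R v) - f (x + h *\<^sub>R w) + f x - h\<^sup>2 * g w\<bar> \<le> e * h\<^sup>2"
      using second_difference_expansion[OF r g e, of w] by blast
    obtain d' where d': "d' > 0" "\<forall>h. 0 < h \<and> h < d' \<longrightarrow>
      \<bar>f (x + h *\<^sub>R w + h *\<^sub>R v) - f (x + h *\<^sub>R w) - f (x + h *\<^sub>R v) + f x - h\<^sup>2 * k v\<bar> \<le> e * h\<^sup>2"
      using second_difference_expansion[OF r k e, of v] by blast
    define h where "h = min d d' / 2"
    have h: "0 < h" "h < d" "h < d'" using d d' by (auto simp: h_def)
    have sw: "x + h *\<^sub>R v + h *\<^sub>R w = x + h *\<^sub>R w + h *\<^sub>R v" by simp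
    have "\<bar>h\<^sup>2 * g w - h\<^sup>2 * k v\<bar> \<le> 2 * (e * h\<^sup>2)"
      using d(2)[rule_format, of h] d'(2)[rule_format, of h] h unfolding sw by linarith
    moreover have "\<bar>h\<^sup>2 * g w - h\<^sup>2 * k v\<bar> = h\<^sup>2 * \<bar>g w - k v\<bar>"
      unfolding right_diff_distrib[symmetric] by (simp add: abs_mult)
    ultimately have "h\<^sup>2 * \<bar>g w - k v\<bar> \<le> h\<^sup>2 * (2 * e)"
      by (simp only: mult_ac)
    then show ?thesis using h by simp
  qed
  from this[of "\<bar>g w - k v\<bar> / 4"] show ?thesis by (cases "g w = k v") auto
qed

lemma second_derivative_nonpos_at_max:
  fixes f f' :: "real \<Rightarrow> real"
  assumes d: "d > 0" and f: "\<And>t. \<bar>t\<bar> < d \<Longrightarrow> (f has_real_derivative f' t) (at t)"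
    and f': "(f' has_real_derivative c) (at 0)" and max: "\<And>t. \<bar>t\<bar> < d \<Longrightarrow> f t \<le> f 0"
  shows "c \<le> 0"
proof (rule ccontr)
  assume "\<not> c \<le> 0"
  then have c: "c > 0" by simp
  have "f' 0 = 0"
    using DERIV_local_max[OF f[of 0] d] max d by simp
  obtain e where e: "e > 0" "\<And>h. 0 < h \<Longrightarrow> h < e \<Longrightarrow> f' 0 < f' (0 + h)"
    using DERIV_pos_inc_right[OF f' c] by blast
  define h where "h = min d e / 2"
  have h: "0 < h" "h < d" "h < e" using d e by (auto simp: h_def)
  obtain z where "0 < z" "z < h" "f h - f 0 = (h - 0) * f' z"
    using MVT2[OF h(1), of f f'] f h by auto
  moreover have "f' z > 0" using e(2)[of z] h \<open>f' 0 = 0\<close> calculation by simp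
  ultimately have "f h - f 0 > 0" using h by simp
  then show False using max[of h] h by simp
qed

lemma DERIV_inner_vec:
  fixes v w :: "real \<Rightarrow> real^'n"
  assumes "\<And>i. ((\<lambda>t. v t $ i) has_real_derivative v' $ i) (at x)" "\<And>i. ((\<lambda>t. w t $ i) has_real_derivative w' $ i) (at x)"
  shows "((\<lambda>t. v t \<bullet> w t) has_real_derivative v' \<bullet> w x + v x \<bullet> w') (at x)"
proof -
  have "((\<lambda>t. \<Sum>i\<in>UNIV. v t $ i * w t $ i) has_real_derivative (\<Sum>i\<in>UNIV. v' $ i * w x $ i + w' $ i * v x $ i)) (at x)"
    by (intro DERIV_sum DERIV_mult assms)
  then show ?thesis by (simp add: inner_vec_def sum.distrib mult.commute)
qed

lemma DERIV_matrix_vector: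
  fixes A :: "real \<Rightarrow> real^'n^'n" and w :: "real \<Rightarrow> real^'n"
  assumes "\<And>i j. ((\<lambda>t. A t $ i $ j) has_real_derivative A' $ i $ j) (at x)" "\<And>i. ((\<lambda>t. w t $ i) has_real_derivative w' $ i) (at x)"
  shows "((\<lambda>t. (A t *v w t) $ i) has_real_derivative (A' *v w x + A x *v w') $ i) (at x)"
proof -
  have "((\<lambda>t. \<Sum>j\<in>UNIV. A t $ i $ j * w t $ j) has_real_derivative (\<Sum>j\<in>UNIV. A' $ i $ j * w x $ j + w' $ j * A x $ i $ j)) (at x)"
    by (intro DERIV_sum DERIV_mult assms)
  then show ?thesis by (simp add: matrix_vector_mult_def sum.distrib mult.commute)
qed

lemma DERIV_trace:
  fixes A :: "real \<Rightarrow> real^'n^'n"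
  assumes "\<And>i j. ((\<lambda>t. A t $ i $ j) has_real_derivative A' $ i $ j) (at x)"
  shows "((\<lambda>t. trace (A t)) has_real_derivative trace A') (at x)"
  unfolding trace_def by (intro DERIV_sum assms)

lemma tendsto_det:
  fixes A :: "'a \<Rightarrow> real^'n^'n"
  assumes "\<And>i j. ((\<lambda>t. A t $ i $ j) \<longlongrightarrow> B $ i $ j) F"
  shows "((\<lambda>t. det (A t)) \<longlongrightarrow> det B) F"
  unfolding det_def by (intro tendsto_intros assms)

text \<open>
  Cramer's rule gives continuity of the solution \<open>w\<close>. The derivative can then be read off from
  \<open>A(0) (w(t) - w(0)) = (p(t) - p(0)) - (A(t) - A(0)) w(t)\<close> after division by \<open>t\<close>.
\<close>

lemma DERIV_linear_system_solution:
  fixes A :: "real \<Rightarrow> real^'n^'n" and p w :: "real \<Rightarrow> real^'n"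
  assumes ev: "eventually (\<lambda>t. A t *v w t = p t) (at 0)" and eq0: "A 0 *v w 0 = p 0"
    and C: "C ** A 0 = mat 1"
    and A: "\<And>i j. ((\<lambda>t. A t $ i $ j) has_real_derivative A' $ i $ j) (at 0)"
    and p: "\<And>i. ((\<lambda>t. p t $ i) has_real_derivative p' $ i) (at 0)"
  shows "((\<lambda>t. w t $ i) has_real_derivative (C *v (p' - A' *v w 0)) $ i) (at 0)"
proof -
  have det0: "det (A 0) \<noteq> 0"
    using C by (metis det_I det_mul mult_zero_right zero_neq_one)
  have Al: "((\<lambda>t. A t $ i $ j) \<longlongrightarrow> A 0 $ i $ j) (at 0)" for i j
    using DERIV_isCont[OF A] by (simp add: isCont_def)
  have pl: "((\<lambda>t. p t $ i) \<longlongrightarrow> p 0 $ i) (at 0)" for i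
    using DERIV_isCont[OF p] by (simp add: isCont_def)
  have dl: "((\<lambda>t. det (A t)) \<longlongrightarrow> det (A 0)) (at 0)"
    by (intro tendsto_det Al)
  have cont: "((\<lambda>t. w t $ k) \<longlongrightarrow> w 0 $ k) (at 0)" for k
  proof -
    let ?M = "\<lambda>t. \<chi> i j. if j = k then p t $ i else A t $ i $ j"
    have "((\<lambda>t. det (?M t)) \<longlongrightarrow> det (?M 0)) (at 0)"
      by (rule tendsto_det) (auto intro: Al pl)
    then have "((\<lambda>t. det (?M t) / det (A t)) \<longlongrightarrow> det (?M 0) / det (A 0)) (at 0)"
      using dl det0 by (intro tendsto_divide)
    moreover have "det (?M 0) = w 0 $ k * det (A 0)"
      using cramer_lemma[of k "A 0" "w 0"] by (simp add: eq0 cong: if_cong)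
    moreover have "eventually (\<lambda>t. det (A t) \<noteq> 0) (at 0)"
      using dl det0 by (rule tendsto_imp_eventually_ne)
    then have "eventually (\<lambda>t. det (?M t) / det (A t) = w t $ k) (at 0)"
      using ev
    proof eventually_elim
      case (elim t)
      then show ?case using cramer_lemma[of k "A t" "w t"] by (simp cong: if_cong)
    qed
    ultimately show ?thesis
      using det0 by (simp add: Lim_transform_eventually)
  qed
  have slope: "((\<lambda>t. (A t $ i $ j - A 0 $ i $ j) / t) \<longlongrightarrow> A' $ i $ j) (at 0)"
      "((\<lambda>t. (p t $ i - p 0 $ i) / t) \<longlongrightarrow> p' $ i) (at 0)" for i j
    using A[of i j] p[of i] by (auto simp: has_field_derivative_iff)
  have "((\<lambda>t. \<Sum>k\<in>UNIV. C $ i $ k * ((p t $ k - p 0 $ k) / t - (\<Sum>j\<in>UNIV. (A t $ k $ j - A 0 $ k $ j) / t * w t $ j)))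
     \<longlongrightarrow> (\<Sum>k\<in>UNIV. C $ i $ k * (p' $ k - (\<Sum>j\<in>UNIV. A' $ k $ j * w 0 $ j)))) (at 0)"
    by (intro tendsto_intros slope cont)
  moreover have "eventually (\<lambda>t. (\<Sum>k\<in>UNIV. C $ i $ k * ((p t $ k - p 0 $ k) / t - (\<Sum>j\<in>UNIV. (A t $ k $ j - A 0 $ k $ j) / t * w t $ j)))
     = (w t $ i - w 0 $ i) / t) (at 0)"
    using ev eventually_at_ball'[of 1 0 UNIV, simplified]
  proof eventually_elim
    case (elim t)
    have "w t - w 0 = C *v (A 0 *v (w t - w 0))"
      using C by (simp add: matrix_vector_mul_assoc)
    also have "A 0 *v (w t - w 0) = (p t - p 0) - (A t - A 0) *v w t"
      using elim(1) eq0 by (simp add: matrix_vector_mult_diff_distrib matrix_vector_mult_diff_rdistrib)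
    finally have "(w t - w 0) $ i = (C *v ((p t - p 0) - (A t - A 0) *v w t)) $ i" by simp
    then have wi: "w t $ i - w 0 $ i =
        (\<Sum>k\<in>UNIV. C $ i $ k * (p t $ k - p 0 $ k - (\<Sum>j\<in>UNIV. (A t $ k $ j - A 0 $ k $ j) * w t $ j)))"
      by (simp add: matrix_vector_mult_def)
    have "(\<Sum>j\<in>UNIV. (A t $ k $ j - A 0 $ k $ j) / t * w t $ j) =
        (\<Sum>j\<in>UNIV. (A t $ k $ j - A 0 $ k $ j) * w t $ j) / t" for k
      unfolding sum_divide_distrib by (intro sum.cong) auto
    then have "C $ i $ k * ((p t $ k - p 0 $ k) / t - (\<Sum>j\<in>UNIV. (A t $ k $ j - A 0 $ k $ j) / t * w t $ j)) =
        C $ i $ k * (p t $ k - p 0 $ k - (\<Sum>j\<in>UNIV. (A t $ k $ j - A 0 $ k $ j) * w t $ j)) / t" for k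
      by (simp only: diff_divide_distrib[symmetric] times_divide_eq_right)
    then show ?case
      unfolding wi sum_divide_distrib[of "\<lambda>k. C $ i $ k * _ k"] by (intro sum.cong refl)
  qed
  ultimately have "((\<lambda>t. (w t $ i - w 0 $ i) / t) \<longlongrightarrow> (C *v (p' - A' *v w 0)) $ i) (at 0)"
    by (simp add: matrix_vector_mult_def Lim_transform_eventually)
  then show ?thesis by (simp add: has_field_derivative_iff)
qed

lemma linear_eq_on_open_translate:
  fixes f g :: "'a::euclidean_space \<Rightarrow> 'b::real_normed_vector"
  assumes "linear f" "linear g" "open U" "U \<noteq> {}" "\<And>y. y \<in> U \<Longrightarrow> f (y - x) = g (y - x)"
  shows "f = g"
proof
  fix v
  obtain y where y: "y \<in> U" using assms by blast
  have "((\<lambda>t::real. y + t *\<^sub>R v) \<longlongrightarrow> y + 0 *\<^sub>R v) (at 0)" by (intro tendsto_intros)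
  then have "eventually (\<lambda>t::real. y + t *\<^sub>R v \<in> U) (at 0)"
    using assms(3) y by (intro topological_tendstoD) auto
  then have "eventually (\<lambda>t::real. y + t *\<^sub>R v \<in> U \<and> t \<noteq> 0) (at 0)"
    by (intro eventually_conj eventually_neq_at_within)
  then obtain t :: real where t: "t \<noteq> 0" "y + t *\<^sub>R v \<in> U"
    using eventually_happens'[OF at_neq_bot] by blast
  have "f (t *\<^sub>R v) = f ((y + t *\<^sub>R v) - x) - f (y - x)"
    by (subst linear_diff[OF assms(1), symmetric]) simp
  also have "\<dots> = g ((y + t *\<^sub>R v) - x) - g (y - x)"
    using assms(5) y t by simp
  also have "\<dots> = g (t *\<^sub>R v)"
    by (subst linear_diff[OF assms(2), symmetric]) simp
  finally show "f v = g v" using t by (simp add: linear_scale[OF assms(1)] linear_scale[OF assms(2)])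
qed

text \<open>
  Two derivatives agree on all directions pointing from \<open>x\<close> into the interior, and these form an open
  set, which determines a linear map. At a boundary point coordinate directions alone might not
  point into the set.
\<close>

lemma derivative_within_convex_unique:
  fixes f :: "'a::euclidean_space \<Rightarrow> 'b::real_normed_vector"
  assumes S: "convex S" "interior S \<noteq> {}" "x \<in> S"
    and f: "(f has_derivative f') (at x within S)" "(f has_derivative f'') (at x within S)"
  shows "f' = f''"
proof (rule linear_eq_on_open_translate[OF _ _ open_interior S(2)])
  show "linear f'" "linear f''" using f has_derivative_linear by blast+
  fix y assume "y \<in> interior S"
  then have y: "y \<in> S" using interior_subset by blast
  define c where "c t = x + t *\<^sub>R (y - x)" for t :: real
  have cS: "c ` {0..1} \<subseteq> S"
    using S(1,3) y unfolding c_def by (auto simp: convex_alt algebra_simps)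
  have c: "(c has_derivative (\<lambda>t. t *\<^sub>R (y - x))) (at 0 within {0..1})"
    unfolding c_def by (auto intro!: derivative_eq_intros)
  have "(f has_derivative g) (at (c 0) within c ` {0..1})" if "(f has_derivative g) (at x within S)" for g
    using that cS by (auto simp: c_def intro: has_derivative_subset)
  then have *: "((f \<circ> c) has_derivative (g \<circ> (\<lambda>t. t *\<^sub>R (y - x)))) (at 0 within {0..1})"
    if "(f has_derivative g) (at x within S)" for g
    using that diff_chain_within[OF c] by blast
  have "(f' \<circ> (\<lambda>t. t *\<^sub>R (y - x))) = (f'' \<circ> (\<lambda>t. t *\<^sub>R (y - x)))"
    using frechet_derivative_unique_within_closed_interval[of 0 "1::real" 0 "f \<circ> c"] *[OF f(1)] *[OF f(2)] by simp
  from fun_cong[OF this, of 1] show "f' (y - x) = f'' (y - x)" by simp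
qed

lemma DERIV_at_shift:
  fixes e :: "'a::real_normed_vector"
  shows "((\<lambda>t. g (x + t *\<^sub>R e)) has_real_derivative c) (at s) \<longleftrightarrow>
    ((\<lambda>t. g ((x + s *\<^sub>R e) + t *\<^sub>R e)) has_real_derivative c) (at 0)"
  using DERIV_shift[of "\<lambda>t. g (x + t *\<^sub>R e)" c 0 s]
  by (simp add: scaleR_add_left algebra_simps)

lemma gradient_derivative:
  assumes "f differentiable (at x within T)"
  shows "(f has_derivative (\<lambda>h. gradient T f x \<bullet> h)) (at x within T)"
proof -
  have f: "(f has_derivative frechet_derivative f (at x within T)) (at x within T)"
    using assms frechet_derivative_works by blast
  have "frechet_derivative f (at x within T) h = gradient T f x \<bullet> h" for h
  proof -
    have "h = (\<Sum>k\<in>UNIV. (h $ k) *\<^sub>R axis k 1)"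
      using basis_expansion[of h] by (simp add: scalar_mult_eq_scaleR)
    then have "frechet_derivative f (at x within T) h =
        frechet_derivative f (at x within T) (\<Sum>k\<in>UNIV. (h $ k) *\<^sub>R axis k 1)" by simp
    also have "\<dots> = (\<Sum>k\<in>UNIV. h $ k * frechet_derivative f (at x within T) (axis k 1))"
      using has_derivative_linear[OF f] by (simp add: linear_sum linear_scale)
    finally show ?thesis by (simp add: gradient_def pderiv_within_def inner_vec_def mult.commute)
  qed
  then have "frechet_derivative f (at x within T) = (\<lambda>h. gradient T f x \<bullet> h)" by (rule ext)
  with f show ?thesis by simp
qed

section \<open>The solution and its derivatives\<close>

locale monge_ampere_solution =
  fixes \<Omega> :: "(real^'n) set" and u :: "real^'n \<Rightarrow> real"
  assumes dim: "CARD('n) \<ge> 2"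
    and bounded_domain: "bounded \<Omega>" and domain: "strictly_convex_domain \<Omega>" and boundary: "smooth_boundary \<Omega>"
    and smooth: "smooth_within (closure \<Omega>) u" and convex_solution: "strictly_convex_function (closure \<Omega>) u"
    and det_eq: "\<forall>x\<in>\<Omega>. det (hessian (closure \<Omega>) u x) = 1"
    and boundary_value: "\<forall>x\<in>frontier \<Omega>. u x = 0"
begin

abbreviation S where "S \<equiv> closure \<Omega>"
abbreviation D where "D ks \<equiv> iter_pderiv_within S ks u"
abbreviation Du where "Du \<equiv> gradient S u"
abbreviation A where "A \<equiv> hessian S u"

lemma open_domain: "open \<Omega>" and nonempty: "\<Omega> \<noteq> {}"
  using domain by (auto simp: strictly_convex_domain_def)

lemma open_segment_in_domain: "x \<in> S \<Longrightarrow> y \<in> S \<Longrightarrow> x \<noteq> y \<Longrightarrow> open_segment x y \<subseteq> \<Omega>"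
  using domain by (auto simp: strictly_convex_domain_def)

lemma domain_subset: "x \<in> \<Omega> \<Longrightarrow> x \<in> S"
  using closure_subset by blast

lemma convex_domain: "convex \<Omega>"
  unfolding convex_contains_segment
proof (intro ballI)
  fix a b assume "a \<in> \<Omega>" "b \<in> \<Omega>"
  then show "closed_segment a b \<subseteq> \<Omega>"
    using open_segment_in_domain[of a b] domain_subset
    by (cases "a = b") (auto simp: closed_segment_eq_open)
qed

lemma convex_S: "convex S" by (simp add: convex_domain convex_closure)

lemma compact_S: "compact S" by (simp add: bounded_domain compact_closure)

lemma interior_S: "interior S = \<Omega>"
  by (simp only: convex_interior_closure[OF convex_domain] interior_open[OF open_domain])

lemma frontier_eq: "frontier \<Omega> = S - \<Omega>"
  using open_domain by (metis frontier_def interior_open)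

lemma at_within_domain: "x \<in> \<Omega> \<Longrightarrow> at x within S = at x"
  using at_within_interior[of x S] unfolding interior_S .

lemma D_has_derivative_within:
  assumes "x \<in> S"
  shows "(D ks has_derivative (\<lambda>h. \<Sum>k\<in>UNIV. h $ k * D (k # ks) x)) (at x within S)"
proof -
  have "D ks differentiable (at x within S)"
    using smooth assms by (simp add: smooth_within_def)
  from gradient_derivative[OF this] show ?thesis
    by (simp add: inner_vec_def gradient_def mult.commute)
qed

lemma D_has_derivative:
  "x \<in> \<Omega> \<Longrightarrow> (D ks has_derivative (\<lambda>h. \<Sum>k\<in>UNIV. h $ k * D (k # ks) x)) (at x)"
  using D_has_derivative_within[of x ks] domain_subset[of x] at_within_domain[of x] by (simp only:)

lemma continuous_on_D: "continuous_on S (D ks)"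
  unfolding continuous_on_eq_continuous_within
  using has_derivative_continuous[OF D_has_derivative_within[of _ ks]] by blast

lemma gradient_component: "Du x $ k = D [k] x" by (simp add: gradient_def)

lemma hessian_component: "A x $ k $ l = D [k, l] x" by (simp add: hessian_def)

lemma positive_definite_hessian: "x \<in> S \<Longrightarrow> positive_definite (A x)"
  using convex_solution by (simp add: strictly_convex_function_def)

lemma transpose_hessian: "x \<in> S \<Longrightarrow> transpose (A x) = A x"
  using positive_definite_hessian by (simp add: positive_definite_def)

lemma hessian_commute: "x \<in> S \<Longrightarrow> A x $ k $ l = A x $ l $ k"
  using transpose_hessian[of x] by (simp add: transpose_def vec_eq_iff)

lemma u_has_derivative: "x \<in> S \<Longrightarrow> (u has_derivative (\<lambda>h. Du x \<bullet> h)) (at x within S)"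
  using D_has_derivative_within[of x "[]"]
  by (simp add: inner_vec_def gradient_component mult.commute)

lemma gradient_has_derivative: "x \<in> S \<Longrightarrow> (Du has_derivative (\<lambda>h. A x *v h)) (at x within S)"
proof (subst has_derivative_componentwise_within, intro ballI)
  fix i :: "real^'n" assume x: "x \<in> S" and "i \<in> Basis"
  then obtain k where i: "i = axis k 1" by (auto simp: Basis_vec_def)
  have "(\<lambda>h. \<Sum>j\<in>UNIV. h $ j * D [j, k] x) = (\<lambda>h. (A x *v h) \<bullet> i)"
    using hessian_commute[OF x]
    by (simp add: i inner_axis matrix_vector_mult_def hessian_component mult.commute fun_eq_iff)
  moreover have "(\<lambda>y. Du y \<bullet> i) = D [k]"
    by (simp add: i inner_axis gradient_component fun_eq_iff)
  ultimately show "((\<lambda>y. Du y \<bullet> i) has_derivative (\<lambda>h. (A x *v h) \<bullet> i)) (at x within S)"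
    using D_has_derivative_within[OF x, of "[k]"] by simp
qed

lemma continuous_on_u: "continuous_on S u"
  using continuous_on_D[of "[]"] by simp

lemma continuous_on_gradient: "continuous_on S Du"
  unfolding continuous_on_eq_continuous_within
  using has_derivative_continuous[OF gradient_has_derivative] by blast

lemma D_swap:
  assumes x: "x \<in> \<Omega>"
  shows "D (i # j # ks) x = D (j # i # ks) x"
proof -
  obtain r where r: "r > 0" "ball x r \<subseteq> \<Omega>"
    using open_domain x open_contains_ball by blast
  have ax: "(\<Sum>k\<in>UNIV. (axis j 1 :: real^'n) $ k * c k) = c j" for j and c :: "'n \<Rightarrow> real"
    by (simp add: axis_def if_distrib[of "\<lambda>x. x * _"] cong: if_cong)
  have 1: "(D ks has_derivative (\<lambda>h. \<Sum>k\<in>UNIV. h $ k * D (k # ks) y)) (at y)" if "dist y x < r" for y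
    using that r by (intro D_has_derivative) (auto simp: dist_commute)
  have 2: "((\<lambda>y. \<Sum>k\<in>UNIV. (axis j 1 :: real^'n) $ k * D (k # ks) y) has_derivative
      (\<lambda>h. \<Sum>k\<in>UNIV. h $ k * D (k # j # ks) x)) (at x)" for j
    unfolding ax by (rule D_has_derivative[OF x])
  show ?thesis
    using symmetric_second_directional_derivatives[OF r(1) 1 2[of j] 2[of i]] by (simp only: ax)
qed

lemma D_Cons_cong:
  assumes eq: "\<And>y. y \<in> \<Omega> \<Longrightarrow> D ks y = D ks' y" and x: "x \<in> \<Omega>"
  shows "D (k # ks) x = D (k # ks') x"
proof -
  have ax: "(\<Sum>k\<in>UNIV. (axis j 1 :: real^'n) $ k * c k) = c j" for j and c :: "'n \<Rightarrow> real"
    by (simp add: axis_def if_distrib[of "\<lambda>x. x * _"] cong: if_cong)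
  have "(D ks' has_derivative (\<lambda>h. \<Sum>k\<in>UNIV. h $ k * D (k # ks) x)) (at x)"
    by (rule has_derivative_transform_within_open[OF D_has_derivative[OF x, of ks] open_domain x eq])
  from fun_cong[OF has_derivative_unique[OF this D_has_derivative[OF x, of ks']], of "axis k 1"]
  show ?thesis by (simp only: ax)
qed

lemma D_swap3: "x \<in> \<Omega> \<Longrightarrow> D (k # i # j # ks) x = D (k # j # i # ks) x"
  by (rule D_Cons_cong[OF D_swap])

lemma D_swap4: "x \<in> \<Omega> \<Longrightarrow> D (l # k # i # j # ks) x = D (l # k # j # i # ks) x"
  by (rule D_Cons_cong[OF D_swap3])

lemma D_has_derivative_on_line:
  assumes "x + s *\<^sub>R e \<in> \<Omega>"
  shows "((\<lambda>t. D ks (x + t *\<^sub>R e)) has_real_derivative (\<Sum>k\<in>UNIV. e $ k * D (k # ks) (x + s *\<^sub>R e))) (at s)"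
proof -
  have "((\<lambda>t. D ks (x + t *\<^sub>R e)) has_derivative (\<lambda>h. \<Sum>k\<in>UNIV. (h *\<^sub>R e) $ k * D (k # ks) (x + s *\<^sub>R e))) (at s)"
    by (rule has_derivative_compose[where f = "\<lambda>t. x + t *\<^sub>R e" and g = "D ks", OF _ D_has_derivative[OF assms]])
       (auto intro!: derivative_eq_intros)
  moreover have "(\<Sum>k\<in>UNIV. (h *\<^sub>R e) $ k * D (k # ks) (x + s *\<^sub>R e)) = (\<Sum>k\<in>UNIV. e $ k * D (k # ks) (x + s *\<^sub>R e)) * h" for h
    unfolding sum_distrib_right by (intro sum.cong) auto
  ultimately show ?thesis by (simp add: has_field_derivative_def)
qed

text \<open>
  \<open>dA v x\<close> is the directional derivative \<open>\<partial>\<^sub>vA\<close> of the Hessian at \<open>x\<close>, and \<open>ddA v x\<close> below is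
  \<open>\<partial>\<^sub>v\<partial>\<^sub>vA\<close>.
\<close>

definition dA :: "real^'n \<Rightarrow> real^'n \<Rightarrow> real^'n^'n" where
  "dA v x = (\<chi> k l. \<Sum>i\<in>UNIV. v $ i * D [i, k, l] x)"

definition ddA :: "real^'n \<Rightarrow> real^'n \<Rightarrow> real^'n^'n" where
  "ddA v x = (\<chi> k l. \<Sum>i\<in>UNIV. v $ i * (\<Sum>j\<in>UNIV. v $ j * D [j, i, k, l] x))"

lemma hessian_on_line:
  "x + s *\<^sub>R e \<in> \<Omega> \<Longrightarrow> ((\<lambda>t. A (x + t *\<^sub>R e) $ k $ l) has_real_derivative dA e (x + s *\<^sub>R e) $ k $ l) (at s)"
  unfolding hessian_component dA_def vec_lambda_beta by (rule D_has_derivative_on_line)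

lemma dA_on_line:
  "x + s *\<^sub>R e \<in> \<Omega> \<Longrightarrow> ((\<lambda>t. dA e (x + t *\<^sub>R e) $ k $ l) has_real_derivative ddA e (x + s *\<^sub>R e) $ k $ l) (at s)"
  unfolding ddA_def dA_def vec_lambda_beta
  by (intro DERIV_sum DERIV_cmult D_has_derivative_on_line)

lemma gradient_on_line:
  assumes "x + s *\<^sub>R e \<in> \<Omega>"
  shows "((\<lambda>t. Du (x + t *\<^sub>R e) $ k) has_real_derivative (A (x + s *\<^sub>R e) *v e) $ k) (at s)"
proof -
  have "(\<Sum>j\<in>UNIV. e $ j * D [j, k] (x + s *\<^sub>R e)) = (A (x + s *\<^sub>R e) *v e) $ k"
    using hessian_commute[OF domain_subset[OF assms]]
    by (simp add: matrix_vector_mult_def hessian_component mult.commute)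
  then show ?thesis
    unfolding gradient_component using D_has_derivative_on_line[OF assms, of "[k]"] by simp
qed

lemma dA_transpose: "x \<in> \<Omega> \<Longrightarrow> transpose (dA v x) = dA v x"
  unfolding dA_def transpose_def vec_eq_iff vec_lambda_beta
  by (intro allI sum.cong refl arg_cong[of _ _ "\<lambda>y. _ * y"] D_swap3)

text \<open>
  The third derivatives form a symmetric trilinear form; likewise the fourth derivatives in
  \<open>ddA_commute\<close>.
\<close>

lemma dA_commute: "x \<in> \<Omega> \<Longrightarrow> dA v x *v w = dA w x *v v"
proof -
  assume x: "x \<in> \<Omega>"
  have "(\<Sum>l\<in>UNIV. (\<Sum>i\<in>UNIV. v $ i * D [i, k, l] x) * w $ l) = (\<Sum>l\<in>UNIV. (\<Sum>i\<in>UNIV. w $ i * D [i, k, l] x) * v $ l)" for k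
  proof -
    have "D [i, k, l] x = D [l, k, i] x" for i l
      using D_swap[OF x, of i k "[l]"] D_swap3[OF x, of k i l "[]"] D_swap[OF x, of k l "[i]"] by (simp only:)
    then have "(\<Sum>l\<in>UNIV. (\<Sum>i\<in>UNIV. v $ i * D [i, k, l] x) * w $ l) = (\<Sum>l\<in>UNIV. \<Sum>i\<in>UNIV. v $ i * D [l, k, i] x * w $ l)"
      by (simp only: sum_distrib_right)
    also have "\<dots> = (\<Sum>i\<in>UNIV. \<Sum>l\<in>UNIV. v $ i * D [l, k, i] x * w $ l)" by (rule sum.swap)
    also have "\<dots> = (\<Sum>i\<in>UNIV. (\<Sum>l\<in>UNIV. w $ l * D [l, k, i] x) * v $ i)"
      unfolding sum_distrib_right by (intro sum.cong refl) (simp only: mult_ac)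
    finally show ?thesis .
  qed
  then show ?thesis
    unfolding dA_def matrix_vector_mult_def vec_eq_iff vec_lambda_beta by (intro allI)
qed

lemma ddA_commute: "x \<in> \<Omega> \<Longrightarrow> w \<bullet> (ddA v x *v w) = v \<bullet> (ddA w x *v v)"
proof -
  assume x: "x \<in> \<Omega>"
  have expand: "w \<bullet> (ddA v x *v w) = (\<Sum>k\<in>UNIV. \<Sum>l\<in>UNIV. \<Sum>i\<in>UNIV. \<Sum>j\<in>UNIV. w $ k * w $ l * v $ i * v $ j * D [j, i, k, l] x)" for v w
    by (simp only: ddA_def inner_vec_def matrix_vector_mult_def vec_lambda_beta sum_distrib_left sum_distrib_right mult_ac inner_real_def)
  have sym: "D [j, i, k, l] x = D [l, k, i, j] x" for i j k l
    using D_swap[OF x, of j i "[k, l]"] D_swap3[OF x, of i j k "[l]"] D_swap4[OF x, of i k j l "[]"]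
      D_swap[OF x, of i k "[l, j]"] D_swap3[OF x, of k i l "[j]"] D_swap[OF x, of k l "[i, j]"] by (simp only:)
  have "w \<bullet> (ddA v x *v w) = (\<Sum>k\<in>UNIV. \<Sum>l\<in>UNIV. \<Sum>i\<in>UNIV. \<Sum>j\<in>UNIV. v $ i * v $ j * w $ k * w $ l * D [l, k, i, j] x)"
    unfolding expand by (intro sum.cong refl) (subst sym, simp only: mult_ac)
  also have "\<dots> = (\<Sum>k\<in>UNIV. \<Sum>i\<in>UNIV. \<Sum>l\<in>UNIV. \<Sum>j\<in>UNIV. v $ i * v $ j * w $ k * w $ l * D [l, k, i, j] x)"
    by (intro sum.cong refl sum.swap)
  also have "\<dots> = (\<Sum>i\<in>UNIV. \<Sum>k\<in>UNIV. \<Sum>j\<in>UNIV. \<Sum>l\<in>UNIV. v $ i * v $ j * w $ k * w $ l * D [l, k, i, j] x)"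
    by (subst sum.swap) (intro sum.cong refl sum.swap)
  also have "\<dots> = (\<Sum>i\<in>UNIV. \<Sum>j\<in>UNIV. \<Sum>k\<in>UNIV. \<Sum>l\<in>UNIV. v $ i * v $ j * w $ k * w $ l * D [l, k, i, j] x)"
    by (intro sum.cong refl sum.swap)
  finally show ?thesis unfolding expand .
qed

lemma near_in_domain:
  assumes "x \<in> \<Omega>"
  obtains d where "d > 0" "\<And>t. \<bar>t\<bar> < d \<Longrightarrow> x + t *\<^sub>R e \<in> \<Omega>"
proof -
  obtain r where r: "r > 0" "ball x r \<subseteq> \<Omega>"
    using open_domain assms open_contains_ball by blast
  define d where "d = r / (norm e + 1)"
  have "x + t *\<^sub>R e \<in> \<Omega>" if "\<bar>t\<bar> < d" for t
  proof -
    have "\<bar>t\<bar> * norm e \<le> \<bar>t\<bar> * (norm e + 1)" by (intro mult_left_mono) auto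
    also have "\<dots> < r" using that by (simp add: d_def field_simps add_pos_nonneg)
    finally have "x + t *\<^sub>R e \<in> ball x r" by (simp add: dist_norm)
    then show ?thesis using r by blast
  qed
  moreover have "d > 0" using r by (simp add: d_def add_nonneg_pos)
  ultimately show thesis using that by blast
qed

lemma eventually_in_domain: "x \<in> \<Omega> \<Longrightarrow> eventually (\<lambda>t. x + t *\<^sub>R e \<in> \<Omega>) (at 0)"
proof -
  assume "x \<in> \<Omega>"
  then obtain d where "d > 0" "\<And>t. \<bar>t\<bar> < d \<Longrightarrow> x + t *\<^sub>R e \<in> \<Omega>"
    using near_in_domain by blast
  then show ?thesis unfolding eventually_at by (intro exI[of _ d]) auto
qed

section \<open>Convexity of the solution and behaviour at the boundary\<close>

lemma has_derivative_on_segment: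
  fixes F :: "real^'n \<Rightarrow> real"
  assumes x: "x \<in> S" "x + d \<in> S" and t: "t \<in> {0..1}"
    and F: "\<And>z. z \<in> S \<Longrightarrow> (F has_derivative F' z) (at z within S)"
  shows "((\<lambda>t. F (x + t *\<^sub>R d)) has_derivative (\<lambda>h. F' (x + t *\<^sub>R d) (h *\<^sub>R d))) (at t within {0..1})"
    and "x + t *\<^sub>R d \<in> S"
proof -
  have seg: "x + s *\<^sub>R d \<in> S" if "s \<in> {0..1}" for s
  proof -
    have "(1 - s) *\<^sub>R x + s *\<^sub>R (x + d) \<in> S"
      using convex_S x that by (auto simp: convex_alt)
    then show ?thesis by (simp add: algebra_simps)
  qed
  show "x + t *\<^sub>R d \<in> S" by (rule seg[OF t])
  have sub: "(\<lambda>t. x + t *\<^sub>R d) ` {0..1} \<subseteq> S" using seg by auto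
  show "((\<lambda>t. F (x + t *\<^sub>R d)) has_derivative (\<lambda>h. F' (x + t *\<^sub>R d) (h *\<^sub>R d))) (at t within {0..1})"
  proof (rule has_derivative_in_compose[where f = "\<lambda>t. x + t *\<^sub>R d" and g = F])
    show "((\<lambda>t. x + t *\<^sub>R d) has_derivative (\<lambda>h. h *\<^sub>R d)) (at t within {0..1})"
      by (auto intro!: derivative_eq_intros)
    show "(F has_derivative F' (x + t *\<^sub>R d)) (at (x + t *\<^sub>R d) within (\<lambda>t. x + t *\<^sub>R d) ` {0..1})"
      using F[OF seg[OF t]] sub by (rule has_derivative_subset)
  qed
qed

lemma gradient_strict_mono:
  assumes "x \<in> S" "x + d \<in> S" "d \<noteq> 0"
  shows "Du x \<bullet> d < Du (x + d) \<bullet> d"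
proof -
  have der: "((\<lambda>y. Du y \<bullet> d) has_derivative (\<lambda>h. (A z *v h) \<bullet> d)) (at z within S)" if "z \<in> S" for z
    using has_derivative_inner_left[OF gradient_has_derivative[OF that]] .
  have "\<exists>t\<in>{0<..<1}. Du (x + 1 *\<^sub>R d) \<bullet> d - Du (x + 0 *\<^sub>R d) \<bullet> d = (A (x + t *\<^sub>R d) *v ((1 - 0) *\<^sub>R d)) \<bullet> d"
    using has_derivative_on_segment(1)[OF assms(1,2) _ der] by (intro mvt_simple) auto
  then obtain t where t: "t \<in> {0<..<1}" "Du (x + d) \<bullet> d - Du x \<bullet> d = (A (x + t *\<^sub>R d) *v d) \<bullet> d" by auto
  have "x + t *\<^sub>R d \<in> S" using has_derivative_on_segment(2)[OF assms(1,2) _ der, of t] t(1) by auto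
  then have "d \<bullet> (A (x + t *\<^sub>R d) *v d) > 0"
    using positive_definite_hessian assms(3) by (simp add: positive_definite_def)
  then show ?thesis using t(2) by (simp add: inner_commute)
qed

text \<open>
  The strict monotonicity of the gradient, applied at the intermediate point of the mean value
  theorem.
\<close>

lemma u_above_tangent:
  assumes "x \<in> S" "y \<in> S" "x \<noteq> y"
  shows "u x + Du x \<bullet> (y - x) < u y"
proof -
  define d where "d = y - x"
  have d: "x + d \<in> S" "d \<noteq> 0" using assms by (auto simp: d_def)
  have "\<exists>t\<in>{0<..<1}. u (x + 1 *\<^sub>R d) - u (x + 0 *\<^sub>R d) = Du (x + t *\<^sub>R d) \<bullet> ((1 - 0) *\<^sub>R d)"
    using has_derivative_on_segment(1)[OF assms(1) d(1) _ u_has_derivative] by (intro mvt_simple) auto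
  then obtain t where t: "t \<in> {0<..<1}" "u (x + d) - u x = Du (x + t *\<^sub>R d) \<bullet> d" by auto
  have "x + t *\<^sub>R d \<in> S" using has_derivative_on_segment(2)[OF assms(1) d(1) _ u_has_derivative, of t] t(1) by auto
  then have "Du x \<bullet> (t *\<^sub>R d) < Du (x + t *\<^sub>R d) \<bullet> (t *\<^sub>R d)"
    using t(1) d by (intro gradient_strict_mono assms(1)) auto
  then have "Du x \<bullet> d < Du (x + t *\<^sub>R d) \<bullet> d" using t(1) by simp
  then show ?thesis using t(2) by (simp add: d_def)
qed

lemma gradient_nonzero: "x \<in> S \<Longrightarrow> y \<in> S \<Longrightarrow> u y < u x \<Longrightarrow> Du x \<noteq> 0"
  using u_above_tangent[of x y] by force

lemma boundary_nonempty: "frontier \<Omega> \<noteq> {}"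
  using bounded_domain nonempty frontier_eq_empty[of \<Omega>] not_bounded_UNIV[where 'a="real^'n"] by auto

lemma u_negative:
  assumes x: "x \<in> \<Omega>"
  shows "u x < 0"
proof -
  have "S \<noteq> {}" using nonempty by auto
  then obtain m where m: "m \<in> S" "\<And>y. y \<in> S \<Longrightarrow> u y \<le> u m"
    using continuous_attains_sup[OF compact_S _ continuous_on_u] by blast
  have no_max: False if z: "z \<in> \<Omega>" "\<And>y. y \<in> S \<Longrightarrow> u y \<le> u z" for z
  proof -
    have der: "(u has_derivative (\<lambda>h. Du z \<bullet> h)) (at z)"
      using u_has_derivative[OF domain_subset[OF z(1)]] at_within_domain[OF z(1)] by simp
    have "(\<lambda>h. Du z \<bullet> h) = (\<lambda>h. 0)"
      using z domain_subset by (intro differential_zero_maxmin[OF z(1) open_domain der]) auto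
    then have "Du z \<bullet> (y - z) = 0" for y by metis
    moreover obtain y where "y \<in> frontier \<Omega>" using boundary_nonempty by blast
    then have "y \<in> S" "y \<noteq> z" using z(1) by (auto simp: frontier_eq)
    ultimately show False
      using u_above_tangent[OF domain_subset[OF z(1)], of y] z(2)[of y] by force
  qed
  have "m \<in> frontier \<Omega>" using no_max m by (auto simp: frontier_eq)
  then have "u m = 0" using boundary_value by blast
  then show ?thesis using no_max[OF x] m(2) domain_subset[OF x] by (metis order.trans order_le_less)
qed

lemma u_nonpos: "x \<in> S \<Longrightarrow> u x \<le> 0"
  using u_negative[of x] boundary_value frontier_eq by (cases "x \<in> \<Omega>") auto

lemma u_eq_0_iff: "x \<in> S \<Longrightarrow> u x = 0 \<longleftrightarrow> x \<in> frontier \<Omega>"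
  using u_negative[of x] boundary_value frontier_eq by (cases "x \<in> \<Omega>") auto

lemma boundary_gradient_nonzero:
  assumes "x \<in> frontier \<Omega>"
  shows "Du x \<noteq> 0"
proof -
  obtain y where y: "y \<in> \<Omega>" using nonempty by blast
  have "x \<in> S" "u x = 0" using assms boundary_value by (auto simp: frontier_eq)
  then show ?thesis
    using gradient_nonzero[of x y] u_negative[OF y] domain_subset[OF y] by simp
qed

text \<open>
  Near \<open>x\<close> the domain is \<open>{\<rho> < 0}\<close>, so every direction in which \<open>\<rho>\<close> decreases points inward. As \<open>u\<close>
  vanishes on the boundary and is negative inside, it cannot increase in these directions; hence
  \<open>Du(x)\<close> is a positive multiple of the gradient of \<open>\<rho>\<close>.
\<close>

lemma boundary_inward:
  assumes x: "x \<in> frontier \<Omega>" and v: "Du x \<bullet> v < 0"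
  shows "\<exists>d>0. \<forall>t. 0 < t \<and> t < d \<longrightarrow> x + t *\<^sub>R v \<in> \<Omega>"
proof -
  obtain U \<rho> where U: "open U" "x \<in> U" "smooth_within U \<rho>" "\<forall>x\<in>U. gradient U \<rho> x \<noteq> 0"
      "\<Omega> \<inter> U = {x\<in>U. \<rho> x < 0}" "frontier \<Omega> \<inter> U = {x\<in>U. \<rho> x = 0}"
    using bspec[OF boundary[unfolded smooth_boundary_def] x] by (elim exE conjE) (rule that)
  define g where "g = gradient U \<rho> x"
  have g: "g \<noteq> 0" using U by (simp add: g_def)
  have rho0: "\<rho> x = 0" using U(2,6) x by blast
  have "\<rho> differentiable (at x within U)"
    using U(2,3) unfolding smooth_within_def by (metis iter_pderiv_within.simps(1))
  then have der: "(\<rho> has_derivative (\<lambda>h. g \<bullet> h)) (at x)"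
    using gradient_derivative[of \<rho> x U] at_within_open[OF U(2,1)] by (simp add: g_def)
  have inward: "\<exists>d>0. \<forall>t. 0 < t \<and> t < d \<longrightarrow> x + t *\<^sub>R v \<in> \<Omega>" if v: "g \<bullet> v < 0" for v
  proof -
    have "((\<lambda>t. \<rho> (x + t *\<^sub>R v)) has_derivative (\<lambda>h. g \<bullet> (h *\<^sub>R v))) (at 0)"
      by (rule has_derivative_compose[where f = "\<lambda>t. x + t *\<^sub>R v" and g = \<rho>])
         (use der in \<open>auto intro!: derivative_eq_intros\<close>)
    then have "((\<lambda>t. \<rho> (x + t *\<^sub>R v)) has_real_derivative g \<bullet> v) (at 0)"
      by (simp add: has_field_derivative_def mult_commute_abs)
    from DERIV_neg_dec_right[OF this v] obtain d1 where
      d1: "d1 > 0" "\<And>t. 0 < t \<Longrightarrow> t < d1 \<Longrightarrow> \<rho> (x + t *\<^sub>R v) < 0"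
      using rho0 by auto
    obtain r where r: "r > 0" "ball x r \<subseteq> U" using U(1,2) open_contains_ball by blast
    define d where "d = min d1 (r / (norm v + 1))"
    have "x + t *\<^sub>R v \<in> \<Omega>" if t: "0 < t" "t < d" for t
    proof -
      have "t * norm v \<le> t * (norm v + 1)" using t by (intro mult_left_mono) auto
      also have "\<dots> < r" using t by (simp add: d_def field_simps add_pos_nonneg)
      finally have "x + t *\<^sub>R v \<in> U" using r t by (auto simp: subset_iff dist_norm)
      then show ?thesis using d1(2)[of t] t U(5) by (auto simp: d_def)
    qed
    moreover have "d > 0" using d1 r by (simp add: d_def add_nonneg_pos)
    ultimately show ?thesis by blast
  qed
  have "Du x \<bullet> v \<le> 0" if gv: "g \<bullet> v < 0" for v
  proof -
    obtain d where d: "d > 0" "\<forall>t. 0 < t \<and> t < d \<longrightarrow> x + t *\<^sub>R v \<in> \<Omega>" using inward[OF gv] by blast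
    then have z: "x + (d/2) *\<^sub>R v \<in> \<Omega>" by auto
    have "x \<in> S" "u x = 0" "x + (d/2) *\<^sub>R v \<noteq> x" using x boundary_value z by (auto simp: frontier_eq)
    then have "Du x \<bullet> ((d/2) *\<^sub>R v) < 0"
      using u_above_tangent[of x "x + (d/2) *\<^sub>R v"] domain_subset[OF z] u_negative[OF z] by force
    then show ?thesis using d(1) by (simp add: mult_less_0_iff)
  qed
  from halfspace_subset_imp_parallel[OF g this] obtain c where c: "c \<ge> 0" "Du x = c *\<^sub>R g" by blast
  have "c \<noteq> 0" using boundary_gradient_nonzero[OF x] c by auto
  then have "g \<bullet> v < 0" using v c by (auto simp: mult_less_0_iff)
  then show ?thesis by (rule inward)
qed

lemma descent_direction:
  assumes x: "x \<in> S" and v: "Du x \<bullet> v < 0"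
  shows "\<exists>d>0. \<forall>t. 0 < t \<and> t < d \<longrightarrow> x + t *\<^sub>R v \<in> \<Omega> \<and> u (x + t *\<^sub>R v) < u x"
proof -
  have "\<exists>d>0. \<forall>t. 0 < t \<and> t < d \<longrightarrow> x + t *\<^sub>R v \<in> \<Omega>"
  proof (cases "x \<in> \<Omega>")
    case True
    then obtain d where "d > 0" "\<And>t. \<bar>t\<bar> < d \<Longrightarrow> x + t *\<^sub>R v \<in> \<Omega>" using near_in_domain by blast
    then show ?thesis by (intro exI[of _ d]) auto
  next
    case False
    then show ?thesis using boundary_inward[OF _ v] x by (simp add: frontier_eq)
  qed
  then obtain d where d: "d > 0" "\<And>t. 0 < t \<Longrightarrow> t < d \<Longrightarrow> x + t *\<^sub>R v \<in> \<Omega>" by blast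
  have cont: "continuous (at x within S) (\<lambda>y. Du y \<bullet> v)"
    using continuous_on_gradient x by (auto simp: continuous_on_eq_continuous_within intro!: continuous_intros)
  then have "eventually (\<lambda>y. Du y \<bullet> v < 0) (at x within S)"
    unfolding continuous_within using v by (rule order_tendstoD)
  then obtain r where r: "r > 0" "\<And>y. y \<in> S \<Longrightarrow> y \<noteq> x \<Longrightarrow> dist y x < r \<Longrightarrow> Du y \<bullet> v < 0"
    unfolding eventually_at by blast
  define \<delta> where "\<delta> = min d (r / (norm v + 1))"
  have v0: "v \<noteq> 0" using v by auto
  have "x + t *\<^sub>R v \<in> \<Omega> \<and> u (x + t *\<^sub>R v) < u x" if t: "0 < t" "t < \<delta>" for t
  proof -
    have z: "x + t *\<^sub>R v \<in> \<Omega>" using d t by (simp add: \<delta>_def)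
    have "t * norm v \<le> t * (norm v + 1)" using t by (intro mult_left_mono) auto
    also have "\<dots> < r" using t by (simp add: \<delta>_def field_simps add_pos_nonneg)
    finally have "Du (x + t *\<^sub>R v) \<bullet> v < 0"
      using r(2)[OF domain_subset[OF z]] t v0 by (simp add: dist_norm)
    moreover have "u (x + t *\<^sub>R v) + Du (x + t *\<^sub>R v) \<bullet> (- t *\<^sub>R v) < u x"
      using u_above_tangent[OF domain_subset[OF z] x] t v0 by simp
    ultimately show ?thesis using z t by (simp add: mult_pos_neg) (smt (verit) mult_pos_neg)
  qed
  moreover have "\<delta> > 0" using d r by (simp add: \<delta>_def add_nonneg_pos)
  ultimately show ?thesis by blast
qed

section \<open>The linearized equation and the function for the Gauss curvature\<close>

lemma normal_frame:
  assumes "x \<in> S"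
  obtains B :: "real^'n^'n" where "transpose B ** A x ** B = mat 1" "B ** transpose B ** A x = mat 1"
  using positive_definite_normal_form[OF positive_definite_hessian[OF assms]] by blast

text \<open>
  After normalization by \<open>B\<close> the matrices \<open>A(x + tv)\<close> have determinant \<open>1\<close>, so their trace is at
  least \<open>n\<close> with equality at \<open>t = 0\<close>. The derivative of the trace vanishes at this minimum.
\<close>

lemma first_variation_of_det:
  assumes x: "x \<in> \<Omega>" and C: "C ** A x = mat 1"
  shows "trace (C ** dA v x) = 0"
proof -
  obtain B :: "real^'n^'n" where B: "transpose B ** A x ** B = mat 1" "B ** transpose B ** A x = mat 1"
    using normal_frame[OF domain_subset[OF x]] .
  have CB: "C = B ** transpose B" using left_inverse_unique[OF C B(2)] .
  have detB: "det B * det B = 1"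
    using arg_cong[OF B(1), of det] det_eq x by (simp add: det_mul)
  let ?g = "\<lambda>t. trace (C ** A (x + t *\<^sub>R v))"
  have g: "?g t = trace (transpose B ** A (x + t *\<^sub>R v) ** B)" for t
    unfolding CB trace_frame trace_eq_sum_inner_columns ..
  have ge: "?g t \<ge> CARD('n)" if "x + t *\<^sub>R v \<in> \<Omega>" for t
    unfolding g
  proof (rule positive_definite_trace_ge)
    show "positive_definite (transpose B ** A (x + t *\<^sub>R v) ** B)"
      using detB positive_definite_hessian[OF domain_subset[OF that]] by (intro positive_definite_congruence) auto
    show "det (transpose B ** A (x + t *\<^sub>R v) ** B) = 1"
      using detB det_eq that by (simp add: det_mul)
  qed
  have "((\<lambda>t. (C ** A (x + t *\<^sub>R v)) $ i $ j) has_real_derivative (C ** dA v x) $ i $ j) (at 0)" for i j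
    unfolding matrix_matrix_mult_def vec_lambda_beta
    using hessian_on_line[of x 0 v] x by (intro DERIV_sum DERIV_cmult) simp
  then have der: "(?g has_real_derivative trace (C ** dA v x)) (at 0)"
    by (rule DERIV_trace)
  obtain d where d: "d > 0" "\<And>t. \<bar>t\<bar> < d \<Longrightarrow> x + t *\<^sub>R v \<in> \<Omega>"
    using near_in_domain[OF x] by blast
  have "?g 0 = CARD('n)" using C by (simp add: trace_I)
  then have "\<forall>t. \<bar>0 - t\<bar> < d \<longrightarrow> ?g 0 \<le> ?g t" using ge d(2) by simp
  with DERIV_local_min[OF der d(1)] show ?thesis by blast
qed

text \<open>
  The identity \<open>tr (A\<inverse> \<partial>\<^sub>vA) = 0\<close> of \<open>first_variation_of_det\<close> holds along the whole line and can be
  differentiated once more. Column \<open>l\<close> of \<open>A\<inverse> \<partial>\<^sub>vA\<close> solves a linear system with matrix \<open>A\<close>, whose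
  solution is differentiated by \<open>DERIV_linear_system_solution\<close>.
\<close>

lemma second_variation_of_det:
  fixes B :: "real^'n^'n"
  assumes x: "x \<in> \<Omega>" and B: "transpose B ** A x ** B = mat 1" "B ** transpose B ** A x = mat 1"
  shows "(\<Sum>a\<in>UNIV. column a B \<bullet> (ddA v x *v column a B)) = (\<Sum>a\<in>UNIV. \<Sum>b\<in>UNIV. (column a B \<bullet> (dA v x *v column b B))\<^sup>2)"
proof -
  define C where "C = B ** transpose B"
  have C: "C ** A x = mat 1" using B(2) by (simp add: C_def)
  have inv: "matrix_inv (A y) ** A y = mat 1" "A y ** matrix_inv (A y) = mat 1" if "y \<in> \<Omega>" for y
  proof -
    have "invertible (A y)" using det_eq that by (simp add: invertible_det_nz)
    then show "matrix_inv (A y) ** A y = mat 1" "A y ** matrix_inv (A y) = mat 1"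
      using someI_ex[of "\<lambda>C. A y ** C = mat 1 \<and> C ** A y = mat 1"]
      by (auto simp: matrix_inv_def invertible_def)
  qed
  have Cinv: "matrix_inv (A x) = C" using left_inverse_unique[OF inv(1)[OF x] C] .
  define w where "w l t = matrix_inv (A (x + t *\<^sub>R v)) *v column l (dA v (x + t *\<^sub>R v))" for l t
  have w0: "w l 0 = C *v column l (dA v x)" for l by (simp add: w_def Cinv)
  have wd: "((\<lambda>t. w l t $ l) has_real_derivative (C *v (column l (ddA v x) - dA v x *v w l 0)) $ l) (at 0)" for l
  proof (rule DERIV_linear_system_solution)
    show "eventually (\<lambda>t. A (x + t *\<^sub>R v) *v w l t = column l (dA v (x + t *\<^sub>R v))) (at 0)"
      using eventually_in_domain[OF x, of v] by eventually_elim (simp add: w_def matrix_vector_mul_assoc inv)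
    show "A (x + 0 *\<^sub>R v) *v w l 0 = column l (dA v (x + 0 *\<^sub>R v))"
      using x by (simp add: w_def matrix_vector_mul_assoc inv)
    show "C ** A (x + 0 *\<^sub>R v) = mat 1" using C by simp
    show "((\<lambda>t. A (x + t *\<^sub>R v) $ i $ j) has_real_derivative dA v x $ i $ j) (at 0)" for i j
      using hessian_on_line[of x 0 v] x by simp
    show "((\<lambda>t. column l (dA v (x + t *\<^sub>R v)) $ i) has_real_derivative column l (ddA v x) $ i) (at 0)" for i
      using dA_on_line[of x 0 v i l] x by (simp add: column_def)
  qed
  have "((\<lambda>t. \<Sum>l\<in>UNIV. w l t $ l) has_real_derivative (\<Sum>l\<in>UNIV. (C *v (column l (ddA v x) - dA v x *v w l 0)) $ l)) (at 0)"
    by (intro DERIV_sum wd)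
  moreover have "((\<lambda>t. \<Sum>l\<in>UNIV. w l t $ l) has_real_derivative 0) (at 0)"
  proof (rule DERIV_cong_ev[THEN iffD2])
    have "(\<Sum>l\<in>UNIV. w l t $ l) = 0" if "x + t *\<^sub>R v \<in> \<Omega>" for t
    proof -
      have "(\<Sum>l\<in>UNIV. w l t $ l) = trace (matrix_inv (A (x + t *\<^sub>R v)) ** dA v (x + t *\<^sub>R v))"
        unfolding trace_def w_def column_matrix_mult[symmetric] by (simp add: column_def)
      then show ?thesis using first_variation_of_det[OF that inv(1)[OF that]] by simp
    qed
    note zero = this
    obtain d where d: "d > 0" "\<And>t. \<bar>t\<bar> < d \<Longrightarrow> x + t *\<^sub>R v \<in> \<Omega>"
      using near_in_domain[OF x] by blast
    show "eventually (\<lambda>t. (\<Sum>l\<in>UNIV. w l t $ l) = 0) (nhds 0)"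
      unfolding eventually_nhds_metric using d zero by (intro exI[of _ d]) simp
  qed auto
  ultimately have "(\<Sum>l\<in>UNIV. (C *v (column l (ddA v x) - dA v x *v w l 0)) $ l) = 0"
    by (rule DERIV_unique)
  moreover have "(C *v (column l (ddA v x) - dA v x *v w l 0)) $ l = (C ** ddA v x) $ l $ l - (C ** dA v x ** C ** dA v x) $ l $ l" for l
  proof -
    have "C *v (column l (ddA v x) - dA v x *v w l 0) = column l (C ** ddA v x) - column l (C ** (dA v x ** (C ** dA v x)))"
      by (simp only: column_matrix_mult w0 matrix_vector_mult_diff_distrib)
    then show ?thesis by (simp add: column_def matrix_mul_assoc)
  qed
  ultimately have "trace (C ** ddA v x) = trace (C ** dA v x ** C ** dA v x)"
    by (simp add: trace_def sum_subtractf)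
  moreover have "trace (C ** ddA v x) = (\<Sum>a\<in>UNIV. column a B \<bullet> (ddA v x *v column a B))"
    unfolding C_def by (rule trace_frame)
  moreover have "trace (C ** dA v x ** C ** dA v x) = (\<Sum>a\<in>UNIV. \<Sum>b\<in>UNIV. (column a B \<bullet> (dA v x *v column b B))\<^sup>2)"
  proof -
    have "trace (C ** dA v x ** C ** dA v x) = trace (B ** (transpose B ** dA v x ** C ** dA v x))"
      by (simp add: C_def matrix_mul_assoc)
    also have "\<dots> = trace (transpose B ** (dA v x ** C ** dA v x) ** B)"
      by (subst trace_mul_sym) (simp add: matrix_mul_assoc)
    also have "\<dots> = (\<Sum>a\<in>UNIV. column a B \<bullet> ((dA v x ** C ** dA v x) *v column a B))"
      by (rule trace_eq_sum_inner_columns)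
    also have "\<dots> = (\<Sum>a\<in>UNIV. \<Sum>b\<in>UNIV. (column b B \<bullet> (dA v x *v column a B))\<^sup>2)"
    proof (rule sum.cong)
      fix a :: 'n
      have "column a B \<bullet> ((dA v x ** C ** dA v x) *v column a B) = (dA v x *v column a B) \<bullet> (C *v (dA v x *v column a B))"
        by (simp add: matrix_vector_mul_assoc[symmetric] symmetric_matrix_inner[OF dA_transpose[OF x]])
      then show "column a B \<bullet> ((dA v x ** C ** dA v x) *v column a B) = (\<Sum>b\<in>UNIV. (column b B \<bullet> (dA v x *v column a B))\<^sup>2)"
        by (simp only: sum_square_inner_columns C_def)
    qed simp
    also have "\<dots> = (\<Sum>a\<in>UNIV. \<Sum>b\<in>UNIV. (column a B \<bullet> (dA v x *v column b B))\<^sup>2)"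
      by (rule sum.swap)
    finally show ?thesis .
  qed
  ultimately show ?thesis by simp
qed

lemma trace_dA_zero:
  fixes B :: "real^'n^'n"
  assumes x: "x \<in> \<Omega>" and B: "B ** transpose B ** A x = mat 1"
  shows "(\<Sum>a\<in>UNIV. column a B \<bullet> (dA v x *v column a B)) = 0"
  using first_variation_of_det[OF x B, of v]
  unfolding trace_frame .

lemma hessian_invertible: "x \<in> S \<Longrightarrow> invertible (A x)"
  using normal_frame[of x] by (metis invertible_left_inverse)

definition dual_gradient :: "real^'n \<Rightarrow> real^'n" where
  "dual_gradient x = matrix_inv (A x) *v Du x"

lemma hessian_dual_gradient: "x \<in> S \<Longrightarrow> A x *v dual_gradient x = Du x"
proof -
  assume "x \<in> S"
  then have "A x ** matrix_inv (A x) = mat 1"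
    using hessian_invertible[of x] someI_ex[of "\<lambda>C. A x ** C = mat 1 \<and> C ** A x = mat 1"]
    by (auto simp: matrix_inv_def invertible_def)
  then show ?thesis by (simp add: dual_gradient_def matrix_vector_mul_assoc)
qed

abbreviation w where "w \<equiv> dual_gradient"

lemma dual_gradient_on_line:
  assumes x: "x \<in> \<Omega>" and C: "C ** A x = mat 1"
  shows "((\<lambda>t. w (x + t *\<^sub>R e) $ i) has_real_derivative (e - C *v (dA e x *v w x)) $ i) (at 0)"
proof -
  have "((\<lambda>t. w (x + t *\<^sub>R e) $ i) has_real_derivative (C *v (A x *v e - dA e x *v w (x + 0 *\<^sub>R e))) $ i) (at 0)"
  proof (rule DERIV_linear_system_solution)
    show "eventually (\<lambda>t. A (x + t *\<^sub>R e) *v w (x + t *\<^sub>R e) = Du (x + t *\<^sub>R e)) (at 0)"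
      using eventually_in_domain[OF x, of e] by eventually_elim (simp add: hessian_dual_gradient domain_subset)
    show "A (x + 0 *\<^sub>R e) *v w (x + 0 *\<^sub>R e) = Du (x + 0 *\<^sub>R e)"
      using x by (simp add: hessian_dual_gradient domain_subset)
    show "C ** A (x + 0 *\<^sub>R e) = mat 1" using C by simp
    show "((\<lambda>t. A (x + t *\<^sub>R e) $ i $ j) has_real_derivative dA e x $ i $ j) (at 0)" for i j
      using hessian_on_line[of x 0 e] x by simp
    show "((\<lambda>t. Du (x + t *\<^sub>R e) $ i) has_real_derivative (A x *v e) $ i) (at 0)" for i
      using gradient_on_line[of x 0 e] x by simp
  qed
  moreover have "C *v (A x *v e) = e" using C by (simp add: matrix_vector_mul_assoc)
  ultimately show ?thesis by (simp add: matrix_vector_mult_diff_distrib)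
qed

definition \<phi> :: "real^'n \<Rightarrow> real" where "\<phi> x = Du x \<bullet> w x"

text \<open>
  Differentiating \<open>A w = Du\<close> eliminates the derivative of \<open>w\<close>, so that the first derivative of \<open>\<phi>\<close>
  contains \<open>w\<close> itself only. A second differentiation then needs no more than the first derivative of
  \<open>w\<close>.
\<close>

lemma \<phi>_on_line:
  assumes s: "x + s *\<^sub>R e \<in> \<Omega>"
  shows "((\<lambda>t. \<phi> (x + t *\<^sub>R e)) has_real_derivative
    2 * (Du (x + s *\<^sub>R e) \<bullet> e) - w (x + s *\<^sub>R e) \<bullet> (dA e (x + s *\<^sub>R e) *v w (x + s *\<^sub>R e))) (at s)"
proof -
  define y where "y = x + s *\<^sub>R e"
  have y: "y \<in> \<Omega>" using s by (simp add: y_def)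
  obtain B :: "real^'n^'n" where B: "transpose B ** A y ** B = mat 1" "B ** transpose B ** A y = mat 1"
    using normal_frame[OF domain_subset[OF y]] .
  define C where "C = B ** transpose B"
  have C: "A y ** C = mat 1" using B(2) matrix_left_right_inverse by (auto simp: C_def)
  have sym: "(A y *v v) \<bullet> z = v \<bullet> (A y *v z)" for v z
    using symmetric_matrix_inner[OF transpose_hessian[OF domain_subset[OF y]]] .
  have "((\<lambda>t. \<phi> (y + t *\<^sub>R e)) has_real_derivative
      (A y *v e) \<bullet> w (y + 0 *\<^sub>R e) + Du (y + 0 *\<^sub>R e) \<bullet> (e - C *v (dA e y *v w y))) (at 0)"
    unfolding \<phi>_def
    using gradient_on_line[of y 0 e] dual_gradient_on_line[OF y B(2)] y by (intro DERIV_inner_vec) (auto simp: C_def)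
  moreover have "(A y *v e) \<bullet> w y = Du y \<bullet> e"
    using sym[of e "w y"] by (simp only: hessian_dual_gradient[OF domain_subset[OF y]] inner_commute)
  moreover have "Du y \<bullet> (C *v (dA e y *v w y)) = w y \<bullet> (dA e y *v w y)"
    unfolding hessian_dual_gradient[OF domain_subset[OF y], symmetric]
    by (simp add: sym matrix_vector_mul_assoc matrix_mul_assoc C)
  ultimately have "((\<lambda>t. \<phi> (y + t *\<^sub>R e)) has_real_derivative
      2 * (Du y \<bullet> e) - w y \<bullet> (dA e y *v w y)) (at 0)"
    by (simp add: inner_diff_right)
  then show ?thesis by (subst DERIV_at_shift) (simp only: y_def)
qed

text \<open>
  The second derivatives of \<open>\<phi>\<close> at \<open>x\<close> along the columns \<open>e\<^sub>a\<close> of the normal frame add up to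
  \<open>L\<phi>\<close>. With \<open>w' = e\<^sub>a - A\<inverse> (\<partial>\<^sub>aA) w\<close> the sum is \<open>2n - 0 + 2 Q(w) - Q(w)\<close>, where the terms come from
  the four summands of \<open>nonpos\<close> in order; it is positive, whereas each second derivative is
  nonpositive at a maximum.
\<close>

theorem \<phi>_no_interior_max:
  assumes x: "x \<in> \<Omega>" and max: "\<And>y. y \<in> \<Omega> \<Longrightarrow> \<phi> y \<le> \<phi> x"
  shows False
proof -
  obtain B :: "real^'n^'n" where B: "transpose B ** A x ** B = mat 1" "B ** transpose B ** A x = mat 1"
    using normal_frame[OF domain_subset[OF x]] .
  define C where "C = B ** transpose B"
  define e where "e a = column a B" for a
  define V where "V = w x"
  note dsym = symmetric_matrix_inner[OF dA_transpose[OF x]]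
  have nonpos: "2 * ((A x *v e a) \<bullet> e a) - (2 * (e a \<bullet> (dA (e a) x *v V)) - 2 * ((dA (e a) x *v V) \<bullet> (C *v (dA (e a) x *v V)))
      + V \<bullet> (ddA (e a) x *v V)) \<le> 0" for a
  proof -
    obtain d where d: "d > 0" "\<And>t. \<bar>t\<bar> < d \<Longrightarrow> x + t *\<^sub>R e a \<in> \<Omega>"
      using near_in_domain[OF x] by blast
    define W' where "W' = e a - C *v (dA (e a) x *v V)"
    have w': "((\<lambda>t. w (x + t *\<^sub>R e a) $ i) has_real_derivative W' $ i) (at 0)" for i
      using dual_gradient_on_line[OF x B(2)] by (simp add: W'_def C_def V_def)
    have dA': "((\<lambda>t. dA (e a) (x + t *\<^sub>R e a) $ k $ l) has_real_derivative ddA (e a) x $ k $ l) (at 0)" for k l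
      using dA_on_line[of x 0 "e a"] x by simp
    have Du': "((\<lambda>t. Du (x + t *\<^sub>R e a) $ i) has_real_derivative (A x *v e a) $ i) (at 0)" for i
      using gradient_on_line[of x 0 "e a"] x by simp
    have e': "((\<lambda>t. e a $ i) has_real_derivative 0 $ i) (at 0)" for i by simp
    have "((\<lambda>t. 2 * (Du (x + t *\<^sub>R e a) \<bullet> e a) - w (x + t *\<^sub>R e a) \<bullet> (dA (e a) (x + t *\<^sub>R e a) *v w (x + t *\<^sub>R e a)))
       has_real_derivative 2 * ((A x *v e a) \<bullet> e a + Du (x + 0 *\<^sub>R e a) \<bullet> 0) -
        (W' \<bullet> (dA (e a) (x + 0 *\<^sub>R e a) *v w (x + 0 *\<^sub>R e a)) + w (x + 0 *\<^sub>R e a) \<bullet> (ddA (e a) x *v w (x + 0 *\<^sub>R e a) + dA (e a) (x + 0 *\<^sub>R e a) *v W'))) (at 0)"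
      by (intro DERIV_diff DERIV_cmult DERIV_inner_vec DERIV_matrix_vector w' dA' Du' e')
    then have "2 * ((A x *v e a) \<bullet> e a) - (W' \<bullet> (dA (e a) x *v V) + V \<bullet> (ddA (e a) x *v V + dA (e a) x *v W')) \<le> 0"
    proof (intro second_derivative_nonpos_at_max[OF d(1) \<phi>_on_line[OF d(2)]])
      show "\<phi> (x + t *\<^sub>R e a) \<le> \<phi> (x + 0 *\<^sub>R e a)" if "\<bar>t\<bar> < d" for t
        using max d(2)[OF that] by simp
    qed (simp_all add: V_def)
    moreover have "V \<bullet> (dA (e a) x *v W') = W' \<bullet> (dA (e a) x *v V)"
      by (metis dsym inner_commute)
    ultimately show ?thesis
      by (simp add: inner_add_right W'_def inner_diff_left inner_commute[of "C *v _"] V_def)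
  qed
  have "(\<Sum>a\<in>UNIV. (A x *v e a) \<bullet> e a) = CARD('n)"
    using arg_cong[OF B(1), of trace] unfolding trace_eq_sum_inner_columns trace_I by (simp add: e_def inner_commute)
  moreover have "(\<Sum>a\<in>UNIV. e a \<bullet> (dA (e a) x *v V)) = 0"
    using trace_dA_zero[OF x B(2), of V] by (simp add: e_def dA_commute[OF x, of _ V])
  moreover have "(\<Sum>a\<in>UNIV. (dA (e a) x *v V) \<bullet> (C *v (dA (e a) x *v V))) = (\<Sum>a\<in>UNIV. \<Sum>b\<in>UNIV. (e b \<bullet> (dA V x *v e a))\<^sup>2)"
    unfolding C_def e_def sum_square_inner_columns[symmetric] by (simp add: dA_commute[OF x, of _ V])
  moreover have "(\<Sum>a\<in>UNIV. \<Sum>b\<in>UNIV. (e b \<bullet> (dA V x *v e a))\<^sup>2) = (\<Sum>a\<in>UNIV. \<Sum>b\<in>UNIV. (e a \<bullet> (dA V x *v e b))\<^sup>2)"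
    by (rule sum.swap)
  moreover have "(\<Sum>a\<in>UNIV. V \<bullet> (ddA (e a) x *v V)) = (\<Sum>a\<in>UNIV. \<Sum>b\<in>UNIV. (e a \<bullet> (dA V x *v e b))\<^sup>2)"
    using second_variation_of_det[OF x B, of V] by (simp add: e_def ddA_commute[OF x, of V])
  moreover have "(\<Sum>a\<in>UNIV. 2 * ((A x *v e a) \<bullet> e a) - (2 * (e a \<bullet> (dA (e a) x *v V)) - 2 * ((dA (e a) x *v V) \<bullet> (C *v (dA (e a) x *v V)))
      + V \<bullet> (ddA (e a) x *v V))) \<le> 0"
    by (intro sum_nonpos nonpos)
  moreover have "(\<Sum>a\<in>UNIV. \<Sum>b\<in>UNIV. (e a \<bullet> (dA V x *v e b))\<^sup>2) \<ge> 0"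
    by (intro sum_nonneg) auto
  moreover have "real CARD('n) \<ge> 2" using dim by simp
  ultimately show False
    by (simp add: sum_subtractf sum.distrib sum_distrib_left[symmetric])
qed

section \<open>The function for the mean curvature\<close>

definition \<psi> :: "real^'n \<Rightarrow> real" where
  "\<psi> x = trace (A x) * (Du x \<bullet> Du x) - Du x \<bullet> (A x *v Du x)"

text \<open>
  What differentiating \<open>\<psi>\<close> once, and in \<open>dd\<psi>\<close> twice, along a line in direction \<open>e\<close> produces, with
  the symmetry of \<open>A\<close> and \<open>\<partial>\<^sub>eA\<close> used to collect equal terms.
\<close>

definition d\<psi> :: "real^'n \<Rightarrow> real^'n \<Rightarrow> real" where
  "d\<psi> e x = trace (dA e x) * (Du x \<bullet> Du x) + 2 * trace (A x) * (Du x \<bullet> (A x *v e))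
     - (2 * ((A x *v e) \<bullet> (A x *v Du x)) + Du x \<bullet> (dA e x *v Du x))"

definition dd\<psi> :: "real^'n \<Rightarrow> real^'n \<Rightarrow> real" where
  "dd\<psi> e x = trace (ddA e x) * (Du x \<bullet> Du x) + 4 * trace (dA e x) * (Du x \<bullet> (A x *v e))
     + 2 * trace (A x) * ((A x *v e) \<bullet> (A x *v e) + Du x \<bullet> (dA e x *v e))
     - (2 * ((dA e x *v e) \<bullet> (A x *v Du x)) + 2 * ((A x *v e) \<bullet> (A x *v (A x *v e)))
        + 4 * ((A x *v e) \<bullet> (dA e x *v Du x)) + Du x \<bullet> (ddA e x *v Du x))"

lemma \<psi>_on_line:
  assumes s: "x + s *\<^sub>R e \<in> \<Omega>"
  shows "((\<lambda>t. \<psi> (x + t *\<^sub>R e)) has_real_derivative d\<psi> e (x + s *\<^sub>R e)) (at s)"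
proof -
  define y where "y = x + s *\<^sub>R e"
  have y: "y \<in> \<Omega>" using s by (simp add: y_def)
  note sym = symmetric_matrix_inner[OF transpose_hessian[OF domain_subset[OF y]]]
  have "((\<lambda>t. \<psi> (x + t *\<^sub>R e)) has_real_derivative
     trace (dA e y) * (Du y \<bullet> Du y) + ((A y *v e) \<bullet> Du y + Du y \<bullet> (A y *v e)) * trace (A y)
     - ((A y *v e) \<bullet> (A y *v Du y) + Du y \<bullet> (dA e y *v Du y + A y *v (A y *v e)))) (at s)"
    unfolding \<psi>_def y_def
    by (intro DERIV_diff DERIV_mult DERIV_trace DERIV_inner_vec DERIV_matrix_vector
        hessian_on_line gradient_on_line s)
  moreover have "Du y \<bullet> (A y *v (A y *v e)) = (A y *v e) \<bullet> (A y *v Du y)"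
    using sym[of "Du y" "A y *v e"] inner_commute[of "A y *v Du y" "A y *v e"] by linarith
  ultimately show ?thesis
    unfolding d\<psi>_def y_def[symmetric]
    by (simp add: inner_add_right inner_commute[of "A y *v e" "Du y"] algebra_simps)
qed

lemma d\<psi>_on_line:
  assumes y: "y \<in> \<Omega>"
  shows "((\<lambda>t. d\<psi> e (y + t *\<^sub>R e)) has_real_derivative dd\<psi> e y) (at 0)"
proof -
  note sym = symmetric_matrix_inner[OF transpose_hessian[OF domain_subset[OF y]]]
  note dsym = symmetric_matrix_inner[OF dA_transpose[OF y, of e]]
  have y0: "y + 0 *\<^sub>R e \<in> \<Omega>" using y by simp
  have e': "((\<lambda>t. e $ i) has_real_derivative 0 $ i) (at 0)" for i by simp
  let ?A = "A (y + 0 *\<^sub>R e)" and ?D = "Du (y + 0 *\<^sub>R e)" and ?d = "dA e (y + 0 *\<^sub>R e)" and ?dd = "ddA e (y + 0 *\<^sub>R e)"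
  have "((\<lambda>t. d\<psi> e (y + t *\<^sub>R e)) has_real_derivative
     (trace ?dd * (?D \<bullet> ?D) + ((?A *v e) \<bullet> ?D + ?D \<bullet> (?A *v e)) * trace ?d)
     + ((2 * trace ?d) * (?D \<bullet> (?A *v e)) + ((?A *v e) \<bullet> (?A *v e) + ?D \<bullet> (?d *v e + ?A *v 0)) * (2 * trace ?A))
     - (2 * ((?d *v e + ?A *v 0) \<bullet> (?A *v ?D) + (?A *v e) \<bullet> (?d *v ?D + ?A *v (?A *v e)))
        + ((?A *v e) \<bullet> (?d *v ?D) + ?D \<bullet> (?dd *v ?D + ?d *v (?A *v e))))) (at 0)"
    unfolding d\<psi>_def
    by (intro DERIV_diff DERIV_add DERIV_mult DERIV_cmult DERIV_trace DERIV_inner_vec DERIV_matrix_vector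
        hessian_on_line gradient_on_line dA_on_line e' y0)
  moreover have "Du y \<bullet> (dA e y *v (A y *v e)) = (A y *v e) \<bullet> (dA e y *v Du y)"
    using dsym[of "Du y" "A y *v e"] inner_commute[of "dA e y *v Du y" "A y *v e"] by linarith
  ultimately show ?thesis
    unfolding dd\<psi>_def by (simp add: inner_add_right inner_commute[of "A y *v e" "Du y"] algebra_simps)
qed

text \<open>
  As for \<open>\<phi>\<close>, the second derivatives along a normal frame are summed. The mixed terms with third
  derivatives either vanish by the first variation of the determinant or cancel, because both
  \<open>t2\<close> and \<open>t6\<close> equal the derivative of \<open>tr A\<close> in direction \<open>p\<close>.
\<close>

theorem \<psi>_no_interior_max:
  assumes x: "x \<in> \<Omega>" and max: "\<And>y. y \<in> \<Omega> \<Longrightarrow> \<psi> y \<le> \<psi> x"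
  shows False
proof -
  obtain B :: "real^'n^'n" where B: "transpose B ** A x ** B = mat 1" "B ** transpose B ** A x = mat 1"
    using normal_frame[OF domain_subset[OF x]] .
  define e where "e a = column a B" for a
  define p where "p = Du x"
  define M where "M = A x"
  define Q where "Q v = (\<Sum>a\<in>UNIV. \<Sum>b\<in>UNIV. (e a \<bullet> (dA v x *v e b))\<^sup>2)" for v
  note sym = symmetric_matrix_inner[OF transpose_hessian[OF domain_subset[OF x]], folded M_def]
  note dsym = symmetric_matrix_inner[OF dA_transpose[OF x]]
  have nonpos: "dd\<psi> (e a) x \<le> 0" for a
  proof -
    obtain d where d: "d > 0" "\<And>t. \<bar>t\<bar> < d \<Longrightarrow> x + t *\<^sub>R e a \<in> \<Omega>"
      using near_in_domain[OF x] by blast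
    show ?thesis
    proof (rule second_derivative_nonpos_at_max[OF d(1) \<psi>_on_line[OF d(2)] d\<psi>_on_line[OF x]])
      show "\<psi> (x + t *\<^sub>R e a) \<le> \<psi> (x + 0 *\<^sub>R e a)" if "\<bar>t\<bar> < d" for t
        using max d(2)[OF that] by simp
    qed
  qed
  have expand: "(\<Sum>a\<in>UNIV. (e a \<bullet> (M *v y)) *\<^sub>R e a) = y" for y
    using sum_columns_expand[OF B(2)] by (simp only: e_def M_def)
  have lin: "(\<Sum>a\<in>UNIV. (e a \<bullet> (M *v y)) * (e a \<bullet> z)) = y \<bullet> z" for y z
    using arg_cong[OF expand[of y], of "\<lambda>v. v \<bullet> z"] by (simp add: inner_sum_left)
  have Q: "(\<Sum>a\<in>UNIV. v \<bullet> (ddA (e a) x *v v)) = Q v" for v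
    using second_variation_of_det[OF x B, of v] by (simp add: Q_def e_def ddA_commute[OF x, of v])
  have tr: "trace N = (\<Sum>k\<in>UNIV. axis k 1 \<bullet> (N *v axis k 1))" for N :: "real^'n^'n"
    by (simp add: trace_def inner_axis' matrix_vector_mult_basis column_def)
  have t1: "(\<Sum>a\<in>UNIV. trace (ddA (e a) x)) = (\<Sum>k\<in>UNIV. Q (axis k 1))"
    unfolding tr by (subst sum.swap) (simp only: Q)
  have t2: "(\<Sum>a\<in>UNIV. trace (dA (e a) x) * (p \<bullet> (M *v e a))) = trace (dA p x)"
  proof -
    define Z where "Z = (\<Sum>k\<in>UNIV. dA (axis k 1) x *v axis k 1)"
    have trZ: "trace (dA v x) = v \<bullet> Z" for v
    proof -
      have "axis k 1 \<bullet> (dA v x *v axis k 1) = v \<bullet> (dA (axis k 1) x *v axis k 1)" for k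
        by (metis dA_commute[OF x] dsym inner_commute)
      then show ?thesis unfolding tr Z_def inner_sum_right by (intro sum.cong refl)
    qed
    have "p \<bullet> (M *v e a) = e a \<bullet> (M *v p)" for a
      using sym[of p "e a"] inner_commute[of "M *v p" "e a"] by linarith
    then have "(\<Sum>a\<in>UNIV. trace (dA (e a) x) * (p \<bullet> (M *v e a))) = (\<Sum>a\<in>UNIV. (e a \<bullet> (M *v p)) * (e a \<bullet> Z))"
      unfolding trZ by (intro sum.cong refl) (simp only: mult.commute)
    then show ?thesis unfolding lin trZ .
  qed
  have t3: "(\<Sum>a\<in>UNIV. (M *v e a) \<bullet> (M *v e a)) = trace M"
  proof -
    have "(\<Sum>a\<in>UNIV. (M *v e a) \<bullet> (M *v e a)) = (\<Sum>a\<in>UNIV. e a \<bullet> ((M ** M) *v e a))"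
      by (simp add: sym matrix_vector_mul_assoc)
    also have "\<dots> = trace M"
      unfolding e_def trace_frame[symmetric] by (simp add: matrix_mul_assoc B(2)[folded M_def])
    finally show ?thesis .
  qed
  have t4: "(\<Sum>a\<in>UNIV. v \<bullet> (dA (e a) x *v e a)) = 0" for v
  proof -
    have "v \<bullet> (dA (e a) x *v e a) = e a \<bullet> (dA v x *v e a)" for a
      by (metis dA_commute[OF x] dsym inner_commute)
    then show ?thesis using trace_dA_zero[OF x B(2), of v] by (simp add: e_def)
  qed
  have t5: "(\<Sum>a\<in>UNIV. (M *v e a) \<bullet> (M *v (M *v e a))) = trace (M ** M)"
  proof -
    have "(\<Sum>a\<in>UNIV. (M *v e a) \<bullet> (M *v (M *v e a))) = (\<Sum>a\<in>UNIV. e a \<bullet> ((M ** (M ** M)) *v e a))"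
      by (simp add: sym matrix_vector_mul_assoc matrix_mul_assoc)
    also have "\<dots> = trace (M ** M)"
      unfolding e_def trace_frame[symmetric] by (simp add: matrix_mul_assoc B(2)[folded M_def])
    finally show ?thesis .
  qed
  have t6: "(\<Sum>a\<in>UNIV. (M *v e a) \<bullet> (dA (e a) x *v p)) = trace (dA p x)"
  proof -
    have "(\<Sum>a\<in>UNIV. (M *v e a) \<bullet> (dA (e a) x *v p)) = (\<Sum>a\<in>UNIV. e a \<bullet> ((M ** dA p x) *v e a))"
      by (simp add: sym matrix_vector_mul_assoc[symmetric] dA_commute[OF x, of _ p])
    also have "\<dots> = trace (dA p x)"
      unfolding e_def trace_frame[symmetric] by (simp add: matrix_mul_assoc B(2)[folded M_def])
    finally show ?thesis .
  qed
  have Qle: "Q p \<le> (p \<bullet> p) * (\<Sum>k\<in>UNIV. Q (axis k 1))"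
  proof -
    have "(e a \<bullet> (dA p x *v e b))\<^sup>2 \<le> (p \<bullet> p) * (\<Sum>k\<in>UNIV. (e a \<bullet> (dA (axis k 1) x *v e b))\<^sup>2)" for a b
    proof -
      define c where "c = (\<chi> k. e a \<bullet> (dA (axis k 1) x *v e b))"
      have "e a \<bullet> (dA p x *v e b) = p \<bullet> c"
      proof -
        have "dA p x *v e b = (\<Sum>k\<in>UNIV. (p $ k) *\<^sub>R (dA (axis k 1) x *v e b))"
          unfolding dA_commute[OF x, of _ "e b"]
          by (simp only: matrix_mult_sum[of "dA (e b) x" p] scalar_mult_eq_scaleR matrix_vector_mult_basis)
        then show ?thesis
          by (simp only: inner_sum_right inner_scaleR_right inner_vec_def[of p] c_def vec_lambda_beta inner_real_def)
      qed
      moreover have "c \<bullet> c = (\<Sum>k\<in>UNIV. (e a \<bullet> (dA (axis k 1) x *v e b))\<^sup>2)"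
        by (simp add: inner_vec_def c_def power2_eq_square)
      ultimately show ?thesis
        using Cauchy_Schwarz_ineq[of p c] by (simp only:)
    qed
    then have "Q p \<le> (\<Sum>a\<in>UNIV. \<Sum>b\<in>UNIV. (p \<bullet> p) * (\<Sum>k\<in>UNIV. (e a \<bullet> (dA (axis k 1) x *v e b))\<^sup>2))"
      unfolding Q_def by (intro sum_mono)
    also have "\<dots> = (p \<bullet> p) * (\<Sum>a\<in>UNIV. \<Sum>b\<in>UNIV. \<Sum>k\<in>UNIV. (e a \<bullet> (dA (axis k 1) x *v e b))\<^sup>2)"
      by (simp only: sum_distrib_left)
    also have "(\<Sum>a\<in>UNIV. \<Sum>b\<in>UNIV. \<Sum>k\<in>UNIV. (e a \<bullet> (dA (axis k 1) x *v e b))\<^sup>2) = (\<Sum>a\<in>UNIV. \<Sum>k\<in>UNIV. \<Sum>b\<in>UNIV. (e a \<bullet> (dA (axis k 1) x *v e b))\<^sup>2)"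
      by (intro sum.cong refl sum.swap)
    also have "\<dots> = (\<Sum>k\<in>UNIV. Q (axis k 1))"
      unfolding Q_def by (rule sum.swap)
    finally show ?thesis .
  qed
  have "(\<Sum>a\<in>UNIV. dd\<psi> (e a) x) = (\<Sum>k\<in>UNIV. Q (axis k 1)) * (p \<bullet> p) + 4 * trace (dA p x)
      + 2 * trace M * (trace M + 0) - (2 * 0 + 2 * trace (M ** M) + 4 * trace (dA p x) + Q p)"
  proof -
    have "(\<Sum>a\<in>UNIV. dd\<psi> (e a) x) = (\<Sum>a\<in>UNIV. trace (ddA (e a) x)) * (p \<bullet> p)
      + 4 * (\<Sum>a\<in>UNIV. trace (dA (e a) x) * (p \<bullet> (M *v e a)))
      + 2 * trace M * ((\<Sum>a\<in>UNIV. (M *v e a) \<bullet> (M *v e a)) + (\<Sum>a\<in>UNIV. p \<bullet> (dA (e a) x *v e a)))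
      - (2 * (\<Sum>a\<in>UNIV. (M *v p) \<bullet> (dA (e a) x *v e a)) + 2 * (\<Sum>a\<in>UNIV. (M *v e a) \<bullet> (M *v (M *v e a)))
        + 4 * (\<Sum>a\<in>UNIV. (M *v e a) \<bullet> (dA (e a) x *v p)) + (\<Sum>a\<in>UNIV. p \<bullet> (ddA (e a) x *v p)))"
      unfolding dd\<psi>_def M_def[symmetric] p_def[symmetric]
      by (simp add: sum.distrib sum_subtractf sum_distrib_left sum_distrib_right mult.assoc inner_commute[of _ "M *v p"] distrib_left)
    then show ?thesis by (simp only: t1 t2 t3 t4 t5 t6 Q)
  qed
  moreover have "(\<Sum>a\<in>UNIV. dd\<psi> (e a) x) \<le> 0" by (intro sum_nonpos nonpos)
  moreover have "trace (M ** M) < (trace M)\<^sup>2"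
    unfolding M_def using dim by (intro positive_definite_trace_square positive_definite_hessian domain_subset x) 
  ultimately show False using Qle by (simp add: power2_eq_square mult.commute)
qed

section \<open>Level sets, support points and the shape operator\<close>

definition sublevel :: "real \<Rightarrow> (real^'n) set" where "sublevel c = {x \<in> S. u x \<le> c}"
definition level :: "real \<Rightarrow> (real^'n) set" where "level c = {x \<in> S. u x = c}"
definition \<nu> :: "real^'n \<Rightarrow> real^'n" where "\<nu> x = sgn (Du x)"

lemma compact_sublevel: "compact (sublevel c)"
proof -
  have "closedin (top_of_set S) {x \<in> S. u x \<le> c}"
    using continuous_closedin_preimage[OF continuous_on_u, of "{..c}"] by (simp add: vimage_def Collect_conj_eq)
  then show ?thesis
    unfolding sublevel_def using compact_S closedin_compact by blast
qed

lemma compact_level: "compact (level c)"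
proof -
  have "closedin (top_of_set S) {x \<in> S. u x = c}"
    using continuous_closedin_preimage[OF continuous_on_u, of "{c}"] by (simp add: vimage_def Collect_conj_eq)
  then show ?thesis
    unfolding level_def using compact_S closedin_compact by blast
qed

lemma convex_sublevel: "convex (sublevel c)"
  unfolding convex_def
proof (intro ballI allI impI)
  fix x y and a b :: real
  assume x: "x \<in> sublevel c" and y: "y \<in> sublevel c" and ab: "0 \<le> a" "0 \<le> b" "a + b = 1"
  define z where "z = a *\<^sub>R x + b *\<^sub>R y"
  have z: "z \<in> S" using convex_S x y ab by (auto simp: z_def sublevel_def convex_def)
  have tangent: "u z + Du z \<bullet> (p - z) \<le> u p" if "p \<in> S" for p
    using u_above_tangent[OF z that] by (cases "p = z") auto
  have "a * (u z + Du z \<bullet> (x - z)) + b * (u z + Du z \<bullet> (y - z)) \<le> a * c + b * c"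
    using tangent[of x] tangent[of y] x y ab by (intro add_mono mult_left_mono) (auto simp: sublevel_def)
  moreover have "a * (u z + Du z \<bullet> (x - z)) + b * (u z + Du z \<bullet> (y - z))
      = (a + b) * u z + Du z \<bullet> (a *\<^sub>R (x - z) + b *\<^sub>R (y - z))"
    by (simp add: inner_add_right algebra_simps)
  moreover have "a *\<^sub>R (x - z) + b *\<^sub>R (y - z) = z - (a + b) *\<^sub>R z"
    by (simp add: z_def algebra_simps)
  moreover have "a * c + b * c = c" using ab(3) by (simp add: distrib_right[symmetric])
  ultimately have "u z \<le> c" using ab(3) by simp
  then show "a *\<^sub>R x + b *\<^sub>R y \<in> sublevel c" using z by (simp add: sublevel_def z_def)
qed

lemma level_point_is_support_point:
  assumes y: "y \<in> level c" and l: "l > 0" "Du y = l *\<^sub>R \<theta>" and z: "z \<in> sublevel c" "z \<noteq> y"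
  shows "\<theta> \<bullet> z < \<theta> \<bullet> y"
proof -
  have "u y + Du y \<bullet> (z - y) < u z"
    using y z by (intro u_above_tangent) (auto simp: level_def sublevel_def)
  then have "l * (\<theta> \<bullet> (z - y)) < 0" using y z l by (simp add: level_def sublevel_def)
  then show ?thesis using l by (simp add: mult_less_0_iff inner_diff_right)
qed

text \<open>
  At the point of the sublevel set farthest in direction \<open>\<theta>\<close> every descent direction of \<open>u\<close> is a
  direction in which \<open>\<theta>\<close> does not increase, so \<open>\<theta>\<close> and \<open>Du\<close> are parallel. For \<open>c = 0\<close> the point lies on
  \<open>\<partial>\<Omega>\<close>, so the level sets inside \<open>\<Omega>\<close> and the boundary are treated alike.
\<close>

lemma support_point_exists:
  assumes c: "c \<le> 0" and z0: "z0 \<in> S" "u z0 < c" and th: "\<theta> \<noteq> 0"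
  shows "\<exists>y\<in>level c. \<exists>l>0. Du y = l *\<^sub>R \<theta>"
proof -
  have "sublevel c \<noteq> {}" using z0 by (auto simp: sublevel_def)
  then have "\<exists>y\<in>sublevel c. \<forall>z\<in>sublevel c. \<theta> \<bullet> z \<le> \<theta> \<bullet> y"
    by (intro continuous_attains_sup compact_sublevel continuous_intros)
  then obtain y where y: "y \<in> sublevel c" and ymax: "\<And>z. z \<in> sublevel c \<Longrightarrow> \<theta> \<bullet> z \<le> \<theta> \<bullet> y"
    by blast
  have yS: "y \<in> S" using y by (simp add: sublevel_def)
  have dir: "\<theta> \<bullet> v \<le> 0" if v: "Du y \<bullet> v < 0" for v
  proof -
    obtain d where d: "d > 0" "\<forall>t. 0 < t \<and> t < d \<longrightarrow> y + t *\<^sub>R v \<in> \<Omega> \<and> u (y + t *\<^sub>R v) < u y"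
      using descent_direction[OF yS v] by blast
    then have "y + (d/2) *\<^sub>R v \<in> \<Omega>" "u (y + (d/2) *\<^sub>R v) < u y"
      by auto
    then have "y + (d/2) *\<^sub>R v \<in> sublevel c"
      using y domain_subset[of "y + (d/2) *\<^sub>R v"] by (simp add: sublevel_def)
    from ymax[OF this] show ?thesis using d(1) by (simp add: inner_add_right mult_le_0_iff)
  qed
  have uy: "u y = c"
  proof (rule ccontr)
    assume "u y \<noteq> c"
    then have lt: "u y < c" using y by (simp add: sublevel_def)
    then have "y \<in> \<Omega>" using yS c boundary_value by (cases "y \<in> \<Omega>") (auto simp: frontier_eq)
    then obtain d where d: "d > 0" "\<And>t. \<bar>t\<bar> < d \<Longrightarrow> y + t *\<^sub>R \<theta> \<in> \<Omega>"
      by (rule near_in_domain[of y \<theta>]) blast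
    have "((\<lambda>t. u (y + t *\<^sub>R \<theta>)) \<longlongrightarrow> u (y + 0 *\<^sub>R \<theta>)) (at 0)"
      using DERIV_isCont[OF D_has_derivative_on_line[of y 0 \<theta> "[]"]] \<open>y \<in> \<Omega>\<close> by (simp add: isCont_def)
    then have "eventually (\<lambda>t. u (y + t *\<^sub>R \<theta>) < c) (at 0)"
      using lt by (intro order_tendstoD(2)) auto
    then obtain r where r: "r > 0" "\<And>t. t \<noteq> 0 \<Longrightarrow> \<bar>t\<bar> < r \<Longrightarrow> u (y + t *\<^sub>R \<theta>) < c"
      unfolding eventually_at by (auto simp: dist_norm)
    define t where "t = min d r / 2"
    have t: "t > 0" "t < d" "t < r" using d r by (auto simp: t_def)
    then have "y + t *\<^sub>R \<theta> \<in> sublevel c"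
      using d(2)[of t] r(2)[of t] domain_subset by (auto simp: sublevel_def)
    from ymax[OF this] have "t * (\<theta> \<bullet> \<theta>) \<le> 0" by (simp add: inner_add_right)
    moreover have "t * (\<theta> \<bullet> \<theta>) > 0" using t th by (intro mult_pos_pos) auto
    ultimately show False by linarith
  qed
  have "Du y \<noteq> 0" using gradient_nonzero[OF yS z0(1)] z0(2) uy by simp
  from halfspace_subset_imp_parallel[OF this dir] obtain k where k: "k \<ge> 0" "\<theta> = k *\<^sub>R Du y" by blast
  then have "k > 0" using th by (cases "k = 0") auto
  then have "Du y = (1 / k) *\<^sub>R \<theta>" "1 / k > 0" using k by auto
  moreover have "y \<in> level c" using yS uy by (simp add: level_def)
  ultimately show ?thesis by blast
qed

definition support_point :: "real \<Rightarrow> real^'n \<Rightarrow> real^'n" where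
  "support_point c \<theta> = (SOME y. y \<in> level c \<and> (\<exists>l>0. Du y = l *\<^sub>R \<theta>))"

lemma support_point_properties:
  assumes "c \<le> 0" "z0 \<in> S" "u z0 < c" "\<theta> \<noteq> 0"
  shows "support_point c \<theta> \<in> level c" "\<exists>l>0. Du (support_point c \<theta>) = l *\<^sub>R \<theta>"
  using someI_ex[of "\<lambda>y. y \<in> level c \<and> (\<exists>l>0. Du y = l *\<^sub>R \<theta>)"] support_point_exists[OF assms]
  unfolding support_point_def by blast+

lemma level_subset_sublevel: "level c \<subseteq> sublevel c"
  by (auto simp: level_def sublevel_def)

lemma support_point_unique:
  assumes "c \<le> 0" "z0 \<in> S" "u z0 < c" "\<theta> \<noteq> 0" and y: "y \<in> level c" "l > 0" "Du y = l *\<^sub>R \<theta>"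
  shows "support_point c \<theta> = y"
proof (rule ccontr)
  assume ne: "support_point c \<theta> \<noteq> y"
  obtain k where k: "k > 0" "Du (support_point c \<theta>) = k *\<^sub>R \<theta>" using support_point_properties(2)[OF assms(1-4)] by blast
  show False
    using level_point_is_support_point[OF support_point_properties(1)[OF assms(1-4)] k, of y]
      level_point_is_support_point[OF y, of "support_point c \<theta>"] ne y support_point_properties(1)[OF assms(1-4)] level_subset_sublevel by force
qed

lemma support_point_maximizes:
  assumes "c \<le> 0" "z0 \<in> S" "u z0 < c" "\<theta> \<noteq> 0" "z \<in> sublevel c"
  shows "\<theta> \<bullet> z \<le> \<theta> \<bullet> support_point c \<theta>"
proof (cases "z = support_point c \<theta>")
  case False
  obtain k where k: "k > 0" "Du (support_point c \<theta>) = k *\<^sub>R \<theta>" using support_point_properties(2)[OF assms(1-4)] by blast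
  show ?thesis
    using level_point_is_support_point[OF support_point_properties(1)[OF assms(1-4)] k assms(5) False] by simp
qed simp

text \<open>
  The graph is cut out by the closed conditions \<open>\<theta> \<bullet> z \<le> \<theta> \<bullet> y\<close>, and the range is compact.
\<close>

lemma continuous_on_support_point:
  assumes c: "c \<le> 0" "z0 \<in> S" "u z0 < c"
  shows "continuous_on (- {0}) (support_point c)"
proof -
  have X: "support_point c \<in> (- {0}) \<rightarrow> sublevel c"
    using support_point_properties(1)[OF c] level_subset_sublevel by fastforce
  have graph: "(\<lambda>\<theta>. (\<theta>, support_point c \<theta>)) ` (- {0}) =
      ((- {0}) \<times> sublevel c) \<inter> (\<Inter>z\<in>sublevel c. {p. fst p \<bullet> z \<le> fst p \<bullet> snd p})"
  proof (intro equalityI subsetI)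
    fix p assume "p \<in> (\<lambda>\<theta>. (\<theta>, support_point c \<theta>)) ` (- {0})"
    then show "p \<in> ((- {0}) \<times> sublevel c) \<inter> (\<Inter>z\<in>sublevel c. {p. fst p \<bullet> z \<le> fst p \<bullet> snd p})"
      using X support_point_maximizes[OF c] by auto
  next
    fix p assume p: "p \<in> ((- {0}) \<times> sublevel c) \<inter> (\<Inter>z\<in>sublevel c. {p. fst p \<bullet> z \<le> fst p \<bullet> snd p})"
    obtain \<theta> y where py: "p = (\<theta>, y)" by (cases p)
    have th: "\<theta> \<noteq> 0" and y: "y \<in> sublevel c" and max: "\<And>z. z \<in> sublevel c \<Longrightarrow> \<theta> \<bullet> z \<le> \<theta> \<bullet> y"
      using p by (auto simp: py)
    obtain k where k: "k > 0" "Du (support_point c \<theta>) = k *\<^sub>R \<theta>" using support_point_properties(2)[OF c th] by blast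
    have XL: "support_point c \<theta> \<in> level c" by (rule support_point_properties(1)[OF c th])
    have "y = support_point c \<theta>"
      using level_point_is_support_point[OF XL k y] max[of "support_point c \<theta>"] XL level_subset_sublevel by force
    then show "p \<in> (\<lambda>\<theta>. (\<theta>, support_point c \<theta>)) ` (- {0})" using th py by blast
  qed
  have "closed (\<Inter>z\<in>sublevel c. {p :: (real^'n) \<times> (real^'n). fst p \<bullet> z \<le> fst p \<bullet> snd p})"
    by (intro closed_INT ballI closed_Collect_le continuous_intros)
  then have "closedin (top_of_set ((- {0}) \<times> sublevel c)) ((\<lambda>\<theta>. (\<theta>, support_point c \<theta>)) ` (- {0}))"
    unfolding graph by (rule closedin_closed_Int)
  then show ?thesis
    using continuous_closed_graph_eq[OF compact_sublevel X] by blast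
qed

text \<open>
  The derivative of the unit normal \<open>\<nu> = Du/|Du|\<close>.
\<close>

definition shape :: "real^'n \<Rightarrow> real^'n \<Rightarrow> real^'n" where
  "shape x h = (A x *v h - (\<nu> x \<bullet> (A x *v h)) *\<^sub>R \<nu> x) /\<^sub>R norm (Du x)"

lemma norm_\<nu>: "Du x \<noteq> 0 \<Longrightarrow> norm (\<nu> x) = 1" by (simp add: \<nu>_def norm_sgn)

lemma gradient_eq_\<nu>: "Du x = norm (Du x) *\<^sub>R \<nu> x"
  by (cases "Du x = 0") (simp_all add: \<nu>_def sgn_div_norm)

lemma \<nu>_has_derivative:
  assumes x: "x \<in> S" and nz: "Du x \<noteq> 0"
  shows "(\<nu> has_derivative shape x) (at x within S)"
proof -
  define N where "N = norm (Du x)"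
  have N: "N \<noteq> 0" using nz by (simp add: N_def)
  have "((\<lambda>y. norm (Du y)) has_derivative (\<lambda>h. sgn (Du x) \<bullet> (A x *v h))) (at x within S)"
    using has_derivative_compose[OF gradient_has_derivative[OF x] has_derivative_norm[OF nz]]
    by (simp only: inner_commute)
  from has_derivative_scaleR[OF Deriv.has_derivative_inverse[OF _ this] gradient_has_derivative[OF x]] nz
  have der: "((\<lambda>y. inverse (norm (Du y)) *\<^sub>R Du y) has_derivative
      (\<lambda>h. inverse N *\<^sub>R (A x *v h) + (- (inverse N * (\<nu> x \<bullet> (A x *v h)) * inverse N)) *\<^sub>R Du x)) (at x within S)"
    by (simp add: N_def \<nu>_def)
  have "inverse N *\<^sub>R a + (- (inverse N * b * inverse N)) *\<^sub>R Du x = (a - b *\<^sub>R \<nu> x) /\<^sub>R N" for a b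
  proof -
    have p: "Du x = N *\<^sub>R \<nu> x" using gradient_eq_\<nu>[of x] by (simp only: N_def)
    have "inverse N * b * inverse N * N = inverse N * b" using N by simp
    then show ?thesis by (subst p) (simp add: scaleR_diff_right)
  qed
  with der show ?thesis
    by (simp add: \<nu>_def[abs_def] sgn_div_norm shape_def[abs_def] N_def)
qed

text \<open>
  At boundary points the derivative within \<open>S\<close> has to be known to be unique.
\<close>

lemma weingarten_eq_shape:
  assumes x: "x \<in> S" and nz: "Du x \<noteq> 0"
  shows "weingarten S u x = shape x"
proof -
  have "((\<lambda>y. sgn (Du y)) has_derivative shape x) (at x within S)"
    using \<nu>_has_derivative[OF assms] by (simp add: \<nu>_def[abs_def])
  moreover from this have "((\<lambda>y. sgn (Du y)) has_derivative weingarten S u x) (at x within S)"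
    unfolding weingarten_def frechet_derivative_works[symmetric] by (auto simp: differentiable_def)
  ultimately show ?thesis
    using derivative_within_convex_unique[OF convex_S _ x] nonempty interior_S by metis
qed

abbreviation tangent :: "real^'n \<Rightarrow> (real^'n) set" where "tangent x \<equiv> {v. v \<bullet> Du x = 0}"

lemma linear_shape: "linear (shape x)"
  by (rule linearI)
    (simp_all add: shape_def matrix_vector_right_distrib inner_add_right algebra_simps matrix_vector_mult_scaleR)

lemma shape_inner_tangent:
  assumes "z \<in> tangent x"
  shows "shape x v \<bullet> z = ((A x *v v) \<bullet> z) / norm (Du x)"
proof -
  have "\<nu> x \<bullet> z = 0" using assms by (simp add: \<nu>_def sgn_div_norm inner_commute)
  then show ?thesis by (simp add: shape_def inner_diff_left divide_inverse mult.commute)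
qed

lemma shape_tangent: "Du x \<noteq> 0 \<Longrightarrow> shape x v \<in> tangent x"
proof -
  assume nz: "Du x \<noteq> 0"
  have "shape x v \<bullet> \<nu> x = 0"
  proof -
    have "\<nu> x \<bullet> \<nu> x = 1" using norm_\<nu>[OF nz] by (simp add: dot_square_norm)
    then show ?thesis by (simp add: shape_def inner_diff_left inner_commute[of "A x *v v"])
  qed
  then have "shape x v \<bullet> (norm (Du x) *\<^sub>R \<nu> x) = 0" by simp
  then show ?thesis by (simp only: gradient_eq_\<nu>[symmetric] mem_Collect_eq)
qed

lemma tangent_subspace: "subspace (tangent x)"
  by (auto simp: subspace_def inner_add_left)

text \<open>
  Here \<open>n \<ge> 2\<close> enters: otherwise level sets would have no principal curvatures.
\<close>

lemma tangent_nontrivial: "tangent x \<noteq> {0}"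
proof
  assume *: "tangent x = {0}"
  have "tangent x = {v. Du x \<bullet> v = 0}" by (simp add: inner_commute)
  then have "dim (tangent x) \<ge> CARD('n) - 1"
    using dim_hyperplane[of "Du x"] by (cases "Du x = 0") auto
  then show False using * dim by simp
qed

lemma shape_selfadjoint:
  assumes "x \<in> S" "v \<in> tangent x" "z \<in> tangent x"
  shows "shape x v \<bullet> z = v \<bullet> shape x z"
  using shape_inner_tangent[OF assms(3), of v] shape_inner_tangent[OF assms(2), of z]
    symmetric_matrix_inner[OF transpose_hessian[OF assms(1)], of v z] by (simp add: inner_commute)

lemma principal_curvatures_eq:
  assumes "x \<in> S" "Du x \<noteq> 0"
  shows "principal_curvatures S u x = {c. \<exists>v. v \<noteq> 0 \<and> v \<in> tangent x \<and> shape x v = c *\<^sub>R v}"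
  by (simp add: principal_curvatures_def weingarten_eq_shape[OF assms])

lemma principal_curvature_rayleigh:
  assumes x: "x \<in> S" "Du x \<noteq> 0" and k: "k \<in> principal_curvatures S u x"
  obtains v where "norm v = 1" "v \<in> tangent x" "k = (v \<bullet> (A x *v v)) / norm (Du x)"
proof -
  obtain v where v: "v \<noteq> 0" "v \<in> tangent x" "shape x v = k *\<^sub>R v"
    using k principal_curvatures_eq[OF x] by blast
  have s: "sgn v \<in> tangent x" using v by (simp add: sgn_div_norm)
  have "shape x (sgn v) = k *\<^sub>R sgn v"
    using v(3) by (simp add: sgn_div_norm linear_scale[OF linear_shape])
  then have "k * (sgn v \<bullet> sgn v) = (A x *v sgn v) \<bullet> sgn v / norm (Du x)"
    using shape_inner_tangent[OF s, of "sgn v"] by simp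
  moreover have "norm (sgn v) = 1" using v(1) by (simp add: norm_sgn)
  ultimately show thesis using s by (intro that[of "sgn v"]) (simp_all add: dot_square_norm inner_commute)
qed

lemma principal_curvature_pos:
  assumes x: "x \<in> S" "Du x \<noteq> 0" and k: "k \<in> principal_curvatures S u x"
  shows "k > 0"
proof -
  obtain v where v: "norm v = 1" "v \<in> tangent x" "k = (v \<bullet> (A x *v v)) / norm (Du x)"
    using principal_curvature_rayleigh[OF assms] .
  have "v \<noteq> 0" using v(1) by auto
  then show ?thesis using v(3) x positive_definite_hessian[OF x(1)] by (simp add: positive_definite_def)
qed

lemma finite_principal_curvatures:
  assumes x: "x \<in> S" "Du x \<noteq> 0"
  shows "finite (principal_curvatures S u x)" "principal_curvatures S u x \<noteq> {}"
  unfolding principal_curvatures_eq[OF x]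
  using selfadjoint_finite_spectrum[OF linear_shape tangent_subspace shape_tangent[OF x(2)] shape_selfadjoint[OF x(1)]]
    selfadjoint_spectrum_nonempty[OF linear_shape tangent_subspace shape_tangent[OF x(2)] shape_selfadjoint[OF x(1)] tangent_nontrivial]
  by blast+

lemma shape_norm_le:
  assumes x: "x \<in> S" "Du x \<noteq> 0" and M: "max_curvature S u x \<le> M" and v: "v \<in> tangent x"
  shows "shape x v \<bullet> shape x v \<le> M * (v \<bullet> shape x v)"
proof (rule selfadjoint_norm_le[OF linear_shape tangent_subspace shape_tangent[OF x(2)] shape_selfadjoint[OF x(1)] v])
  fix k assume "k \<in> {c. \<exists>v. v \<noteq> 0 \<and> v \<in> tangent x \<and> shape x v = c *\<^sub>R v}"
  then have k: "k \<in> principal_curvatures S u x" by (simp only: principal_curvatures_eq[OF x])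
  have "k \<le> max_curvature S u x"
    unfolding max_curvature_def using finite_principal_curvatures[OF x] k by (intro Max_ge)
  then show "0 \<le> k \<and> k \<le> M" using principal_curvature_pos[OF x k] M by simp
qed

lemma shape_norm_ge:
  assumes x: "x \<in> S" "Du x \<noteq> 0" and m: "m \<le> min_curvature S u x" and v: "v \<in> tangent x"
  shows "m * (v \<bullet> shape x v) \<le> shape x v \<bullet> shape x v"
proof (rule selfadjoint_norm_ge[OF linear_shape tangent_subspace shape_tangent[OF x(2)] shape_selfadjoint[OF x(1)] v])
  fix k assume "k \<in> {c. \<exists>v. v \<noteq> 0 \<and> v \<in> tangent x \<and> shape x v = c *\<^sub>R v}"
  then have k: "k \<in> principal_curvatures S u x" by (simp only: principal_curvatures_eq[OF x])
  have "min_curvature S u x \<le> k"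
    unfolding min_curvature_def using finite_principal_curvatures[OF x] k by (intro Min_le)
  then show "0 \<le> k \<and> m \<le> k" using principal_curvature_pos[OF x k] m by simp
qed

lemma shape_positive:
  assumes x: "x \<in> S" "Du x \<noteq> 0" and v: "v \<in> tangent x" "v \<noteq> 0"
  shows "v \<bullet> shape x v > 0"
  using shape_inner_tangent[OF v(1), of v] x positive_definite_hessian[OF x(1)] v(2)
  by (simp add: positive_definite_def inner_commute[of v "shape x v"] inner_commute[of "A x *v v" v])

section \<open>Rolling balls\<close>

text \<open>
  The mean value theorem for the remainder, whose gradient is \<open>Du(z) - Du(x) - A(x)(z - x)\<close>. It is
  applied within the convex set \<open>S\<close>, so that \<open>x\<close> may be a boundary point.
\<close>

lemma second_order_taylor:
  assumes x: "x \<in> S"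
  shows "((\<lambda>y. (u y - u x - Du x \<bullet> (y - x) - (y - x) \<bullet> (A x *v (y - x)) / 2) / (norm (y - x))\<^sup>2) \<longlongrightarrow> 0) (at x within S)"
proof (rule tendstoI)
  fix e :: real assume e: "e > 0"
  obtain d where d: "d > 0" "\<And>y. y \<in> S \<Longrightarrow> norm (y - x) < d \<Longrightarrow> norm (Du y - Du x - A x *v (y - x)) \<le> e / 2 * norm (y - x)"
    using gradient_has_derivative[OF x] e unfolding has_derivative_within_alt by (meson half_gt_zero)
  note sym = symmetric_matrix_inner[OF transpose_hessian[OF x]]
  define F where "F z = u z - Du x \<bullet> z - (z - x) \<bullet> (A x *v (z - x)) / 2" for z
  have F: "(F has_derivative (\<lambda>k. (Du z - Du x - A x *v (z - x)) \<bullet> k)) (at z within S)" if z: "z \<in> S" for z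
  proof -
    have 1: "((\<lambda>z. A x *v (z - x)) has_derivative (\<lambda>k. A x *v k)) (at z within S)"
      by (rule bounded_linear.has_derivative[OF matrix_vector_mul_bounded_linear]) (auto intro!: derivative_eq_intros)
    have 2: "((\<lambda>z. z - x) has_derivative (\<lambda>k. k)) (at z within S)" by (auto intro!: derivative_eq_intros)
    have 3: "((\<lambda>z. Du x \<bullet> z) has_derivative (\<lambda>k. Du x \<bullet> k)) (at z within S)"
      by (intro has_derivative_inner_right has_derivative_ident)
    have "(F has_derivative (\<lambda>k. Du z \<bullet> k - Du x \<bullet> k - ((z - x) \<bullet> (A x *v k) + k \<bullet> (A x *v (z - x))) / 2)) (at z within S)"
      unfolding F_def
      using has_derivative_diff[OF has_derivative_diff[OF u_has_derivative[OF z] 3]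
          has_derivative_mult_right[OF has_derivative_inner[OF 2 1], of "1/2"]] by simp
    moreover have "Du z \<bullet> k - Du x \<bullet> k - ((z - x) \<bullet> (A x *v k) + k \<bullet> (A x *v (z - x))) / 2 = (Du z - Du x - A x *v (z - x)) \<bullet> k" for k
    proof -
      have "(Du z - Du x - A x *v (z - x)) \<bullet> k = Du z \<bullet> k - Du x \<bullet> k - (A x *v (z - x)) \<bullet> k"
        by (simp only: inner_diff_left)
      moreover have "k \<bullet> (A x *v (z - x)) = (z - x) \<bullet> (A x *v k)"
        using sym[of "z - x" k] by (simp only: inner_commute)
      moreover have "(c + c) / 2 = c" for c :: real by simp
      ultimately show ?thesis by (simp only: sym[of "z - x" k])
    qed
    ultimately show ?thesis by simp
  qed
  have "\<bar>u y - u x - Du x \<bullet> (y - x) - (y - x) \<bullet> (A x *v (y - x)) / 2\<bar> \<le> e / 2 * (norm (y - x))\<^sup>2"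
    if y: "y \<in> S" "norm (y - x) < d" for y
  proof -
    define h where "h = y - x"
    have h: "x + h \<in> S" using y by (simp add: h_def)
    have "\<exists>t\<in>{0<..<1}. F (x + 1 *\<^sub>R h) - F (x + 0 *\<^sub>R h) =
        (Du (x + t *\<^sub>R h) - Du x - A x *v ((x + t *\<^sub>R h) - x)) \<bullet> ((1 - 0) *\<^sub>R h)"
      using has_derivative_on_segment(1)[OF x h _ F] by (intro mvt_simple) auto
    then obtain t where t: "t \<in> {0<..<1}" "F (x + h) - F x = (Du (x + t *\<^sub>R h) - Du x - A x *v ((x + t *\<^sub>R h) - x)) \<bullet> h"
      by auto
    have tS: "x + t *\<^sub>R h \<in> S" using has_derivative_on_segment(2)[OF x h _ F, of t] t(1) by auto
    have th: "t * norm h \<le> norm h" using t(1) by (simp add: mult_left_le_one_le)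
    have "\<bar>F (x + h) - F x\<bar> \<le> norm (Du (x + t *\<^sub>R h) - Du x - A x *v ((x + t *\<^sub>R h) - x)) * norm h"
      unfolding t(2) by (rule Cauchy_Schwarz_ineq2)
    also have "\<dots> \<le> (e / 2 * norm ((x + t *\<^sub>R h) - x)) * norm h"
      using d(2)[OF tS] y(2) th t(1) by (intro mult_right_mono) (auto simp: h_def)
    also have "\<dots> \<le> (e / 2 * norm h) * norm h"
      using th t(1) e by (intro mult_right_mono mult_left_mono) auto
    finally show ?thesis
      by (simp add: F_def h_def power2_eq_square inner_diff_right algebra_simps)
  qed
  note bound = this
  show "eventually (\<lambda>y. dist ((u y - u x - Du x \<bullet> (y - x) - (y - x) \<bullet> (A x *v (y - x)) / 2) / (norm (y - x))\<^sup>2) 0 < e) (at x within S)"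
    unfolding eventually_at
  proof (intro exI[of _ d] conjI ballI impI)
    fix y assume y: "y \<in> S" "y \<noteq> x \<and> dist y x < d"
    then have n: "(norm (y - x))\<^sup>2 > 0" by simp
    have "e / 2 * (norm (y - x))\<^sup>2 < e * (norm (y - x))\<^sup>2" using n e by simp
    moreover have "\<bar>u y - u x - Du x \<bullet> (y - x) - (y - x) \<bullet> (A x *v (y - x)) / 2\<bar> \<le> e / 2 * (norm (y - x))\<^sup>2"
      using y by (intro bound) (auto simp: dist_norm)
    ultimately have "\<bar>u y - u x - Du x \<bullet> (y - x) - (y - x) \<bullet> (A x *v (y - x)) / 2\<bar> < e * (norm (y - x))\<^sup>2"
      by (simp only: le_less_trans)
    then show "dist ((u y - u x - Du x \<bullet> (y - x) - (y - x) \<bullet> (A x *v (y - x)) / 2) / (norm (y - x))\<^sup>2) 0 < e"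
      using n by (simp add: abs_divide pos_divide_less_eq)
  qed (rule d(1))
qed

text \<open>
  To second order \<open>-\<nu>(x) \<bullet> (y - x)\<close> and \<open>\<nu>(y) \<bullet> (y - x)\<close> both equal half of the second fundamental
  form at \<open>y - x\<close>, while \<open>\<nu>(y) - \<nu>(x)\<close> is the shape operator at \<open>y - x\<close> to first order. If an inequality
  failed arbitrarily close to \<open>x\<close>, the directions \<open>(y - x) / |y - x|\<close> would subconverge to a tangent
  vector \<open>l\<close> violating the hypothesis. The sign \<open>\<sigma>\<close> is \<open>1\<close> for balls inside and \<open>-1\<close> for balls
  outside.
\<close>

lemma local_rolling:
  assumes x: "x \<in> S" "Du x \<noteq> 0"
    and pos: "\<And>v. v \<in> tangent x \<Longrightarrow> v \<noteq> 0 \<Longrightarrow> \<sigma> * (v \<bullet> shape x v - \<rho> * (shape x v \<bullet> shape x v)) > 0"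
  shows "\<exists>\<delta>>0. \<forall>y\<in>level (u x). norm (y - x) < \<delta> \<longrightarrow>
    0 \<le> \<sigma> * (- (\<nu> x \<bullet> (y - x)) - \<rho> / 2 * (norm (\<nu> y - \<nu> x))\<^sup>2) \<and>
    0 \<le> \<sigma> * (\<nu> y \<bullet> (y - x) - \<rho> / 2 * (norm (\<nu> y - \<nu> x))\<^sup>2)"
proof (rule ccontr)
  define P where "P y = \<sigma> * (- (\<nu> x \<bullet> (y - x)) - \<rho> / 2 * (norm (\<nu> y - \<nu> x))\<^sup>2)" for y
  define Q where "Q y = \<sigma> * (\<nu> y \<bullet> (y - x) - \<rho> / 2 * (norm (\<nu> y - \<nu> x))\<^sup>2)" for y
  assume "\<not> ?thesis"
  then have "\<forall>n. \<exists>y. y \<in> level (u x) \<and> norm (y - x) < inverse (real (Suc n)) \<and> (P y < 0 \<or> Q y < 0)"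
    unfolding P_def Q_def by (metis inverse_positive_iff_positive not_le of_nat_0_less_iff zero_less_Suc)
  then obtain Y where Y: "\<And>n. Y n \<in> level (u x)" "\<And>n. norm (Y n - x) < inverse (real (Suc n))" "\<And>n. P (Y n) < 0 \<or> Q (Y n) < 0"
    by metis
  have ne: "Y n \<noteq> x" for n using Y(3)[of n] by (auto simp: P_def Q_def)
  define e where "e n = (Y n - x) /\<^sub>R norm (Y n - x)" for n
  have "e n \<in> sphere 0 1" for n using ne[of n] by (simp add: e_def)
  then obtain l r where l: "l \<in> sphere 0 1" and r: "strict_mono r" and el: "(e \<circ> r) \<longlonglongrightarrow> l"
    using compact_sphere[of "0::real^'n" 1] unfolding compact_def by metis
  define Z where "Z n = Y (r n)" for n
  define s where "s n = norm (Z n - x)" for n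
  have s: "s n > 0" for n using ne by (simp add: s_def Z_def)
  have dZ: "Z n - x = s n *\<^sub>R e (r n)" for n using s[of n] by (simp add: e_def s_def Z_def)
  have Z: "Z n \<in> S" "u (Z n) = u x" "Z n \<noteq> x" for n using Y(1)[of "r n"] ne by (auto simp: level_def Z_def)
  have "Y \<longlonglongrightarrow> x"
  proof (rule LIMSEQ_I)
    fix a :: real assume "a > 0"
    then obtain N where N: "inverse (real (Suc N)) < a" using reals_Archimedean by blast
    have "norm (Y n - x) < a" if "n \<ge> N" for n
    proof -
      have "inverse (real (Suc n)) \<le> inverse (real (Suc N))" using that by (intro le_imp_inverse_le) auto
      then show ?thesis using Y(2)[of n] N by linarith
    qed
    then show "\<exists>no. \<forall>n\<ge>no. norm (Y n - x) < a" by blast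
  qed
  then have "Z \<longlonglongrightarrow> x" using LIMSEQ_subseq_LIMSEQ[OF _ r] by (simp add: Z_def[abs_def] o_def)
  then have Zlim: "filterlim Z (at x within S) sequentially"
    using Z by (simp add: filterlim_at)
  have el': "(\<lambda>n. e (r n)) \<longlonglongrightarrow> l" using el by (simp add: o_def)
  have t1: "(\<lambda>n. Du x \<bullet> e (r n)) \<longlonglongrightarrow> 0"
  proof -
    have "((\<lambda>y. (1 / norm (y - x)) *\<^sub>R (u y - (u x + Du x \<bullet> (y - x)))) \<longlongrightarrow> 0) (at x within S)"
      using u_has_derivative[OF x(1)] by (simp add: has_derivative_within)
    from filterlim_compose[OF this Zlim] have "(\<lambda>n. - ((1 / s n) * (Du x \<bullet> (Z n - x)))) \<longlonglongrightarrow> 0"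
      by (simp add: Z s_def)
    from tendsto_minus[OF this] have "(\<lambda>n. (1 / s n) * (Du x \<bullet> (Z n - x))) \<longlonglongrightarrow> 0"
      by simp
    moreover have "(1 / s n) * (Du x \<bullet> (Z n - x)) = Du x \<bullet> e (r n)" for n using s[of n] by (simp add: dZ)
    ultimately show ?thesis by simp
  qed
  have "(\<lambda>n. Du x \<bullet> e (r n)) \<longlonglongrightarrow> Du x \<bullet> l" by (intro tendsto_intros el')
  from LIMSEQ_unique[OF this t1] have lT: "l \<in> tangent x" by (simp add: inner_commute)
  have l0: "l \<noteq> 0" using l by auto
  have t2: "(\<lambda>n. (1 / s n) *\<^sub>R (\<nu> (Z n) - \<nu> x)) \<longlonglongrightarrow> shape x l"
  proof -
    have "((\<lambda>y. (1 / norm (y - x)) *\<^sub>R (\<nu> y - (\<nu> x + shape x (y - x)))) \<longlongrightarrow> 0) (at x within S)"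
      using \<nu>_has_derivative[OF x] by (simp add: has_derivative_within)
    from filterlim_compose[OF this Zlim]
    have 1: "(\<lambda>n. (1 / s n) *\<^sub>R (\<nu> (Z n) - (\<nu> x + shape x (Z n - x)))) \<longlonglongrightarrow> 0"
      by (simp add: s_def)
    have 2: "(\<lambda>n. shape x (e (r n))) \<longlonglongrightarrow> shape x l"
      by (intro linear_lim_0 bounded_linear.tendsto[OF linear_shape[unfolded linear_conv_bounded_linear] el'])
    have "(1 / s n) *\<^sub>R (\<nu> (Z n) - (\<nu> x + shape x (Z n - x))) + shape x (e (r n)) = (1 / s n) *\<^sub>R (\<nu> (Z n) - \<nu> x)" for n
      using s[of n] unfolding dZ linear_scale[OF linear_shape] by (simp add: scaleR_diff_right scaleR_add_right)
    then show ?thesis using tendsto_add[OF 1 2] by simp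
  qed
  have t3: "(\<lambda>n. (\<nu> x \<bullet> (Z n - x)) / (s n)\<^sup>2) \<longlonglongrightarrow> - (l \<bullet> shape x l) / 2"
  proof -
    have 1: "(\<lambda>n. (- (Du x \<bullet> (Z n - x)) - (Z n - x) \<bullet> (A x *v (Z n - x)) / 2) / (s n)\<^sup>2) \<longlonglongrightarrow> 0"
      using filterlim_compose[OF second_order_taylor[OF x(1)] Zlim] by (simp add: Z s_def)
    have 2: "(\<lambda>n. e (r n) \<bullet> (A x *v e (r n)) / 2) \<longlonglongrightarrow> l \<bullet> (A x *v l) / 2"
      by (intro tendsto_intros el' bounded_linear.tendsto[OF matrix_vector_mul_bounded_linear]) auto
    have "(- (Du x \<bullet> (Z n - x)) - (Z n - x) \<bullet> (A x *v (Z n - x)) / 2) / (s n)\<^sup>2 + e (r n) \<bullet> (A x *v e (r n)) / 2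
      = - ((Du x \<bullet> (Z n - x)) / (s n)\<^sup>2)" for n
      using s[of n] by (simp add: dZ matrix_vector_mult_scaleR power2_eq_square field_simps)
    then have "(\<lambda>n. - ((Du x \<bullet> (Z n - x)) / (s n)\<^sup>2)) \<longlonglongrightarrow> l \<bullet> (A x *v l) / 2"
      using tendsto_add[OF 1 2] by simp
    from tendsto_mult_left[OF this, of "- (1 / norm (Du x))"]
    have "(\<lambda>n. (1 / norm (Du x)) * ((Du x \<bullet> (Z n - x)) / (s n)\<^sup>2)) \<longlonglongrightarrow> - (1 / norm (Du x)) * (l \<bullet> (A x *v l) / 2)"
      by simp
    moreover have "(1 / norm (Du x)) * ((Du x \<bullet> (Z n - x)) / (s n)\<^sup>2) = (\<nu> x \<bullet> (Z n - x)) / (s n)\<^sup>2" for n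
      by (simp add: \<nu>_def sgn_div_norm divide_inverse)
    moreover have "- (1 / norm (Du x)) * (l \<bullet> (A x *v l) / 2) = - (l \<bullet> shape x l) / 2"
      using shape_inner_tangent[OF lT, of l] by (simp add: inner_commute)
    ultimately show ?thesis by (simp only:)
  qed
  have t4: "(\<lambda>n. (norm (\<nu> (Z n) - \<nu> x))\<^sup>2 / (s n)\<^sup>2) \<longlonglongrightarrow> shape x l \<bullet> shape x l"
  proof -
    have "((1 / s n) *\<^sub>R (\<nu> (Z n) - \<nu> x)) \<bullet> ((1 / s n) *\<^sub>R (\<nu> (Z n) - \<nu> x)) = (norm (\<nu> (Z n) - \<nu> x))\<^sup>2 / (s n)\<^sup>2" for n
      by (simp add: dot_square_norm power2_eq_square)
    then show ?thesis using tendsto_inner[OF t2 t2] by simp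
  qed
  have t5: "(\<lambda>n. (\<nu> (Z n) \<bullet> (Z n - x)) / (s n)\<^sup>2) \<longlonglongrightarrow> (l \<bullet> shape x l) / 2"
  proof -
    have "((1 / s n) *\<^sub>R (\<nu> (Z n) - \<nu> x)) \<bullet> e (r n) + (\<nu> x \<bullet> (Z n - x)) / (s n)\<^sup>2 = (\<nu> (Z n) \<bullet> (Z n - x)) / (s n)\<^sup>2" for n
      using s[of n] by (simp add: dZ inner_diff_left power2_eq_square field_simps)
    moreover have "shape x l \<bullet> l + - (l \<bullet> shape x l) / 2 = (l \<bullet> shape x l) / 2" by (simp add: inner_commute)
    ultimately show ?thesis using tendsto_add[OF tendsto_inner[OF t2 el'] t3] by simp
  qed
  define L where "L = \<sigma> * ((l \<bullet> shape x l) / 2 - \<rho> / 2 * (shape x l \<bullet> shape x l))"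
  have "L = \<sigma> * (l \<bullet> shape x l - \<rho> * (shape x l \<bullet> shape x l)) / 2" by (simp add: L_def algebra_simps)
  then have L: "L > 0" using pos[OF lT l0] by simp
  have "(\<lambda>n. \<sigma> * (- ((\<nu> x \<bullet> (Z n - x)) / (s n)\<^sup>2) - \<rho> / 2 * ((norm (\<nu> (Z n) - \<nu> x))\<^sup>2 / (s n)\<^sup>2)))
      \<longlonglongrightarrow> \<sigma> * (- (- (l \<bullet> shape x l) / 2) - \<rho> / 2 * (shape x l \<bullet> shape x l))"
    by (intro tendsto_intros t3 t4)
  moreover have "\<sigma> * (- ((\<nu> x \<bullet> (Z n - x)) / (s n)\<^sup>2) - \<rho> / 2 * ((norm (\<nu> (Z n) - \<nu> x))\<^sup>2 / (s n)\<^sup>2)) = P (Z n) / (s n)\<^sup>2" for n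
    using s[of n] by (simp add: P_def field_simps)
  ultimately have lP: "(\<lambda>n. P (Z n) / (s n)\<^sup>2) \<longlonglongrightarrow> L" by (simp add: L_def)
  have "(\<lambda>n. \<sigma> * ((\<nu> (Z n) \<bullet> (Z n - x)) / (s n)\<^sup>2 - \<rho> / 2 * ((norm (\<nu> (Z n) - \<nu> x))\<^sup>2 / (s n)\<^sup>2)))
      \<longlonglongrightarrow> \<sigma> * ((l \<bullet> shape x l) / 2 - \<rho> / 2 * (shape x l \<bullet> shape x l))"
    by (intro tendsto_intros t5 t4)
  moreover have "\<sigma> * ((\<nu> (Z n) \<bullet> (Z n - x)) / (s n)\<^sup>2 - \<rho> / 2 * ((norm (\<nu> (Z n) - \<nu> x))\<^sup>2 / (s n)\<^sup>2)) = Q (Z n) / (s n)\<^sup>2" for n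
    using s[of n] by (simp add: Q_def field_simps)
  ultimately have lQ: "(\<lambda>n. Q (Z n) / (s n)\<^sup>2) \<longlonglongrightarrow> L" by (simp add: L_def)
  have "eventually (\<lambda>n. P (Z n) / (s n)\<^sup>2 > 0 \<and> Q (Z n) / (s n)\<^sup>2 > 0) sequentially"
    using order_tendstoD(1)[OF lP L] order_tendstoD(1)[OF lQ L] by (rule eventually_conj)
  then obtain n where "P (Z n) / (s n)\<^sup>2 > 0" "Q (Z n) / (s n)\<^sup>2 > 0"
    using eventually_happens' sequentially_bot by blast
  then have "P (Z n) > 0" "Q (Z n) > 0" using s[of n] by (auto simp: zero_less_divide_iff)
  then show False using Y(3)[of "r n"] by (simp add: Z_def)
qed

text \<open>
  The assertion compares the values of \<open>M = \<sigma> (X - \<rho> sgn)\<close> at the two ends of a segment \<open>\<gamma>\<close> that avoids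
  the origin. For parameters \<open>a \<le> b\<close> the pair of inequalities \<open>(M b - M a) \<bullet> \<gamma> b \<ge> 0\<close> and
  \<open>(M a - M b) \<bullet> \<gamma> a \<ge> 0\<close> is transitive, because \<open>\<gamma>\<close> is affine, and it holds locally by
  \<open>local_rolling\<close>. Bisection of the parameter interval makes it global.
\<close>

lemma rolling_along_segment:
  assumes c: "c \<le> 0" "z0 \<in> S" "u z0 < c"
    and pos: "\<And>x v. x \<in> level c \<Longrightarrow> v \<in> tangent x \<Longrightarrow> v \<noteq> 0 \<Longrightarrow>
      \<sigma> * (v \<bullet> shape x v - \<rho> * (shape x v \<bullet> shape x v)) > 0"
    and y: "y \<in> level c" and seg: "\<And>t. 0 \<le> t \<Longrightarrow> t \<le> 1 \<Longrightarrow> (1 - t) *\<^sub>R \<nu> y + t *\<^sub>R \<theta> \<noteq> 0"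
  shows "0 \<le> \<sigma> * ((support_point c \<theta> - \<rho> *\<^sub>R sgn \<theta> - (y - \<rho> *\<^sub>R \<nu> y)) \<bullet> \<theta>)"
proof -
  define \<gamma> where "\<gamma> t = (1 - t) *\<^sub>R \<nu> y + t *\<^sub>R \<theta>" for t
  define q where "q = \<theta> - \<nu> y"
  define M where "M t = \<sigma> *\<^sub>R (support_point c (\<gamma> t) - \<rho> *\<^sub>R sgn (\<gamma> t))" for t
  have \<gamma>_add: "\<gamma> b = \<gamma> a + (b - a) *\<^sub>R q" for a b
    by (simp add: \<gamma>_def q_def algebra_simps)
  have nz: "\<gamma> t \<noteq> 0" if "0 \<le> t" "t \<le> 1" for t using seg[OF that] by (simp add: \<gamma>_def)
  have gradnz: "Du x \<noteq> 0" if "x \<in> level c" for x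
    using that gradient_nonzero[of x z0] c by (auto simp: level_def)
  have XL: "support_point c (\<gamma> t) \<in> level c" if "0 \<le> t" "t \<le> 1" for t
    by (rule support_point_properties(1)[OF c nz[OF that]])
  have X\<nu>: "\<nu> (support_point c (\<gamma> t)) = sgn (\<gamma> t)" if t: "0 \<le> t" "t \<le> 1" for t
  proof -
    obtain l where "l > 0" "Du (support_point c (\<gamma> t)) = l *\<^sub>R \<gamma> t" using support_point_properties(2)[OF c nz[OF t]] by blast
    then show ?thesis by (simp add: \<nu>_def sgn_scaleR)
  qed
  define P where "P a b \<longleftrightarrow> (0 \<le> a \<longrightarrow> b \<le> 1 \<longrightarrow> 0 \<le> (M b - M a) \<bullet> \<gamma> b \<and> 0 \<le> (M a - M b) \<bullet> \<gamma> a)" for a b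
  have local: "\<exists>d>0. \<forall>t. 0 \<le> t \<longrightarrow> t \<le> 1 \<longrightarrow> \<bar>t - x\<bar> < d \<longrightarrow>
      0 \<le> (M x - M t) \<bullet> \<gamma> x \<and> 0 \<le> (M t - M x) \<bullet> \<gamma> t" if x: "0 \<le> x" "x \<le> 1" for x
  proof -
    define x0 where "x0 = support_point c (\<gamma> x)"
    have x0: "x0 \<in> level c" "x0 \<in> S" "u x0 = c" using XL[OF x] by (auto simp: x0_def level_def)
    obtain \<delta> where \<delta>: "\<delta> > 0" "\<And>y'. y' \<in> level c \<Longrightarrow> norm (y' - x0) < \<delta> \<Longrightarrow>
      0 \<le> \<sigma> * (- (\<nu> x0 \<bullet> (y' - x0)) - \<rho> / 2 * (norm (\<nu> y' - \<nu> x0))\<^sup>2) \<and>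
      0 \<le> \<sigma> * (\<nu> y' \<bullet> (y' - x0) - \<rho> / 2 * (norm (\<nu> y' - \<nu> x0))\<^sup>2)"
      using local_rolling[OF x0(2) gradnz[OF x0(1)] pos[OF x0(1)]] x0(3) by auto
    have "continuous_on {0..1} (\<lambda>t. support_point c (\<gamma> t))"
    proof (rule continuous_on_compose2[OF continuous_on_support_point[OF c]])
      show "continuous_on {0..1} \<gamma>" unfolding \<gamma>_def by (intro continuous_intros)
      show "\<gamma> ` {0..1} \<subseteq> - {0}" using nz by auto
    qed
    then obtain d where d: "d > 0" "\<And>t. t \<in> {0..1} \<Longrightarrow> dist t x < d \<Longrightarrow> dist (support_point c (\<gamma> t)) x0 < \<delta>"
      using x \<delta>(1) unfolding continuous_on_iff x0_def by (metis atLeastAtMost_iff)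
    have "0 \<le> (M x - M t) \<bullet> \<gamma> x \<and> 0 \<le> (M t - M x) \<bullet> \<gamma> t" if t: "0 \<le> t" "t \<le> 1" "\<bar>t - x\<bar> < d" for t
    proof -
      define y' where "y' = support_point c (\<gamma> t)"
      have y': "y' \<in> level c" using XL[OF t(1,2)] by (simp add: y'_def)
      have "norm (y' - x0) < \<delta>" using d(2)[of t] t by (simp add: dist_norm y'_def)
      note ineq = \<delta>(2)[OF y' this]
      have n1: "norm (\<nu> x0) = 1" "norm (\<nu> y') = 1" using norm_\<nu> gradnz x0(1) y' by auto
      have n2: "norm (\<nu> y' - \<nu> x0) = norm (\<nu> x0 - \<nu> y')" by (rule norm_minus_commute)
      have gx: "\<gamma> x = norm (\<gamma> x) *\<^sub>R \<nu> x0" and gt: "\<gamma> t = norm (\<gamma> t) *\<^sub>R \<nu> y'"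
        using X\<nu>[OF x] X\<nu>[OF t(1,2)] nz[OF x] nz[OF t(1,2)] by (simp_all add: x0_def y'_def sgn_div_norm)
      have Mx: "M x = \<sigma> *\<^sub>R (x0 - \<rho> *\<^sub>R \<nu> x0)" and Mt: "M t = \<sigma> *\<^sub>R (y' - \<rho> *\<^sub>R \<nu> y')"
        using X\<nu>[OF x] X\<nu>[OF t(1,2)] by (simp_all add: M_def x0_def y'_def)
      have i1: "(M x - M t) \<bullet> \<nu> x0 = \<sigma> * (- (\<nu> x0 \<bullet> (y' - x0)) - \<rho> * (1 - \<nu> x0 \<bullet> \<nu> y'))"
        unfolding Mx Mt using n1 by (simp add: inner_diff_left inner_diff_right dot_square_norm inner_commute algebra_simps)
      have i2: "(M t - M x) \<bullet> \<nu> y' = \<sigma> * (\<nu> y' \<bullet> (y' - x0) - \<rho> * (1 - \<nu> x0 \<bullet> \<nu> y'))"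
        unfolding Mx Mt using n1 by (simp add: inner_diff_left inner_diff_right dot_square_norm inner_commute algebra_simps)
      have h: "1 - \<nu> x0 \<bullet> \<nu> y' = (norm (\<nu> y' - \<nu> x0))\<^sup>2 / 2"
        unfolding n2 by (rule half_norm_square_diff_unit[OF n1])
      have "0 \<le> (M x - M t) \<bullet> \<nu> x0" "0 \<le> (M t - M x) \<bullet> \<nu> y'"
        unfolding i1 i2 h using ineq by simp_all
      then have "0 \<le> norm (\<gamma> x) * ((M x - M t) \<bullet> \<nu> x0)" "0 \<le> norm (\<gamma> t) * ((M t - M x) \<bullet> \<nu> y')"
        by simp_all
      moreover have "(M x - M t) \<bullet> \<gamma> x = norm (\<gamma> x) * ((M x - M t) \<bullet> \<nu> x0)"
        by (subst gx) simp
      moreover have "(M t - M x) \<bullet> \<gamma> t = norm (\<gamma> t) * ((M t - M x) \<bullet> \<nu> y')"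
        by (subst gt) simp
      ultimately show ?thesis by simp
    qed
    then show ?thesis using d(1) by blast
  qed
  have transP: "P a e" if ab: "P a b" and be: "P b e" and le: "a \<le> b" "b \<le> e" for a b e
    unfolding P_def
  proof (intro impI)
    assume ae: "0 \<le> a" "e \<le> 1"
    have 1: "0 \<le> (M b - M a) \<bullet> \<gamma> b" "0 \<le> (M a - M b) \<bullet> \<gamma> a" using ab ae le by (auto simp: P_def)
    have 2: "0 \<le> (M e - M b) \<bullet> \<gamma> e" "0 \<le> (M b - M e) \<bullet> \<gamma> b" using be ae le by (auto simp: P_def)
    have q: "0 \<le> (t - s) * ((M t - M s) \<bullet> q)" if "0 \<le> (M t - M s) \<bullet> \<gamma> t" "0 \<le> (M s - M t) \<bullet> \<gamma> s" for s t
      using that \<gamma>_add[of t s] by (simp add: inner_add_right inner_diff_left)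
    have qab: "0 \<le> (M b - M a) \<bullet> q" if "a \<noteq> b"
      using q[OF 1] le that by (simp add: zero_le_mult_iff)
    have qbe: "0 \<le> (M e - M b) \<bullet> q" if "b \<noteq> e"
      using q[OF 2] le that by (simp add: zero_le_mult_iff)
    have 3: "0 \<le> (M b - M a) \<bullet> \<gamma> e"
    proof -
      have "0 \<le> (e - b) * ((M b - M a) \<bullet> q)" using qab le by (cases "a = b") auto
      then show ?thesis using 1(1) \<gamma>_add[of e b] by (simp add: inner_add_right)
    qed
    have 4: "0 \<le> (M b - M e) \<bullet> \<gamma> a"
    proof -
      have "0 \<le> (b - a) * ((M e - M b) \<bullet> q)" using qbe le by (cases "b = e") auto
      moreover have "(M b - M e) \<bullet> \<gamma> a = (M b - M e) \<bullet> \<gamma> b + (b - a) * ((M e - M b) \<bullet> q)"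
        unfolding \<gamma>_add[of a b] by (simp add: inner_add_right inner_diff_left algebra_simps)
      ultimately show ?thesis using 2(2) by simp
    qed
    show "0 \<le> (M e - M a) \<bullet> \<gamma> e \<and> 0 \<le> (M a - M e) \<bullet> \<gamma> a"
      using 1 2 3 4 by (simp add: inner_diff_left)
  qed
  have "P 0 (1::real)"
  proof (rule Bolzano)
    show "(0::real) \<le> 1" by simp
    show "P a e" if "P a b" "P b e" "a \<le> b" "b \<le> e" for a b e using transP that by blast
    fix x :: real assume x: "0 \<le> x" "x \<le> 1"
    obtain d where d: "d > 0" "\<forall>t. 0 \<le> t \<longrightarrow> t \<le> 1 \<longrightarrow> \<bar>t - x\<bar> < d \<longrightarrow>
      0 \<le> (M x - M t) \<bullet> \<gamma> x \<and> 0 \<le> (M t - M x) \<bullet> \<gamma> t" using local[OF x] by blast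
    have "P a b" if "a \<le> x" "x \<le> b" "b - a < d" for a b
    proof (rule transP[of a x b])
      show "P a x" unfolding P_def using d(2)[rule_format, of a] that x by auto
      show "P x b" unfolding P_def using d(2)[rule_format, of b] that x by auto
    qed (use that in auto)
    then show "\<exists>d>0. \<forall>a b. a \<le> x \<and> x \<le> b \<and> b - a < d \<longrightarrow> P a b" using d(1) by blast
  qed
  then have "0 \<le> (M 1 - M 0) \<bullet> \<gamma> 1" by (simp add: P_def)
  moreover have "support_point c (\<nu> y) = y"
  proof (rule support_point_unique[OF c _ y])
    show "\<nu> y \<noteq> 0" using norm_\<nu>[OF gradnz[OF y]] by auto
    show "norm (Du y) > 0" using gradnz[OF y] by simp
    show "Du y = norm (Du y) *\<^sub>R \<nu> y" by (rule gradient_eq_\<nu>)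
  qed
  moreover have "sgn (\<nu> y) = \<nu> y" by (simp add: sgn_div_norm norm_\<nu>[OF gradnz[OF y]])
  ultimately show ?thesis
    by (simp add: M_def \<gamma>_def scaleR_diff_right[symmetric])
qed

text \<open>
  The support function of the sublevel set lies above (\<open>\<sigma> = 1\<close>) or below (\<open>\<sigma> = -1\<close>) that of the ball
  of radius \<open>\<rho>\<close> that touches the level set at \<open>y\<close>.
\<close>

lemma global_rolling:
  assumes c: "c \<le> 0" "z0 \<in> S" "u z0 < c"
    and pos: "\<And>x v. x \<in> level c \<Longrightarrow> v \<in> tangent x \<Longrightarrow> v \<noteq> 0 \<Longrightarrow>
      \<sigma> * (v \<bullet> shape x v - \<rho> * (shape x v \<bullet> shape x v)) > 0"
    and y: "y \<in> level c" and th: "\<theta> \<noteq> 0"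
  shows "0 \<le> \<sigma> * (\<theta> \<bullet> support_point c \<theta> - \<rho> * norm \<theta> - \<theta> \<bullet> (y - \<rho> *\<^sub>R \<nu> y))"
proof -
  define F where "F \<theta> = \<sigma> * ((support_point c \<theta> - \<rho> *\<^sub>R sgn \<theta> - (y - \<rho> *\<^sub>R \<nu> y)) \<bullet> \<theta>)" for \<theta>
  have "0 \<le> F \<theta>"
  proof (cases "\<forall>t. 0 \<le> t \<longrightarrow> t \<le> 1 \<longrightarrow> (1 - t) *\<^sub>R \<nu> y + t *\<^sub>R \<theta> \<noteq> 0")
    case True
    then show ?thesis unfolding F_def using rolling_along_segment[OF c pos y] by blast
  next
    case False
    then obtain t where t: "0 \<le> t" "t \<le> 1" "(1 - t) *\<^sub>R \<nu> y + t *\<^sub>R \<theta> = 0" by blast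
    have yS: "y \<in> S" "u y = c" using y by (auto simp: level_def)
    have nz: "Du y \<noteq> 0" using gradient_nonzero[OF yS(1) c(2)] c(3) yS(2) by simp
    have \<nu>1: "norm (\<nu> y) = 1" by (rule norm_\<nu>[OF nz])
    \<comment> \<open>The segment meets the origin only if \<open>\<theta>\<close> is a negative multiple of \<open>\<nu> y\<close>. A tangential perturbation of \<open>\<theta>\<close> avoids this, and the inequality is recovered in the limit.\<close>
    obtain \<tau> where \<tau>: "\<tau> \<in> tangent y" "\<tau> \<noteq> 0"
      using tangent_nontrivial[of y] subspace_0[OF tangent_subspace[of y]] by blast
    have \<tau>\<nu>: "\<tau> \<bullet> \<nu> y = 0" using \<tau>(1) by (simp add: \<nu>_def sgn_div_norm)
    have "t \<noteq> 0" using t(3) \<nu>1 by auto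
    have "\<tau> \<bullet> ((1 - t) *\<^sub>R \<nu> y + t *\<^sub>R \<theta>) = 0" using t(3) by simp
    then have \<theta>\<tau>: "\<tau> \<bullet> \<theta> = 0" using \<tau>\<nu> \<open>t \<noteq> 0\<close> by (simp add: inner_add_right)
    have seg: "(1 - s) *\<^sub>R \<nu> y + s *\<^sub>R (\<theta> + h *\<^sub>R \<tau>) \<noteq> 0" if h: "h \<noteq> 0" for s h
    proof
      assume *: "(1 - s) *\<^sub>R \<nu> y + s *\<^sub>R (\<theta> + h *\<^sub>R \<tau>) = 0"
      then have "\<tau> \<bullet> ((1 - s) *\<^sub>R \<nu> y + s *\<^sub>R (\<theta> + h *\<^sub>R \<tau>)) = 0" by simp
      then have "s * (h * (\<tau> \<bullet> \<tau>)) = 0" using \<tau>\<nu> \<theta>\<tau> by (simp add: inner_add_right)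
      then have "s = 0" using h \<tau> by simp
      then show False using * \<nu>1 by auto
    qed
    have pos': "F (\<theta> + h *\<^sub>R \<tau>) \<ge> 0" if "h \<noteq> 0" for h
      unfolding F_def using rolling_along_segment[OF c pos y] seg[OF that] by blast
    have "continuous_on (- {0}) F"
      unfolding F_def sgn_div_norm by (intro continuous_intros continuous_on_support_point[OF c]) auto
    then have cont: "isCont F \<theta>" using th continuous_on_eq_continuous_at[of "- {0}" F] open_Compl[OF closed_singleton] by blast
    have "((\<lambda>h. \<theta> + h *\<^sub>R \<tau>) \<longlongrightarrow> \<theta> + 0 *\<^sub>R \<tau>) (at 0)" by (intro tendsto_intros)
    then have "((\<lambda>h. F (\<theta> + h *\<^sub>R \<tau>)) \<longlongrightarrow> F \<theta>) (at 0)"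
      using isCont_tendsto_compose[OF cont] by simp
    moreover have "eventually (\<lambda>h. 0 \<le> F (\<theta> + h *\<^sub>R \<tau>)) (at 0)"
      unfolding eventually_at by (intro exI[of _ 1]) (use pos' in auto)
    ultimately show ?thesis by (intro tendsto_lowerbound) auto
  qed
  moreover have "sgn \<theta> \<bullet> \<theta> = norm \<theta>"
    using th by (simp add: sgn_div_norm dot_square_norm power2_eq_square)
  then have "(support_point c \<theta> - \<rho> *\<^sub>R sgn \<theta> - (y - \<rho> *\<^sub>R \<nu> y)) \<bullet> \<theta> = \<theta> \<bullet> support_point c \<theta> - \<rho> * norm \<theta> - \<theta> \<bullet> (y - \<rho> *\<^sub>R \<nu> y)"
    by (simp only: inner_diff_left[of "support_point c \<theta> - \<rho> *\<^sub>R sgn \<theta>"] inner_diff_left[of "support_point c \<theta>"] inner_scaleR_left inner_commute[of \<theta>])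
  ultimately show ?thesis by (simp only: F_def)
qed

lemma inner_ball:
  assumes c: "c \<le> 0" "z0 \<in> S" "u z0 < c"
    and pos: "\<And>x v. x \<in> level c \<Longrightarrow> v \<in> tangent x \<Longrightarrow> v \<noteq> 0 \<Longrightarrow>
      \<rho> * (shape x v \<bullet> shape x v) < v \<bullet> shape x v"
    and y: "y \<in> level c"
  shows "cball (y - \<rho> *\<^sub>R \<nu> y) \<rho> \<subseteq> sublevel c"
proof
  fix z assume z: "z \<in> cball (y - \<rho> *\<^sub>R \<nu> y) \<rho>"
  show "z \<in> sublevel c"
  proof (rule ccontr)
    assume "z \<notin> sublevel c"
    then obtain a b where ab: "a \<bullet> z < b" "\<forall>x\<in>sublevel c. a \<bullet> x > b"
      using separating_hyperplane_closed_point[OF convex_sublevel compact_imp_closed[OF compact_sublevel]] by blast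
    have "a \<noteq> 0" using ab y level_subset_sublevel by force
    then have a: "- a \<noteq> 0" by simp
    have "support_point c (- a) \<in> sublevel c" using support_point_properties(1)[OF c a] level_subset_sublevel by blast
    then have "(- a) \<bullet> support_point c (- a) < (- a) \<bullet> z" using ab by force
    moreover have "0 \<le> 1 * ((- a) \<bullet> support_point c (- a) - \<rho> * norm (- a) - (- a) \<bullet> (y - \<rho> *\<^sub>R \<nu> y))"
      using pos by (intro global_rolling[OF c _ y a]) auto
    moreover have "(- a) \<bullet> (z - (y - \<rho> *\<^sub>R \<nu> y)) \<le> norm (- a) * \<rho>"
    proof -
      have "(- a) \<bullet> (z - (y - \<rho> *\<^sub>R \<nu> y)) \<le> norm (- a) * norm (z - (y - \<rho> *\<^sub>R \<nu> y))" by (rule norm_cauchy_schwarz)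
      also have "\<dots> \<le> norm (- a) * \<rho>" using z by (intro mult_left_mono) (auto simp: dist_norm norm_minus_commute)
      finally show ?thesis .
    qed
    ultimately show False by (simp add: inner_diff_right mult.commute)
  qed
qed

lemma outer_ball:
  assumes c: "c \<le> 0" "z0 \<in> S" "u z0 < c"
    and pos: "\<And>x v. x \<in> level c \<Longrightarrow> v \<in> tangent x \<Longrightarrow> v \<noteq> 0 \<Longrightarrow>
      v \<bullet> shape x v < \<rho> * (shape x v \<bullet> shape x v)"
    and y: "y \<in> level c" and \<rho>: "\<rho> \<ge> 0"
  shows "sublevel c \<subseteq> cball (y - \<rho> *\<^sub>R \<nu> y) \<rho>"
proof
  fix z assume z: "z \<in> sublevel c"
  define a where "a = y - \<rho> *\<^sub>R \<nu> y"
  define \<theta> where "\<theta> = z - a"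
  show "z \<in> cball a \<rho>"
  proof (cases "\<theta> = 0")
    case True
    then show ?thesis using \<rho> by (simp add: \<theta>_def)
  next
    case False
    have "0 \<le> (- 1) * (\<theta> \<bullet> support_point c \<theta> - \<rho> * norm \<theta> - \<theta> \<bullet> a)"
      unfolding a_def using pos by (intro global_rolling[OF c _ y False]) auto
    moreover have "\<theta> \<bullet> z \<le> \<theta> \<bullet> support_point c \<theta>" by (rule support_point_maximizes[OF c False z])
    ultimately have "\<theta> \<bullet> (z - a) \<le> \<rho> * norm \<theta>" by (simp add: inner_diff_right)
    then have "norm \<theta> * norm \<theta> \<le> \<rho> * norm \<theta>"
      by (simp add: \<theta>_def[symmetric] dot_square_norm power2_eq_square)
    then have "norm \<theta> \<le> \<rho>" using False by simp
    then show ?thesis by (simp add: \<theta>_def dist_norm norm_minus_commute)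
  qed
qed

section \<open>Gradient bounds by comparison with paraboloids\<close>

text \<open>
  The sign \<open>\<sigma>\<close> covers a maximum (\<open>\<sigma> = 1\<close>) and a minimum (\<open>\<sigma> = -1\<close>) of the difference between \<open>u\<close> and
  the paraboloid.
\<close>

lemma hessian_bound_at_touching_paraboloid:
  assumes U: "open U" "m \<in> U" "U \<subseteq> \<Omega>"
    and max: "\<And>z. z \<in> U \<Longrightarrow> \<sigma> * (u z - s * ((z - a) \<bullet> (z - a)) / 2) \<le> \<sigma> * (u m - s * ((m - a) \<bullet> (m - a)) / 2)"
  shows "\<sigma> * (e \<bullet> (A m *v e)) \<le> \<sigma> * (s * (e \<bullet> e))"
proof -
  have "((\<lambda>t::real. m + t *\<^sub>R e) \<longlongrightarrow> m + 0 *\<^sub>R e) (at 0)" by (intro tendsto_intros)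
  then have "eventually (\<lambda>t::real. m + t *\<^sub>R e \<in> U) (at 0)"
    using U by (intro topological_tendstoD) auto
  then obtain d where d: "d > 0" "\<forall>t. t \<noteq> 0 \<and> \<bar>t\<bar> < d \<longrightarrow> m + t *\<^sub>R e \<in> U"
    unfolding eventually_at by (auto simp: dist_norm)
  have inU: "m + t *\<^sub>R e \<in> U" if "\<bar>t\<bar> < d" for t
    using d(2) U(2) that by (cases "t = 0") auto
  have in\<Omega>: "m + t *\<^sub>R e \<in> \<Omega>" if "\<bar>t\<bar> < d" for t using inU[OF that] U(3) by blast
  have m: "m + 0 *\<^sub>R e \<in> \<Omega>" using U by auto
  have du: "((\<lambda>t. u (m + t *\<^sub>R e)) has_real_derivative Du (m + t *\<^sub>R e) \<bullet> e) (at t)" if "\<bar>t\<bar> < d" for t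
    using D_has_derivative_on_line[OF in\<Omega>[OF that], of "[]"]
    by (simp add: inner_vec_def gradient_component mult.commute)
  have dz: "((\<lambda>t. (m + t *\<^sub>R e - a) $ i) has_real_derivative e $ i) (at t)" for t i
    by (auto intro!: derivative_eq_intros)
  have de: "((\<lambda>t. e $ i) has_real_derivative 0 $ i) (at t)" for t i by simp
  let ?f = "\<lambda>t. \<sigma> * (u (m + t *\<^sub>R e) - s * ((m + t *\<^sub>R e - a) \<bullet> (m + t *\<^sub>R e - a)) / 2)"
  let ?f' = "\<lambda>t. \<sigma> * (Du (m + t *\<^sub>R e) \<bullet> e - s * ((m + t *\<^sub>R e - a) \<bullet> e))"
  have 1: "(?f has_real_derivative ?f' t) (at t)" if "\<bar>t\<bar> < d" for t
  proof -
    have "(?f has_real_derivative \<sigma> * (Du (m + t *\<^sub>R e) \<bullet> e -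
        s * (e \<bullet> (m + t *\<^sub>R e - a) + (m + t *\<^sub>R e - a) \<bullet> e) / 2)) (at t)"
      by (intro DERIV_cmult DERIV_diff DERIV_cdivide DERIV_inner_vec du that dz)
    then show ?thesis by (simp add: inner_commute[of e])
  qed
  have 2: "(?f' has_real_derivative \<sigma> * ((A m *v e) \<bullet> e - s * (e \<bullet> e))) (at 0)"
  proof -
    have "(?f' has_real_derivative \<sigma> * ((A (m + 0 *\<^sub>R e) *v e) \<bullet> e + Du (m + 0 *\<^sub>R e) \<bullet> 0 -
        s * (e \<bullet> e + (m + 0 *\<^sub>R e - a) \<bullet> 0))) (at 0)"
      by (intro DERIV_cmult DERIV_diff DERIV_inner_vec gradient_on_line m dz de)
    then show ?thesis by simp
  qed
  have "\<sigma> * ((A m *v e) \<bullet> e - s * (e \<bullet> e)) \<le> 0"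
    using second_derivative_nonpos_at_max[OF d(1) 1 2] max inU by simp
  then show ?thesis by (simp add: inner_commute right_diff_distrib)
qed

text \<open>
  On the ball the paraboloid \<open>c + q\<close> solves the same equation and is at least \<open>u\<close> on the sphere, so it
  lies above \<open>u\<close>. Both equal \<open>c\<close> at \<open>y\<close>, where the slope of the paraboloid is \<open>r\<close>. Comparison is done
  with the factor \<open>s < 1\<close>, for which the touching point would have \<open>det A \<le> s\<^sup>n < 1\<close>.
\<close>

lemma gradient_ge_inner_radius:
  assumes y: "y \<in> level c" "Du y \<noteq> 0" and r: "r > 0" and ball: "cball (y - r *\<^sub>R \<nu> y) r \<subseteq> sublevel c"
  shows "r \<le> norm (Du y)"
proof -
  define a where "a = y - r *\<^sub>R \<nu> y"
  define q where "q z = ((z - a) \<bullet> (z - a) - r\<^sup>2) / 2" for z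
  have sub: "z \<in> S" "u z \<le> c" if "z \<in> cball a r" for z
    using ball that by (auto simp: sublevel_def a_def)
  have q0: "q z \<le> 0" if "z \<in> cball a r" for z
  proof -
    have "norm (z - a) \<le> r" using that by (simp add: dist_norm norm_minus_commute)
    then have "(norm (z - a))\<^sup>2 \<le> r\<^sup>2" by (intro power_mono) auto
    then show ?thesis by (simp add: q_def dot_square_norm)
  qed
  have below: "u z - c \<le> s * q z" if s: "0 < s" "s < 1" and z: "z \<in> cball a r" for s z
  proof -
    have "cball a r \<noteq> {}" using r by simp
    moreover have "continuous_on (cball a r) (\<lambda>z. u z - s * q z)"
      unfolding q_def using sub by (intro continuous_intros continuous_on_subset[OF continuous_on_u]) auto
    ultimately have "\<exists>m\<in>cball a r. \<forall>z\<in>cball a r. u z - s * q z \<le> u m - s * q m"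
      by (rule continuous_attains_sup[OF compact_cball])
    then obtain m where m: "m \<in> cball a r" "\<And>z. z \<in> cball a r \<Longrightarrow> u z - s * q z \<le> u m - s * q m"
      by blast
    have "u m - s * q m \<le> c"
    proof (rule ccontr)
      assume gt: "\<not> ?thesis"
      have "norm (m - a) \<noteq> r"
      proof
        assume "norm (m - a) = r"
        then have "q m = 0" by (simp add: q_def dot_square_norm)
        then show False using gt sub(2)[OF m(1)] by simp
      qed
      then have mb: "m \<in> ball a r" using m(1) by (simp add: dist_norm norm_minus_commute)
      have "ball a r \<subseteq> interior S"
        using sub(1) by (intro interior_maximal) auto
      then have bO: "ball a r \<subseteq> \<Omega>" by (simp only: interior_S)
      have "1 * (e \<bullet> (A m *v e)) \<le> 1 * (s * (e \<bullet> e))" for e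
      proof (rule hessian_bound_at_touching_paraboloid[OF open_ball mb bO])
        fix z assume "z \<in> ball a r"
        then have "z \<in> cball a r" by simp
        from m(2)[OF this]
        show "1 * (u z - s * ((z - a) \<bullet> (z - a)) / 2) \<le> 1 * (u m - s * ((m - a) \<bullet> (m - a)) / 2)"
          by (simp add: q_def field_simps)
      qed
      then have "det (A m) < 1"
        using s(2) by (intro det_less_one[OF positive_definite_hessian[OF sub(1)[OF m(1)]]]) auto
      moreover have "det (A m) = 1" using det_eq mb bO by blast
      ultimately show False by simp
    qed
    then show ?thesis using m(2)[OF z] by simp
  qed
  have "u z - c \<le> q z" if z: "z \<in> cball a r" for z
  proof (rule ccontr)
    assume n: "\<not> ?thesis"
    have w: "u z - c \<le> 0" using sub(2)[OF z] by simp
    have q: "q z < 0" using n w by simp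
    \<comment> \<open>With this factor \<open>s * q z\<close> is the midpoint of \<open>q z\<close> and \<open>u z - c\<close>.\<close>
    define s where "s = (u z - c + q z) / (2 * q z)"
    have "0 < s" "s < 1" using n w q by (simp_all add: s_def field_simps zero_less_divide_iff)
    from below[OF this z] have "u z - c \<le> (u z - c + q z) / 2" using q by (simp add: s_def)
    then show False using n by simp
  qed
  note below' = this
  show ?thesis
  proof (rule ccontr)
    assume "\<not> ?thesis"
    then have lt: "norm (Du y) < r" by simp
    \<comment> \<open>At depth \<open>t\<close> below \<open>y\<close> the paraboloid forces \<open>|Du y| > r - t / 2\<close>, which is false for this \<open>t\<close>.\<close>
    define t where "t = r - norm (Du y)"
    have t: "0 < t" "t \<le> r" using lt by (auto simp: t_def)
    have \<nu>1: "norm (\<nu> y) = 1" by (rule norm_\<nu>[OF y(2)])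
    define z where "z = y - t *\<^sub>R \<nu> y"
    have za: "z - a = (r - t) *\<^sub>R \<nu> y" by (simp add: z_def a_def algebra_simps)
    have zb: "z \<in> cball a r" using za t \<nu>1 by (simp add: dist_norm norm_minus_commute[of a])
    have "z \<noteq> y" using t(1) \<nu>1 by (auto simp: z_def)
    then have "u y + Du y \<bullet> (z - y) < u z"
      using y(1) sub(1)[OF zb] by (intro u_above_tangent) (auto simp: level_def)
    moreover have "Du y \<bullet> \<nu> y = norm (Du y)"
      using y(2) by (simp add: \<nu>_def sgn_div_norm dot_square_norm power2_eq_square)
    ultimately have "c - t * norm (Du y) < u z" using y(1) by (simp add: z_def level_def)
    moreover have "u z - c \<le> ((r - t)\<^sup>2 - r\<^sup>2) / 2"
      using below'[OF zb] \<nu>1 by (simp add: q_def za dot_square_norm[of "\<nu> y"] power2_eq_square)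
    moreover have "((r - t)\<^sup>2 - r\<^sup>2) / 2 = - t * (r - t / 2)" by (simp add: power2_eq_square field_simps)
    ultimately have "t * (r - t / 2) < t * norm (Du y)" by simp
    then have "r - t / 2 < norm (Du y)" using t(1) by simp
    then show False using lt by (simp add: t_def field_simps)
  qed
qed

text \<open>
  The mirror image of \<open>gradient_ge_inner_radius\<close>, with the paraboloid below \<open>u\<close> on all of \<open>\<Omega>\<close> and a
  factor \<open>s > 1\<close>.
\<close>

lemma gradient_le_outer_radius:
  assumes y: "y \<in> frontier \<Omega>" and R: "R > 0" and ball: "S \<subseteq> cball (y - R *\<^sub>R \<nu> y) R"
  shows "norm (Du y) \<le> R"
proof -
  define a where "a = y - R *\<^sub>R \<nu> y"
  define q where "q z = ((z - a) \<bullet> (z - a) - R\<^sup>2) / 2" for z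
  have yS: "y \<in> S" "u y = 0" using y boundary_value by (auto simp: frontier_eq)
  have nz: "Du y \<noteq> 0" by (rule boundary_gradient_nonzero[OF y])
  have q0: "q z \<le> 0" if "z \<in> S" for z
  proof -
    have "norm (z - a) \<le> R" using that ball by (auto simp: dist_norm norm_minus_commute a_def)
    then have "(norm (z - a))\<^sup>2 \<le> R\<^sup>2" by (intro power_mono) auto
    then show ?thesis by (simp add: q_def dot_square_norm)
  qed
  have above: "s * q z \<le> u z" if s: "1 < s" and z: "z \<in> S" for s z
  proof -
    have "S \<noteq> {}" using z by (metis empty_iff)
    moreover have "continuous_on S (\<lambda>z. u z - s * q z)"
      unfolding q_def by (intro continuous_intros continuous_on_u) auto
    ultimately have "\<exists>m\<in>S. \<forall>z\<in>S. u m - s * q m \<le> u z - s * q z"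
      by (rule continuous_attains_inf[OF compact_S])
    then obtain m where m: "m \<in> S" "\<And>z. z \<in> S \<Longrightarrow> u m - s * q m \<le> u z - s * q z"
      by blast
    have "0 \<le> u m - s * q m"
    proof (rule ccontr)
      assume lt: "\<not> ?thesis"
      have "m \<notin> frontier \<Omega>"
      proof
        assume "m \<in> frontier \<Omega>"
        then have "u m = 0" using boundary_value by blast
        moreover have "s * q m \<le> 0" using q0[OF m(1)] s by (simp add: mult_le_0_iff)
        ultimately show False using lt by simp
      qed
      then have mO: "m \<in> \<Omega>" using m(1) by (simp add: frontier_eq)
      have "(-1) * (e \<bullet> (A m *v e)) \<le> (-1) * (s * (e \<bullet> e))" for e
      proof (rule hessian_bound_at_touching_paraboloid[OF open_domain mO subset_refl])
        fix z assume "z \<in> \<Omega>"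
        from m(2)[OF domain_subset[OF this]]
        show "(-1) * (u z - s * ((z - a) \<bullet> (z - a)) / 2) \<le> (-1) * (u m - s * ((m - a) \<bullet> (m - a)) / 2)"
          by (simp add: q_def field_simps)
      qed
      then have "det (A m) > 1"
        using s by (intro det_greater_one[OF positive_definite_hessian[OF m(1)]]) auto
      then show False using det_eq mO by simp
    qed
    then show ?thesis using m(2)[OF z] by simp
  qed
  have above': "q z \<le> u z" if z: "z \<in> S" for z
  proof (rule ccontr)
    assume n: "\<not> ?thesis"
    have q: "q z < 0"
    proof (rule ccontr)
      assume "\<not> q z < 0"
      then have "q z = 0" using q0[OF z] by simp
      then show False using n above[of 2 z] z by simp
    qed
    \<comment> \<open>With this factor \<open>s * q z\<close> is the midpoint of \<open>q z\<close> and \<open>u z\<close>.\<close>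
    define s where "s = (u z + q z) / (2 * q z)"
    have "1 < s" using n q by (simp add: s_def field_simps)
    from above[OF this z] have "(u z + q z) / 2 \<le> u z" using q by (simp add: s_def)
    then show False using n by simp
  qed
  have \<nu>1: "norm (\<nu> y) = 1" by (rule norm_\<nu>[OF nz])
  have Du\<nu>: "Du y \<bullet> \<nu> y = norm (Du y)"
    using nz by (simp add: \<nu>_def sgn_div_norm dot_square_norm power2_eq_square)
  then have "Du y \<bullet> (- \<nu> y) < 0" using nz by simp
  then obtain d where d: "d > 0" "\<forall>t. 0 < t \<and> t < d \<longrightarrow> y + t *\<^sub>R (- \<nu> y) \<in> \<Omega> \<and> u (y + t *\<^sub>R (- \<nu> y)) < u y"
    using descent_direction[OF yS(1)] by blast
  have inS: "y - t *\<^sub>R \<nu> y \<in> S" if "0 < t" "t < d" for t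
    using d(2)[rule_format, of t] that domain_subset by simp
  have le: "Du (y - t *\<^sub>R \<nu> y) \<bullet> \<nu> y \<le> R" if t: "0 < t" "t < d" for t
  proof -
    define z where "z = y - t *\<^sub>R \<nu> y"
    have zS: "z \<in> S" using inS[OF t] by (simp add: z_def)
    have za: "z - a = (R - t) *\<^sub>R \<nu> y" by (simp add: z_def a_def algebra_simps)
    have "z \<noteq> y" using t(1) \<nu>1 by (auto simp: z_def)
    then have "u z + Du z \<bullet> (y - z) < u y" using zS yS(1) by (intro u_above_tangent)
    then have "u z + t * (Du z \<bullet> \<nu> y) < 0" using yS(2) by (simp add: z_def)
    moreover have "((R - t)\<^sup>2 - R\<^sup>2) / 2 \<le> u z"
      using above'[OF zS] \<nu>1 by (simp add: q_def za dot_square_norm[of "\<nu> y"] power2_eq_square)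
    moreover have "((R - t)\<^sup>2 - R\<^sup>2) / 2 = - t * (R - t / 2)" by (simp add: power2_eq_square field_simps)
    ultimately have "t * (Du z \<bullet> \<nu> y) < t * (R - t / 2)" by simp
    then have "Du z \<bullet> \<nu> y < R - t / 2" using t(1) by simp
    then show ?thesis using t(1) by (simp add: z_def)
  qed
  \<comment> \<open>The bound at the interior points \<open>y - t \<nu>(y)\<close> is carried to \<open>y\<close> by continuity of the gradient.\<close>
  have "((\<lambda>t. y - t *\<^sub>R \<nu> y) \<longlongrightarrow> y - 0 *\<^sub>R \<nu> y) (at_right 0)" by (intro tendsto_intros)
  moreover have ev: "eventually (\<lambda>t. 0 < t \<and> t < d) (at_right 0)"
    using d(1) by (auto simp: eventually_at_right_field)
  then have "eventually (\<lambda>t. y - t *\<^sub>R \<nu> y \<in> S \<and> y - t *\<^sub>R \<nu> y \<noteq> y) (at_right 0)"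
    by eventually_elim (use inS \<nu>1 in auto)
  ultimately have "filterlim (\<lambda>t. y - t *\<^sub>R \<nu> y) (at y within S) (at_right 0)"
    by (simp add: filterlim_at)
  moreover have "((\<lambda>z. Du z \<bullet> \<nu> y) \<longlongrightarrow> Du y \<bullet> \<nu> y) (at y within S)"
    using continuous_on_gradient yS(1) by (intro tendsto_intros) (auto simp: continuous_on_def)
  ultimately have "((\<lambda>t. Du (y - t *\<^sub>R \<nu> y) \<bullet> \<nu> y) \<longlongrightarrow> Du y \<bullet> \<nu> y) (at_right 0)"
    using filterlim_compose by blast
  moreover have "eventually (\<lambda>t. Du (y - t *\<^sub>R \<nu> y) \<bullet> \<nu> y \<le> R) (at_right 0)"
    using ev by eventually_elim (use le in auto)
  ultimately have "Du y \<bullet> \<nu> y \<le> R" by (intro tendsto_upperbound) auto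
  then show ?thesis by (simp add: Du\<nu>)
qed

lemma level_0: "level 0 = frontier \<Omega>"
  using u_eq_0_iff by (auto simp: level_def frontier_eq)

lemma sublevel_0: "sublevel 0 = S"
  using u_nonpos by (auto simp: sublevel_def)

text \<open>
  The rolling argument needs principal curvatures strictly below \<open>1/r\<close>, hence radii \<open>r < 1 / M\<close>.
\<close>

lemma gradient_lower_bound:
  assumes c: "c \<le> 0" "z0 \<in> S" "u z0 < c" and M: "M > 0" "\<And>x. x \<in> level c \<Longrightarrow> max_curvature S u x \<le> M"
    and y: "y \<in> level c"
  shows "1 / M \<le> norm (Du y)"
proof (rule ccontr)
  assume "\<not> ?thesis"
  then have lt: "norm (Du y) < 1 / M" by simp
  define r where "r = (norm (Du y) + 1 / M) / 2"
  have r: "0 < r" "norm (Du y) < r" "r < 1 / M" using lt M(1) by (auto simp: r_def add_nonneg_pos)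
  have gradnz: "Du x \<noteq> 0" if "x \<in> level c" for x
    using that gradient_nonzero[of x z0] c by (auto simp: level_def)
  have "cball (y - r *\<^sub>R \<nu> y) r \<subseteq> sublevel c"
  proof (rule inner_ball[OF c _ y])
    fix x v assume x: "x \<in> level c" and v: "v \<in> tangent x" "v \<noteq> 0"
    have xS: "x \<in> S" using x by (simp add: level_def)
    have "r * (shape x v \<bullet> shape x v) \<le> r * (M * (v \<bullet> shape x v))"
      using r(1) shape_norm_le[OF xS gradnz[OF x] M(2)[OF x] v(1)] by (intro mult_left_mono) auto
    also have "\<dots> = (r * M) * (v \<bullet> shape x v)" by simp
    also have "\<dots> < 1 * (v \<bullet> shape x v)"
      using r(3) M(1) shape_positive[OF xS gradnz[OF x] v] by (intro mult_strict_right_mono) (auto simp: field_simps)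
    finally show "r * (shape x v \<bullet> shape x v) < v \<bullet> shape x v" by simp
  qed
  from gradient_ge_inner_radius[OF y gradnz[OF y] r(1) this] show False using r(2) by simp
qed

lemma boundary_gradient_upper_bound:
  assumes m: "m > 0" "\<And>x. x \<in> frontier \<Omega> \<Longrightarrow> m \<le> min_curvature S u x"
    and y: "y \<in> frontier \<Omega>"
  shows "norm (Du y) \<le> 1 / m"
proof (rule ccontr)
  assume "\<not> ?thesis"
  then have lt: "1 / m < norm (Du y)" by simp
  define R where "R = (norm (Du y) + 1 / m) / 2"
  have R: "0 < R" "R < norm (Du y)" "1 / m < R" using lt m(1) by (auto simp: R_def add_nonneg_pos)
  obtain z0 where z0: "z0 \<in> \<Omega>" using nonempty by blast
  have c: "(0::real) \<le> 0" "z0 \<in> S" "u z0 < 0" using z0 u_negative domain_subset by auto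
  have "sublevel 0 \<subseteq> cball (y - R *\<^sub>R \<nu> y) R"
  proof (rule outer_ball[OF c])
    show "y \<in> level 0" using y level_0 by simp
    show "0 \<le> R" using R by simp
    fix x v assume x: "x \<in> level 0" and v: "v \<in> tangent x" "v \<noteq> 0"
    have xf: "x \<in> frontier \<Omega>" using x level_0 by simp
    have xS: "x \<in> S" using x by (simp add: level_def)
    note nz = boundary_gradient_nonzero[OF xf]
    have "1 * (v \<bullet> shape x v) < (R * m) * (v \<bullet> shape x v)"
      using R(3) m(1) shape_positive[OF xS nz v] by (intro mult_strict_right_mono) (auto simp: field_simps)
    also have "\<dots> = R * (m * (v \<bullet> shape x v))" by simp
    also have "\<dots> \<le> R * (shape x v \<bullet> shape x v)"
      using R(1) shape_norm_ge[OF xS nz m(2)[OF xf] v(1)] by (intro mult_left_mono) auto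
    finally show "v \<bullet> shape x v < R * (shape x v \<bullet> shape x v)" by simp
  qed
  then have "S \<subseteq> cball (y - R *\<^sub>R \<nu> y) R" by (simp add: sublevel_0)
  from gradient_le_outer_radius[OF y R(1) this] show False using R(2) by simp
qed

text \<open>
  Let \<open>y\<close> be the support point of the sublevel set with the same gradient direction as \<open>x\<close>. Strict
  monotonicity of the gradient between \<open>x\<close> and \<open>y\<close> then compares the two lengths.
\<close>

lemma gradient_larger_above_level:
  assumes c: "c \<le> 0" "z0 \<in> S" "u z0 < c" and x: "x \<in> S" "c \<le> u x"
  shows "\<exists>y\<in>level c. norm (Du y) \<le> norm (Du x)"
proof (cases "u x = c")
  case True
  then show ?thesis using x by (auto simp: level_def)
next
  case False
  have nz: "Du x \<noteq> 0" using gradient_nonzero[OF x(1) c(2)] c(3) x(2) by simp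
  obtain y l where y: "y \<in> level c" "l > 0" "Du y = l *\<^sub>R Du x"
    using support_point_exists[OF c nz] by blast
  have yS: "y \<in> S" "u y = c" using y by (auto simp: level_def)
  have ne: "x \<noteq> y" using False yS by auto
  have "Du x \<bullet> (y - x) < Du (x + (y - x)) \<bullet> (y - x)"
    using ne x yS by (intro gradient_strict_mono) auto
  then have "(l - 1) * (Du x \<bullet> (y - x)) > 0" using y(3) by (simp add: algebra_simps)
  moreover have "Du x \<bullet> (y - x) < 0"
    using u_above_tangent[OF x(1) yS(1) ne] yS(2) x(2) by simp
  ultimately have "l \<le> 1" by (simp add: zero_less_mult_iff)
  then have "norm (Du y) \<le> norm (Du x)" using y by (simp add: mult_left_le_one_le)
  then show ?thesis using y(1) by blast
qed

section \<open>Curvature estimates\<close>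

lemma critical_point_exists: "\<exists>x\<in>\<Omega>. Du x = 0"
proof -
  have "S \<noteq> {}" using nonempty by simp
  then obtain m where m: "m \<in> S" "\<And>z. z \<in> S \<Longrightarrow> u m \<le> u z"
    using continuous_attains_inf[OF compact_S _ continuous_on_u] by blast
  obtain z where z: "z \<in> \<Omega>" using nonempty by blast
  have "u m < 0" using m(2)[OF domain_subset[OF z]] u_negative[OF z] by simp
  then have mO: "m \<in> \<Omega>" using m(1) boundary_value by (cases "m \<in> \<Omega>") (auto simp: frontier_eq)
  have "Du m = 0"
  proof (rule ccontr)
    assume "Du m \<noteq> 0"
    then have "Du m \<bullet> (- Du m) < 0" by simp
    then obtain d where d: "d > 0" "\<forall>t. 0 < t \<and> t < d \<longrightarrow> m + t *\<^sub>R (- Du m) \<in> \<Omega> \<and> u (m + t *\<^sub>R (- Du m)) < u m"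
      using descent_direction[OF m(1)] by blast
    then have "m + (d/2) *\<^sub>R (- Du m) \<in> \<Omega> \<and> u (m + (d/2) *\<^sub>R (- Du m)) < u m" by auto
    then show False using m(2) domain_subset by force
  qed
  then show ?thesis using mO by blast
qed

lemma attains_max_only_on_boundary:
  assumes f: "continuous_on S f" and nomax: "\<And>x. x \<in> \<Omega> \<Longrightarrow> (\<And>y. y \<in> \<Omega> \<Longrightarrow> f y \<le> f x) \<Longrightarrow> False"
  shows "attains_max_only_on f S (frontier \<Omega>)"
  unfolding attains_max_only_on_def
proof (intro conjI ballI impI)
  show "\<exists>x\<in>S. \<forall>y\<in>S. f y \<le> f x"
    using nonempty by (intro continuous_attains_sup compact_S f) auto
  fix x assume x: "x \<in> S" "\<forall>y\<in>S. f y \<le> f x"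
  show "x \<in> frontier \<Omega>"
  proof (rule ccontr)
    assume "x \<notin> frontier \<Omega>"
    then have "x \<in> \<Omega>" using x(1) by (simp add: frontier_eq)
    then show False using nomax[of x] x(2) domain_subset by blast
  qed
qed

text \<open>
  On the boundary the equation holds by continuity of the second derivatives.
\<close>

lemma det_hessian:
  assumes "x \<in> S"
  shows "det (A x) = 1"
proof -
  have cont: "continuous_on S (\<lambda>x. det (A x))"
    unfolding continuous_on_def
  proof (intro ballI tendsto_det)
    fix x i j assume "x \<in> S"
    then show "((\<lambda>t. A t $ i $ j) \<longlongrightarrow> A x $ i $ j) (at x within S)"
      unfolding hessian_component using continuous_on_D[of "[i, j]"] by (simp add: continuous_on_def)
  qed
  show ?thesis
    using continuous_constant_on_closure[OF cont, of 1 x] det_eq assms by blast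
qed

lemma \<phi>_eq:
  assumes x: "x \<in> S"
  shows "(\<Sum>k\<in>UNIV. \<Sum>l\<in>UNIV. elem_sym_pderiv CARD('n) (A x) k l * Du x $ k * Du x $ l) = \<phi> x"
  using elem_sym_pderiv_card_quadratic_form[OF transpose_hessian[OF x] hessian_dual_gradient[OF x]]
  by (simp only: det_hessian[OF x] \<phi>_def mult_1)

lemma \<psi>_eq: "(\<Sum>k\<in>UNIV. \<Sum>l\<in>UNIV. elem_sym_pderiv 2 (A x) k l * Du x $ k * Du x $ l) = \<psi> x"
  using elem_sym_pderiv_2_quadratic_form[OF dim] by (simp add: \<psi>_def)

lemma continuous_on_\<phi>: "continuous_on S \<phi>"
proof -
  have cofactor: "continuous_on S (\<lambda>x. det (\<chi> i. if i = k then axis l 1 else A x $ i))" for k l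
    unfolding continuous_on_def
  proof (intro ballI tendsto_det)
    fix x i j assume "x \<in> S"
    then have "((\<lambda>t. A t $ i $ j) \<longlongrightarrow> A x $ i $ j) (at x within S)"
      unfolding hessian_component using continuous_on_D[of "[i, j]"] by (simp add: continuous_on_def)
    then show "((\<lambda>t. (\<chi> i. if i = k then axis l 1 else A t $ i) $ i $ j) \<longlongrightarrow> (\<chi> i. if i = k then axis l 1 else A x $ i) $ i $ j) (at x within S)"
      by (cases "i = k") auto
  qed
  have Du: "continuous_on S (\<lambda>x. Du x $ k)" for k
    unfolding gradient_component by (rule continuous_on_D)
  have "continuous_on S (\<lambda>x. \<Sum>k\<in>UNIV. \<Sum>l\<in>UNIV. elem_sym_pderiv CARD('n) (A x) k l * Du x $ k * Du x $ l)"
    unfolding elem_sym_pderiv_card by (intro continuous_on_sum continuous_on_mult cofactor Du)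
  then show ?thesis using \<phi>_eq by (simp cong: continuous_on_cong)
qed

lemma continuous_on_\<psi>: "continuous_on S \<psi>"
  unfolding \<psi>_def trace_def inner_vec_def matrix_vector_mult_def vec_lambda_beta hessian_component gradient_component inner_real_def
  by (intro continuous_intros continuous_on_D)

text \<open>
  A principal curvature is a Rayleigh quotient of the Hessian divided by \<open>|Du|\<close>, a continuous
  positive function on a compact set. This makes the suprema and infima of curvatures in the
  estimate finite and positive.
\<close>

lemma principal_curvature_bounds:
  assumes T: "compact T" "T \<subseteq> S" "\<And>x. x \<in> T \<Longrightarrow> Du x \<noteq> 0"
  shows "\<exists>a>0. \<exists>b. \<forall>x\<in>T. \<forall>k\<in>principal_curvatures S u x. a \<le> k \<and> k \<le> b"
proof (cases "T = {}")
  case False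
  define g where "g p = (snd p \<bullet> (A (fst p) *v snd p)) / norm (Du (fst p))" for p :: "(real^'n) \<times> (real^'n)"
  let ?K = "T \<times> sphere (0::real^'n) 1"
  have K: "compact ?K" using T(1) by (intro compact_Times compact_sphere)
  obtain e :: "real^'n" where "norm e = 1" using vector_choose_size[of 1] by auto
  then have ne: "?K \<noteq> {}" using False by auto
  have fst: "continuous_on ?K (\<lambda>p. D ks (fst p))" for ks
    using T(2) by (intro continuous_on_compose2[OF continuous_on_D]) (auto intro!: continuous_intros)
  have Dufst: "continuous_on ?K (\<lambda>p. Du (fst p))"
    using T(2) by (intro continuous_on_compose2[OF continuous_on_gradient]) (auto intro!: continuous_intros)
  have num: "continuous_on ?K (\<lambda>p. snd p \<bullet> (A (fst p) *v snd p))"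
    unfolding inner_vec_def matrix_vector_mult_def vec_lambda_beta hessian_component inner_real_def
    by (intro continuous_intros fst)
  have g: "continuous_on ?K g"
    unfolding g_def using T(3) by (intro continuous_on_divide num continuous_on_norm Dufst) auto
  obtain p0 where p0: "p0 \<in> ?K" "\<And>p. p \<in> ?K \<Longrightarrow> g p0 \<le> g p"
    using continuous_attains_inf[OF K ne g] by blast
  obtain p1 where p1: "p1 \<in> ?K" "\<And>p. p \<in> ?K \<Longrightarrow> g p \<le> g p1"
    using continuous_attains_sup[OF K ne g] by blast
  have "g p0 > 0"
  proof -
    have "fst p0 \<in> S" "Du (fst p0) \<noteq> 0" "snd p0 \<noteq> 0" using p0(1) T by auto
    then show ?thesis using positive_definite_hessian by (simp add: g_def positive_definite_def)
  qed
  moreover have "g p0 \<le> k \<and> k \<le> g p1" if x: "x \<in> T" and k: "k \<in> principal_curvatures S u x" for x k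
  proof -
    obtain v where v: "norm v = 1" "v \<in> tangent x" "k = (v \<bullet> (A x *v v)) / norm (Du x)"
      using principal_curvature_rayleigh[OF _ T(3)[OF x] k] x T(2) by blast
    have "(x, v) \<in> ?K" "g (x, v) = k" using x v by (auto simp: g_def)
    then show ?thesis using p0(2) p1(2) by metis
  qed
  ultimately show ?thesis by blast
qed (intro exI[of _ 1], auto)

lemma curvature_bounds:
  assumes T: "compact T" "T \<subseteq> S" "\<And>x. x \<in> T \<Longrightarrow> Du x \<noteq> 0"
  shows "\<exists>a>0. \<exists>b. \<forall>x\<in>T. a \<le> min_curvature S u x \<and> min_curvature S u x \<le> max_curvature S u x \<and> max_curvature S u x \<le> b"
proof -
  obtain a b where ab: "a > 0" "\<And>x k. x \<in> T \<Longrightarrow> k \<in> principal_curvatures S u x \<Longrightarrow> a \<le> k \<and> k \<le> b"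
    using principal_curvature_bounds[OF T] by blast
  have "a \<le> min_curvature S u x \<and> min_curvature S u x \<le> max_curvature S u x \<and> max_curvature S u x \<le> b" if x: "x \<in> T" for x
  proof -
    have fin: "finite (principal_curvatures S u x)" "principal_curvatures S u x \<noteq> {}"
      using finite_principal_curvatures x T by blast+
    then have "Min (principal_curvatures S u x) \<in> principal_curvatures S u x"
      "Max (principal_curvatures S u x) \<in> principal_curvatures S u x" by auto
    then show ?thesis using ab(2)[OF x] fin unfolding min_curvature_def max_curvature_def by auto
  qed
  then show ?thesis using ab(1) by blast
qed

lemma frontier_sublevel:
  assumes c: "z0 \<in> \<Omega>" "u z0 < c" "c < 0"
  shows "frontier {x \<in> \<Omega>. u x < c} = level c"
proof -
  let ?O = "{x \<in> \<Omega>. u x < c}"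
  have op: "open ?O"
  proof -
    have "continuous_on \<Omega> u" using continuous_on_subset[OF continuous_on_u closure_subset] .
    then have "open (\<Omega> \<inter> u -` {..<c})" using open_domain by (intro continuous_open_preimage) auto
    moreover have "\<Omega> \<inter> u -` {..<c} = ?O" by auto
    ultimately show ?thesis by (simp only:)
  qed
  have sub: "closure ?O \<subseteq> sublevel c"
    using domain_subset by (intro closure_minimal compact_imp_closed compact_sublevel) (auto simp: sublevel_def)
  have levelO: "x \<in> \<Omega>" if "x \<in> level c" for x
    using that c(3) boundary_value by (cases "x \<in> \<Omega>") (auto simp: level_def frontier_eq)
  have "x \<in> closure ?O" if x: "x \<in> level c" for x
  proof -
    have xS: "x \<in> S" "u x = c" using x by (auto simp: level_def)
    have "Du x \<noteq> 0" using gradient_nonzero[OF xS(1) domain_subset[OF c(1)]] c(2) xS(2) by simp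
    then have "Du x \<bullet> (- Du x) < 0" by simp
    then obtain d where d: "d > 0" "\<forall>t. 0 < t \<and> t < d \<longrightarrow> x + t *\<^sub>R (- Du x) \<in> \<Omega> \<and> u (x + t *\<^sub>R (- Du x)) < u x"
      using descent_direction[OF xS(1)] by blast
    have "((\<lambda>t. x + t *\<^sub>R (- Du x)) \<longlongrightarrow> x + 0 *\<^sub>R (- Du x)) (at_right 0)" by (intro tendsto_intros)
    moreover have "eventually (\<lambda>t. x + t *\<^sub>R (- Du x) \<in> ?O) (at_right 0)"
      using d xS(2) by (auto simp: eventually_at_right_field)
    ultimately show ?thesis
      using Lim_in_closed_set[OF closed_closure, of "\<lambda>t. x + t *\<^sub>R (- Du x)" ?O "at_right 0"]
      by (metis (mono_tags, lifting) add.right_neutral closure_subset eventually_mono scale_zero_left subsetD trivial_limit_at_right_real)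
  qed
  moreover have "x \<in> level c" if "x \<in> closure ?O" "x \<notin> ?O" for x
  proof -
    have x: "x \<in> S" "u x \<le> c" using sub that(1) by (auto simp: sublevel_def)
    then have "x \<in> \<Omega>" using c(3) boundary_value by (cases "x \<in> \<Omega>") (auto simp: frontier_eq)
    then show ?thesis using that(2) x by (auto simp: level_def)
  qed
  moreover have "x \<notin> ?O" if "x \<in> level c" for x using that by (auto simp: level_def)
  moreover have "frontier ?O = closure ?O - ?O" by (simp only: frontier_def interior_open[OF op])
  ultimately show ?thesis by blast
qed

text \<open>
  The common part of both estimates, for \<open>f = \<kappa>|Du|\<^sup>p\<close>: it is applied to \<open>\<phi>\<close> with \<open>p = n + 1\<close> and to
  \<open>\<psi>\<close> with \<open>p = 3\<close>. Vanishing at the critical point ensures that the maximum of \<open>f\<close> is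
  nonnegative, hence that the supremum of \<open>\<kappa>\<close> is.
\<close>

theorem curvature_estimate:
  fixes f \<kappa> :: "real^'n \<Rightarrow> real" and p :: nat
  assumes f: "continuous_on S f" and nomax: "\<And>x. x \<in> \<Omega> \<Longrightarrow> (\<And>y. y \<in> \<Omega> \<Longrightarrow> f y \<le> f x) \<Longrightarrow> False"
    and crit: "\<And>x. x \<in> S \<Longrightarrow> Du x = 0 \<Longrightarrow> f x = 0"
    and \<kappa>: "\<And>x. x \<in> S \<Longrightarrow> \<kappa> x = f x / norm (Du x) ^ p" and p: "p \<le> CARD('n) + 1"
    and c: "(INF x\<in>\<Omega>. u x) < c" "c < 0" and x: "x \<in> \<Omega>" "c \<le> u x"
  shows "\<kappa> x < (SUP y\<in>frontier \<Omega>. \<kappa> y) * (SUP y\<in>frontier {x \<in> \<Omega>. u x < c}. max_curvature S u y ^ (CARD('n) + 1))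
                / (INF y\<in>frontier \<Omega>. min_curvature S u y ^ (CARD('n) + 1))"
proof -
  define N where "N = CARD('n) + 1"
  have N: "N > 0" by (simp add: N_def)
  have "bdd_below (u ` \<Omega>)"
    using bounded_imp_bdd_below[OF compact_imp_bounded[OF compact_continuous_image[OF continuous_on_u compact_S]]]
    by (rule bdd_below_mono) (use closure_subset in blast)
  then obtain z0 where z0: "z0 \<in> \<Omega>" "u z0 < c"
    using c(1) cINF_less_iff[of \<Omega> u c] nonempty by blast
  have c': "c \<le> 0" "z0 \<in> S" "u z0 < c" using c z0 domain_subset by auto
  define I where "I = (INF y\<in>frontier \<Omega>. min_curvature S u y ^ N)"
  define G where "G = (SUP y\<in>level c. max_curvature S u y ^ N)"
  define K where "K = (SUP y\<in>frontier \<Omega>. \<kappa> y)"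
  have fr: "compact (frontier \<Omega>)" "frontier \<Omega> \<subseteq> S"
    using compact_frontier_bounded[OF bounded_domain] by (auto simp: frontier_eq)
  have lv: "level c \<subseteq> S" by (auto simp: level_def)
  have lvnz: "Du y \<noteq> 0" if "y \<in> level c" for y
    using that gradient_nonzero[of y z0] c' by (auto simp: level_def)
  obtain a b where ab: "a > 0" "\<And>y. y \<in> frontier \<Omega> \<Longrightarrow> a \<le> min_curvature S u y \<and> min_curvature S u y \<le> max_curvature S u y \<and> max_curvature S u y \<le> b"
    using curvature_bounds[OF fr boundary_gradient_nonzero] by blast
  obtain a' b' where ab': "a' > 0" "\<And>y. y \<in> level c \<Longrightarrow> a' \<le> min_curvature S u y \<and> min_curvature S u y \<le> max_curvature S u y \<and> max_curvature S u y \<le> b'"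
    using curvature_bounds[OF compact_level lv lvnz] by blast
  have "a ^ N \<le> I"
    unfolding I_def using ab boundary_nonempty by (intro cINF_greatest power_mono) (auto intro: less_imp_le)
  then have I: "I > 0" using ab(1) by (meson less_le_trans zero_less_power)
  define m where "m = root N I"
  have m: "m > 0" "m ^ N = I" using I N by (auto simp: m_def)
  have m_le: "m \<le> min_curvature S u y" if y: "y \<in> frontier \<Omega>" for y
  proof -
    have pos: "min_curvature S u y > 0" using ab y by force
    have "I \<le> min_curvature S u y ^ N"
      unfolding I_def using ab y
      by (intro cINF_lower bdd_belowI2[of _ 0]) (force intro: zero_le_power)+
    then show ?thesis using m pos by (metis N less_imp_le power_le_imp_le_base power_mono_iff)
  qed
  have bddG: "bdd_above ((\<lambda>y. max_curvature S u y ^ N) ` level c)"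
    using ab' by (intro bdd_aboveI2[of _ _ "b' ^ N"] power_mono) force+
  obtain y0 where y0: "y0 \<in> level c" using gradient_larger_above_level[OF c' domain_subset[OF x(1)] x(2)] by blast
  have "a' ^ N \<le> max_curvature S u y0 ^ N" using ab' y0 by (intro power_mono) force+
  also have "\<dots> \<le> G" unfolding G_def using y0 bddG by (rule cSUP_upper)
  finally have G: "G > 0" using ab'(1) by (meson less_le_trans zero_less_power)
  define M where "M = root N G"
  have M: "M > 0" "M ^ N = G" using G N by (auto simp: M_def)
  have le_M: "max_curvature S u y \<le> M" if y: "y \<in> level c" for y
  proof -
    have "max_curvature S u y ^ N \<le> M ^ N" unfolding M(2) G_def using y bddG by (rule cSUP_upper)
    moreover have "M ^ N < max_curvature S u y ^ N" if "M < max_curvature S u y"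
      using that M(1) N by (intro power_strict_mono) auto
    ultimately show ?thesis by linarith
  qed
  have lower: "1 / M \<le> norm (Du y)" if y: "y \<in> S" "c \<le> u y" for y
    using gradient_larger_above_level[OF c' y] gradient_lower_bound[OF c' M(1) le_M] by force
  have upper: "norm (Du y) \<le> 1 / m" if "y \<in> frontier \<Omega>" for y
    using boundary_gradient_upper_bound[OF m(1) m_le that] .
  note att = attains_max_only_on_boundary[OF f nomax, unfolded attains_max_only_on_def]
  obtain q where q: "q \<in> S" "\<forall>y\<in>S. f y \<le> f q"
    by (rule bexE[OF conjunct1[OF att]])
  have "q \<in> frontier \<Omega>" by (rule mp[OF bspec[OF conjunct2[OF att] q(1)] q(2)])
  note q = q(1) bspec[OF q(2)] this
  have fx: "f x < f q"
  proof (rule ccontr)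
    assume "\<not> f x < f q"
    then have "f y \<le> f x" if "y \<in> \<Omega>" for y using q(2)[OF domain_subset[OF that]] by simp
    then show False using nomax[OF x(1)] by blast
  qed
  have fq: "f q \<ge> 0" using critical_point_exists crit q(2) domain_subset by metis
  have qnz: "norm (Du q) > 0" using boundary_gradient_nonzero[OF q(3)] by simp
  have cont\<kappa>: "continuous_on (frontier \<Omega>) \<kappa>"
  proof -
    have "continuous_on (frontier \<Omega>) (\<lambda>x. f x / norm (Du x) ^ p)"
      using boundary_gradient_nonzero fr(2)
      by (intro continuous_intros continuous_on_subset[OF f] continuous_on_subset[OF continuous_on_gradient]) auto
    then show ?thesis using \<kappa> fr(2) by (subst continuous_on_cong[OF refl]) auto
  qed
  have bddK: "bdd_above (\<kappa> ` frontier \<Omega>)"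
    by (rule bounded_imp_bdd_above[OF compact_imp_bounded[OF compact_continuous_image[OF cont\<kappa> fr(1)]]])
  have \<kappa>q: "\<kappa> q \<le> K" unfolding K_def using q(3) bddK by (rule cSUP_upper)
  have "\<kappa> q \<ge> 0" using \<kappa>[OF q(1)] fq by simp
  then have K: "K \<ge> 0" using \<kappa>q by simp
  have "f q = \<kappa> q * norm (Du q) ^ p" using \<kappa>[OF q(1)] qnz by simp
  also have "\<dots> \<le> K * (1 / m) ^ p"
    using \<kappa>q K upper[OF q(3)] by (intro mult_mono power_mono) auto
  finally have fqK: "f q \<le> K * (1 / m) ^ p" .
  have xM: "1 / M \<le> norm (Du x)" by (rule lower[OF domain_subset[OF x(1)] x(2)])
  then have xnz: "norm (Du x) > 0" using M(1) by (meson less_le_trans zero_less_divide_1_iff)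
  have "\<kappa> x = f x / norm (Du x) ^ p" by (rule \<kappa>[OF domain_subset[OF x(1)]])
  also have "\<dots> < f q / norm (Du x) ^ p" using fx xnz by (intro divide_strict_right_mono) auto
  also have "\<dots> \<le> f q / (1 / M) ^ p"
    using xM M(1) fq by (intro divide_left_mono power_mono mult_pos_pos zero_less_power) (auto simp: xnz)
  also have "\<dots> = f q * M ^ p" by (simp add: power_divide)
  also have "\<dots> \<le> K * (1 / m) ^ p * M ^ p" using fqK M(1) by (intro mult_right_mono) auto
  also have "\<dots> = K * (M / m) ^ p" by (simp add: power_divide)
  also have "\<dots> \<le> K * (M / m) ^ N"
  proof -
    \<comment> \<open>At the boundary point \<open>q\<close> both gradient bounds apply, so \<open>M / m \<ge> 1\<close> and a higher power only increases the bound.\<close>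
    have "c \<le> u q" using q(3) boundary_value c(2) by auto
    then have "1 / M \<le> 1 / m" using lower[OF q(1)] upper[OF q(3)] by linarith
    then have "1 \<le> M / m" using m(1) M(1) by (simp add: field_simps)
    then show ?thesis using K p by (intro mult_left_mono power_increasing) (auto simp: N_def)
  qed
  also have "\<dots> = K * G / I" by (simp add: power_divide m(2) M(2))
  finally show ?thesis
    by (simp add: K_def G_def I_def N_def frontier_sublevel[OF z0 c(2)])
qed

end

lemma attains_max_only_on_cong:
  assumes "\<And>x. x \<in> A \<Longrightarrow> f x = g x"
  shows "attains_max_only_on f A B \<longleftrightarrow> attains_max_only_on g A B"
  using assms by (simp add: attains_max_only_on_def)

theorem corollary1p3:
  fixes \<Omega> :: "(real^'n) set" and u :: "real^'n \<Rightarrow> real"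
  defines "K \<equiv> gauss_curvature (closure \<Omega>) u"
    and "H \<equiv> mean_curvature (closure \<Omega>) u"
    and "\<kappa>m \<equiv> min_curvature (closure \<Omega>) u"
    and "\<kappa>M \<equiv> max_curvature (closure \<Omega>) u"
    and "Du \<equiv> gradient (closure \<Omega>) u"
  assumes "CARD('n) \<ge> 2"
    and "bounded \<Omega>" and "strictly_convex_domain \<Omega>" and "smooth_boundary \<Omega>"
    and "smooth_within (closure \<Omega>) u" and "strictly_convex_function (closure \<Omega>) u"
    and "\<forall>x\<in>\<Omega>. det (hessian (closure \<Omega>) u x) = 1"
    and "\<forall>x\<in>frontier \<Omega>. u x = 0"
  shows "attains_max_only_on (\<lambda>x. K x * norm (Du x) ^ (CARD('n) + 1)) (closure \<Omega>) (frontier \<Omega>) \<and>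
    attains_max_only_on (\<lambda>x. H x * norm (Du x) ^ 3) (closure \<Omega>) (frontier \<Omega>) \<and>
    (\<forall>c \<Omega>'. (INF x\<in>\<Omega>. u x) < c \<longrightarrow> c < 0 \<longrightarrow> \<Omega>' = {x\<in>\<Omega>. u x < c} \<longrightarrow>
      (\<forall>x\<in>\<Omega> - \<Omega>'.
        K x < (SUP y\<in>frontier \<Omega>. K y) * (SUP y\<in>frontier \<Omega>'. \<kappa>M y ^ (CARD('n) + 1))
                / (INF y\<in>frontier \<Omega>. \<kappa>m y ^ (CARD('n) + 1)) \<and>
        H x < (SUP y\<in>frontier \<Omega>. H y) * (SUP y\<in>frontier \<Omega>'. \<kappa>M y ^ (CARD('n) + 1))
                / (INF y\<in>frontier \<Omega>. \<kappa>m y ^ (CARD('n) + 1))))"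
proof -
  interpret monge_ampere_solution \<Omega> u
    by standard (use assms(6-) in auto)
  have K: "K x = \<phi> x / norm (Du x) ^ (CARD('n) + 1)" if "x \<in> closure \<Omega>" for x
    unfolding K_def Du_def gauss_curvature_def \<phi>_eq[OF that] ..
  have H: "H x = \<psi> x / norm (Du x) ^ 3" for x
    unfolding H_def Du_def mean_curvature_def \<psi>_eq ..
  have crit: "\<phi> x = 0" "\<psi> x = 0" if "Du x = 0" for x
    using that by (simp_all add: \<phi>_def \<psi>_def Du_def)
  have K\<phi>: "K x * norm (Du x) ^ (CARD('n) + 1) = \<phi> x" if "x \<in> closure \<Omega>" for x
    unfolding K[OF that] using crit[of x] by (cases "Du x = 0") auto
  have H\<psi>: "H x * norm (Du x) ^ 3 = \<psi> x" if "x \<in> closure \<Omega>" for x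
    unfolding H using crit[of x] by (cases "Du x = 0") auto
  have maxK: "attains_max_only_on (\<lambda>x. K x * norm (Du x) ^ (CARD('n) + 1)) (closure \<Omega>) (frontier \<Omega>)"
    using attains_max_only_on_boundary[OF continuous_on_\<phi> \<phi>_no_interior_max]
    by (subst attains_max_only_on_cong[where g = \<phi>]) (simp_all only: K\<phi>)
  have maxH: "attains_max_only_on (\<lambda>x. H x * norm (Du x) ^ 3) (closure \<Omega>) (frontier \<Omega>)"
    using attains_max_only_on_boundary[OF continuous_on_\<psi> \<psi>_no_interior_max]
    by (subst attains_max_only_on_cong[where g = \<psi>]) (simp_all only: H\<psi>)
  have estK: "K x < (SUP y\<in>frontier \<Omega>. K y) * (SUP y\<in>frontier {x\<in>\<Omega>. u x < c}. \<kappa>M y ^ (CARD('n) + 1))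
                / (INF y\<in>frontier \<Omega>. \<kappa>m y ^ (CARD('n) + 1))"
    if "(INF x\<in>\<Omega>. u x) < c" "c < 0" "x \<in> \<Omega>" "c \<le> u x" for c x
    unfolding \<kappa>M_def \<kappa>m_def
    by (rule curvature_estimate[OF continuous_on_\<phi> \<phi>_no_interior_max crit(1) K[unfolded Du_def] _ that])
       (auto simp: Du_def)
  have estH: "H x < (SUP y\<in>frontier \<Omega>. H y) * (SUP y\<in>frontier {x\<in>\<Omega>. u x < c}. \<kappa>M y ^ (CARD('n) + 1))
                / (INF y\<in>frontier \<Omega>. \<kappa>m y ^ (CARD('n) + 1))"
    if "(INF x\<in>\<Omega>. u x) < c" "c < 0" "x \<in> \<Omega>" "c \<le> u x" for c x
    unfolding \<kappa>M_def \<kappa>m_def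
    by (rule curvature_estimate[OF continuous_on_\<psi> \<psi>_no_interior_max crit(2) H[unfolded Du_def] _ that])
       (use assms(6) in \<open>auto simp: Du_def\<close>)
  show ?thesis using maxK maxH estK estH by (auto simp: not_less)
qed

end
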